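(* Let $X=\{X_t:t\ge 0\}$ be a real-valued Lévy process, let $K>0$ and $r\ge 0$, and for $x\in\mathbb{R}$ let $$v(x)=\sup_{\tau\in\mathcal{T}_{0,\infty}}\mathbb{E}_x\big[e^{-r\tau}(K-e^{X_\tau})^+\big],$$ where $\mathcal{T}_{0,\infty}$ is the family of all stopping times. Assume that either $r>0$, or $r=0$ and $\mathbb{P}(\lim_{t\uparrow\infty}X_t=\infty)=1$. Let $$x^*=\log\big(K\,\mathbb{E}[e^{\underline{X}_{\mathbf{e}_r}}]\big).$$ Then the right derivative of $v$ at $x^*$ exists and is given by $$v'(x^*+)=-e^{x^*}+K\,\mathbb{P}(\underline{X}_{\mathbf{e}_r}=0).$$ Consequently, the optimal stopping problem exhibits smooth pasting at $x^*$ if and only if $0$ is regular for $(-\infty,0)$ for $X$.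
   Context: $X$ is a Lévy process on a filtered probability space $(\Omega,\mathcal{F},\{\mathcal{F}_t\},\mathbb{P})$ satisfying the usual conditions. $\mathbb{P}_x$ (with expectation $\mathbb{E}_x$) denotes the law of $X$ started at $x\in\mathbb{R}$, and $\mathbb{P}=\mathbb{P}_0$, $\mathbb{E}=\mathbb{E}_0$. $\mathcal{T}_{0,\infty}$ is the family of $[0,\infty]$-valued stopping times with respect to $\{\mathcal{F}_t:t\ge0\}$, the payoff $e^{-r\tau}(K-e^{X_\tau})^+$ being taken as $0$ on $\{\tau=\infty\}$. Notation: $\underline{X}_t=\inf_{0\le s\le t}X_s$ and $\underline{X}_\infty=\inf_{s\ge 0}X_s$. For $r>0$, $\mathbf{e}_r$ is an exponentially distributed random variable with parameter $r$ (mean $1/r$) independent of $X$; for $r=0$, $\mathbf{e}_0=\infty$ almost surely. The number $x^*$ is the optimal stopping boundary. Smooth pasting at $x^*$ means that $v$ pastes onto the lower bounding curve $x\mapsto(K-e^x)^+$ at $x^*$ (i.e. $v(x^* )=(K-e^{x^*})^+$) in such a way that the left and right derivatives of $v$ at $x^*$ agree. The point $0$ is regular for $(-\infty,0)$ for $X$ if $\mathbb{P}(\tau_0^-=0)=1$, where $\tau_0^-=\inf\{t\ge 0:X_t<0\}$. *)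

theory Defs
  imports "HOL-Probability.Probability"
begin

text \<open>
  A filtration \<open>(\<F>\<^sub>t)\<close> over the times \<open>t \<ge> 0\<close> is indexed by \<^typ>\<open>ennreal\<close>, so that the
  \<open>[0,\<infinity>]\<close>-valued stopping times are exactly those of \<^const>\<open>stopping_time\<close>.  The extra member
  \<open>F \<infinity>\<close> is an arbitrary sub-sigma-algebra containing all \<open>F t\<close>; no condition below depends on its
  choice.  Processes are indexed by \<^typ>\<open>real\<close>, and only times \<open>t \<ge> 0\<close> matter.
\<close>

locale usual_filtered_prob_space = prob_space M + filtration "space M" F
  for M :: "'a measure" and F :: "ennreal \<Rightarrow> 'a measure" +
  assumes subalg: "subalgebra M (F t)"
    and complete: "complete_measure M"
    and null_sets_F0: "null_sets M \<subseteq> sets (F 0)"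
    and right_continuous: "t < \<infinity> \<Longrightarrow> sets (F t) = (\<Inter>u\<in>{t<..}. sets (F u))"

definition cadlag :: "(real \<Rightarrow> real) \<Rightarrow> bool" where
  "cadlag f \<longleftrightarrow>
     (\<forall>t\<ge>0. continuous (at_right t) f) \<and> (\<forall>t>0. \<exists>l. (f \<longlongrightarrow> l) (at_left t))"

locale levy_process = usual_filtered_prob_space M F
  for M :: "'a measure" and F :: "ennreal \<Rightarrow> 'a measure" and X :: "real \<Rightarrow> 'a \<Rightarrow> real" +
  assumes adapted: "0 \<le> t \<Longrightarrow> X t \<in> borel_measurable (F (ennreal t))"
    and start_zero: "AE \<omega> in M. X 0 \<omega> = 0"
    and cadlag_paths: "AE \<omega> in M. cadlag (\<lambda>t. X t \<omega>)"
    and indep_increments: "0 \<le> s \<Longrightarrow> s \<le> t \<Longrightarrow>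
          indep_set (sets (F (ennreal s)))
            {(\<lambda>\<omega>. X t \<omega> - X s \<omega>) -` B \<inter> space M | B. B \<in> sets borel}"
    and stationary_increments: "0 \<le> s \<Longrightarrow> s \<le> t \<Longrightarrow>
          distr M borel (\<lambda>\<omega>. X t \<omega> - X s \<omega>) = distr M borel (X (t - s))"

definition running_inf :: "(real \<Rightarrow> 'a \<Rightarrow> real) \<Rightarrow> ennreal \<Rightarrow> 'a \<Rightarrow> real" where
  "running_inf X t \<omega> = (INF s\<in>{s. 0 \<le> s \<and> ennreal s \<le> t}. X s \<omega>)"

text \<open>The law of \<open>e\<^sub>r\<close>: exponential with parameter \<open>r\<close>, degenerate at \<open>\<infinity>\<close> for \<open>r = 0\<close>.\<close>

definition exp_time_law :: "real \<Rightarrow> ennreal measure" where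
  "exp_time_law r =
     (if r = 0 then return borel \<infinity>
      else distr (density lborel (\<lambda>t. ennreal (exponential_density r t))) borel ennreal)"

text \<open>
  The given space need not carry an exponential time independent of \<open>X\<close>, so it is enlarged: on
  the product, \<open>e\<^sub>r\<close> is the second coordinate and \<open>X\<close> is read off the first.  The completion is
  taken because the running infimum at time \<open>e\<^sub>r\<close> is measurable for the product sigma-algebra only up to the null
  event on which the path fails to be cadlag.
\<close>

definition with_exp_time :: "'a measure \<Rightarrow> real \<Rightarrow> ('a \<times> ennreal) measure" where
  "with_exp_time M r = completion (M \<Otimes>\<^sub>M exp_time_law r)"

definition inf_at_exp_time :: "(real \<Rightarrow> 'a \<Rightarrow> real) \<Rightarrow> 'a \<times> ennreal \<Rightarrow> real" where
  "inf_at_exp_time X = (\<lambda>(\<omega>, e). running_inf X e \<omega>)"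

definition put_payoff :: "real \<Rightarrow> real \<Rightarrow> real" where
  "put_payoff K y = max 0 (K - exp y)"

definition stopped_payoff ::
    "real \<Rightarrow> real \<Rightarrow> (real \<Rightarrow> 'a \<Rightarrow> real) \<Rightarrow> ('a \<Rightarrow> ennreal) \<Rightarrow> 'a \<Rightarrow> real" where
  "stopped_payoff K r Y T \<omega> =
     (if T \<omega> = \<infinity> then 0
      else exp (- r * enn2real (T \<omega>)) * put_payoff K (Y (enn2real (T \<omega>)) \<omega>))"

text \<open>
  The law of \<open>X\<close> under \<open>\<P>\<^sub>x\<close> is that of \<open>x + X\<close> under \<open>\<P>\<close>.  The expectations below all lie
  in \<open>[0, K]\<close> for \<open>K > 0\<close> and \<open>r \<ge> 0\<close>, so the real supremum is the intended one.
\<close>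

definition put_value ::
    "'a measure \<Rightarrow> (ennreal \<Rightarrow> 'a measure) \<Rightarrow> (real \<Rightarrow> 'a \<Rightarrow> real) \<Rightarrow> real \<Rightarrow> real \<Rightarrow> real \<Rightarrow> real"
  where
  "put_value M F X K r x =
     (SUP T\<in>{T. stopping_time F T}. \<integral>\<omega>. stopped_payoff K r (\<lambda>t \<omega>. x + X t \<omega>) T \<omega> \<partial>M)"

definition put_boundary :: "'a measure \<Rightarrow> (real \<Rightarrow> 'a \<Rightarrow> real) \<Rightarrow> real \<Rightarrow> real \<Rightarrow> real" where
  "put_boundary M X K r = ln (K * (\<integral>z. exp (inf_at_exp_time X z) \<partial>with_exp_time M r))"

definition smooth_pasting :: "(real \<Rightarrow> real) \<Rightarrow> (real \<Rightarrow> real) \<Rightarrow> real \<Rightarrow> bool" where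
  "smooth_pasting v g a \<longleftrightarrow>
     v a = g a \<and>
     (\<exists>D. (v has_real_derivative D) (at_left a) \<and> (v has_real_derivative D) (at_right a))"

definition first_passage_below :: "(real \<Rightarrow> 'a \<Rightarrow> real) \<Rightarrow> real \<Rightarrow> 'a \<Rightarrow> ennreal" where
  "first_passage_below X a \<omega> = (INF t\<in>{t. 0 \<le> t \<and> X t \<omega> < a}. ennreal t)"

definition regular_below :: "'a measure \<Rightarrow> (real \<Rightarrow> 'a \<Rightarrow> real) \<Rightarrow> bool" where
  "regular_below M X \<longleftrightarrow> \<P>(\<omega> in M. first_passage_below X 0 \<omega> = 0) = 1"

end

(*
  Write I for the infimum of X up to the exponential time and m = E e^I. The value is
  v(x) = E (K m - e^(x + I))^+ / m. For "<=", the process e^(-rt) E f(x + X_t + I) with f decreasing is a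
  supermartingale dominating the payoff (Jensen), because I is at most X_t plus the infimum of the increments
  after t. For ">=", stop at the first time of a fine grid at which x + X lies below ln (K m). Only the
  Markov property at deterministic times is needed. Since K m = e^(x_star), the slope of v to the right of
  x_star is -K E (e^I; I < 0) by dominated convergence, and v(x) = K - e^x to the left; so pasting is smooth
  exactly if P (I = 0) = 0.
*)
theory Submission
  imports Defs
begin

text \<open>The factor \<open>1 / m\<close> is what makes Jensen's inequality an equality wherever
  \<open>e^x \<le> K m\<close>: there \<open>(K m - e^(x + I))^+\<close> is computed without its
  positive part, since I is nonpositive, and v becomes the payoff itself. The discount
  \<open>e^(-rt)\<close> is read as the probability that the exponential time outlives t, so one
  argument serves r > 0 and r = 0.

  That P (I = 0) = 0 amounts to regularity needs its own argument, because I sees the whole horizon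
  and regularity only the times near 0. For r > 0 the exponential time is arbitrarily small with
  positive probability. For r = 0 no small time is available, and a renewal inequality for late
  visits to the negative half-line takes its place.

  Null sets are the technical obstacle: the paths are good only almost surely, and on bad paths an
  infimum may be a default value. Everything is therefore proved for a process all of whose paths
  are good and carried over by changing X on a null set. Integrals take values in
  \<open>ennreal\<close> until the slope is computed, so that Tonelli and Fatou apply
  directly.\<close>

section \<open>Infima over dense subsets, cadlag paths and time grids\<close>

text \<open>The two sets have the same lower bounds, and the real \<open>Inf\<close> is defined from
  these alone. The equality thus covers unbounded sets, where \<open>Inf\<close> is a default value;
  this lets the running infimum be measurable even over horizons on which paths may be
  unbounded.\<close>

lemma Inf_eq_of_dense:
  fixes S' S :: "real set"
  assumes "S' \<subseteq> S" and dense: "\<And>s e. s \<in> S \<Longrightarrow> 0 < e \<Longrightarrow> \<exists>s'\<in>S'. s' < s + e"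
  shows "Inf S = Inf S'"
proof -
  have "(\<forall>x\<in>uminus ` S. x \<le> z) \<longleftrightarrow> (\<forall>x\<in>uminus ` S'. x \<le> z)" for z
  proof (intro iffI ballI)
    fix x assume *: "\<forall>x\<in>uminus ` S'. x \<le> z" and "x \<in> uminus ` S"
    then obtain s where s: "s \<in> S" "x = - s" by auto
    have "x \<le> z + e" if e: "e > 0" for e
    proof -
      obtain s' where "s' \<in> S'" "s' < s + e" using dense[OF s(1) e] by auto
      moreover have "- s' \<le> z" using * \<open>s' \<in> S'\<close> by auto
      ultimately show ?thesis using s by linarith
    qed
    then show "x \<le> z" by (rule field_le_epsilon)
  qed (use assms(1) in auto)
  then show ?thesis
    unfolding Inf_real_def Sup_real_def by simp
qed

lemma cadlagD:
  assumes "cadlag f"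
  shows "0 \<le> t \<Longrightarrow> (f \<longlongrightarrow> f t) (at_right t)"
    and "0 < t \<Longrightarrow> \<exists>l. (f \<longlongrightarrow> l) (at_left t)"
  using assms by (auto simp: cadlag_def continuous_within)

lemma cadlag_bdd_below:
  assumes "cadlag f" "0 \<le> u"
  shows "bdd_below (f ` {0..u})"
proof -
  \<comment> \<open>Bolzano's lemma tests small intervals around 0 that reach into negative times,
    where nothing is known of \<open>f\<close>; the intersection discards that part.\<close>
  let ?P = "\<lambda>a b. bdd_below (f ` ({a..b} \<inter> {0..}))"
  have "?P 0 u"
  proof (rule Bolzano[where P="?P", OF assms(2)])
    fix a b c :: real assume "a \<le> b" "b \<le> c" "?P a b" "?P b c"
    then have "bdd_below (f ` ({a..b} \<inter> {0..}) \<union> f ` ({b..c} \<inter> {0..}))" by simp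
    then show "?P a c"
      by (rule bdd_below_mono) force
  next
    fix x :: real assume x: "0 \<le> x" "x \<le> u"
    have "eventually (\<lambda>y. f y > f x - 1) (at_right x)"
      by (rule order_tendstoD(1)[OF cadlagD(1)[OF assms(1) x(1)]]) simp
    then obtain dr where dr: "x < dr" "\<And>y. x < y \<Longrightarrow> y < dr \<Longrightarrow> f y > f x - 1"
      by (auto simp: eventually_at_right_field)
    obtain l dl where dl: "dl < x" "\<And>y. dl < y \<Longrightarrow> y < x \<Longrightarrow> 0 \<le> y \<Longrightarrow> f y > l"
    proof (cases "x = 0")
      case True
      then show ?thesis using that[of "-1"] by auto
    next
      case False
      then obtain l where "(f \<longlongrightarrow> l) (at_left x)" using cadlagD(2)[OF assms(1)] x by force
      then have "eventually (\<lambda>y. f y > l - 1) (at_left x)"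
        by (rule order_tendstoD(1)) simp
      then show ?thesis using that unfolding eventually_at_left_field by blast
    qed
    show "\<exists>d>0. \<forall>a b. a \<le> x \<and> x \<le> b \<and> b - a < d \<longrightarrow> ?P a b"
    proof (intro exI[of _ "min (dr - x) (x - dl)"] conjI allI impI)
      fix a b assume ab: "a \<le> x \<and> x \<le> b \<and> b - a < min (dr - x) (x - dl)"
      show "?P a b"
      proof (rule bdd_belowI)
        fix z assume "z \<in> f ` ({a..b} \<inter> {0..})"
        then obtain y where y: "a \<le> y" "y \<le> b" "0 \<le> y" "z = f y" by auto
        show "min l (f x - 1) \<le> z"
          using dr(2)[of y] dl(2)[of y] y ab by (cases y x rule: linorder_cases) auto
      qed
    qed (use dr dl in auto)
  qed
  moreover have "{0..u} \<inter> {0..} = {0..u}" by auto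
  ultimately show ?thesis by simp
qed

lemma cadlag_bdd_below_at_top:
  assumes "cadlag f" "filterlim f at_top at_top"
  shows "bdd_below (f ` {0..})"
proof -
  obtain u where u: "\<And>x. u \<le> x \<Longrightarrow> 0 \<le> f x"
    using assms(2) unfolding filterlim_at_top eventually_at_top_linorder by blast
  have "bdd_below (f ` {0..max 0 u} \<union> {0..})"
    using cadlag_bdd_below[OF assms(1), of "max 0 u"] by simp
  then show ?thesis
    by (rule bdd_below_mono) (force simp: image_iff intro: u)
qed

lemma right_continuous_less_near:
  fixes f :: "real \<Rightarrow> real"
  assumes "(f \<longlongrightarrow> f s) (at_right s)" "f s < a"
  obtains d where "0 < d" "\<And>y. s \<le> y \<Longrightarrow> y < s + d \<Longrightarrow> f y < a"
proof -
  obtain b where b: "b > s" "\<And>y. y > s \<Longrightarrow> y < b \<Longrightarrow> f y < a"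
    using order_tendstoD(2)[OF assms] unfolding eventually_at_right_field by blast
  show thesis
    by (rule that[of "b - s"]) (use b assms(2) in \<open>auto simp: order_le_less\<close>)
qed

lemma exists_grid_point:
  assumes "0 < h" "h \<le> d" "0 \<le> s"
  obtains k :: nat where "s < real k * h" "real k * h \<le> s + d"
proof
  let ?k = "nat \<lfloor>s / h\<rfloor> + 1"
  have k: "real ?k = of_int \<lfloor>s / h\<rfloor> + 1" using assms by simp
  have "s / h < real ?k" "real ?k \<le> s / h + 1" unfolding k by linarith+
  then show "s < real ?k * h" "real ?k * h \<le> s + d"
    using assms by (auto simp: field_simps)
qed

text \<open>Rounding by floor plus one keeps the approximations strictly above \<open>s\<close>, as
  a limit along \<open>at_right s\<close> demands; a ceiling would return \<open>s\<close> itself at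
  grid points.\<close>

lemma filterlim_grid_at_right:
  assumes "0 \<le> s"
  shows "filterlim (\<lambda>n. real (nat \<lfloor>real (Suc n) * s\<rfloor> + 1) / real (Suc n)) (at_right s) sequentially"
    (is "filterlim ?s _ _")
proof -
  have bounds: "s < ?s n \<and> ?s n \<le> s + 1 / real (Suc n)" for n
  proof -
    have "real (nat \<lfloor>real (Suc n) * s\<rfloor> + 1) = of_int \<lfloor>real (Suc n) * s\<rfloor> + 1"
      using assms by (simp add: of_nat_nat)
    moreover have "real (Suc n) * s < of_int \<lfloor>real (Suc n) * s\<rfloor> + 1"
      "of_int \<lfloor>real (Suc n) * s\<rfloor> \<le> real (Suc n) * s" by linarith+
    ultimately show ?thesis by (simp add: field_simps del: of_nat_Suc)
  qed
  have "?s \<longlonglongrightarrow> s"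
  proof (rule tendsto_sandwich[OF _ _ tendsto_const])
    show "(\<lambda>n. s + 1 / real (Suc n)) \<longlonglongrightarrow> s"
      using tendsto_add[OF tendsto_const LIMSEQ_Suc[OF lim_1_over_n], of s] by simp
  qed (use bounds in \<open>auto intro!: always_eventually less_imp_le simp del: of_nat_Suc\<close>)
  moreover have "?s n \<noteq> s" "?s n \<in> {s<..}" for n
    using bounds[of n] by simp_all
  ultimately show ?thesis
    unfolding filterlim_at by (intro conjI always_eventually allI)
qed

section \<open>Levy processes with good paths everywhere, and their future infima\<close>

text \<open>With path properties assumed at every point, comparisons of infima hold pointwise
  without exceptional sets. The rate is fixed here because the drift to infinity is required only
  for \<open>r = 0\<close>.\<close>

locale regular_path_levy = levy_process M F X
  for M :: "'a measure" and F :: "ennreal \<Rightarrow> 'a measure" and X :: "real \<Rightarrow> 'a \<Rightarrow> real" +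
  fixes r :: real
  assumes rate_nonneg: "0 \<le> r"
    and path_start: "\<omega> \<in> space M \<Longrightarrow> X 0 \<omega> = 0"
    and path_cadlag: "\<omega> \<in> space M \<Longrightarrow> cadlag (\<lambda>t. X t \<omega>)"
    and path_drifts: "r = 0 \<Longrightarrow> \<omega> \<in> space M \<Longrightarrow> filterlim (\<lambda>t. X t \<omega>) at_top at_top"
begin

definition increment :: "real \<Rightarrow> real \<Rightarrow> 'a \<Rightarrow> real" where
  "increment t s \<omega> = X (t + s) \<omega> - X t \<omega>"

text \<open>Measured relative to \<open>X t\<close>, so that it is independent of the past of
  \<open>t\<close> and distributed like the infimum started at time 0.\<close>

definition future_inf :: "real \<Rightarrow> ennreal \<Rightarrow> 'a \<Rightarrow> real" where
  "future_inf t = running_inf (increment t)"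

text \<open>Horizons over which the paths are bounded below, so that the infimum is not a junk value.\<close>

definition horizon :: "ennreal \<Rightarrow> bool" where
  "horizon u \<longleftrightarrow> u < \<infinity> \<or> r = 0"

lemma increment_zero [simp]: "increment t 0 \<omega> = 0"
  by (simp add: increment_def)

lemma increment_from_zero: "\<omega> \<in> space M \<Longrightarrow> increment 0 s \<omega> = X s \<omega>"
  by (simp add: increment_def path_start)

lemma future_inf_zero: "\<omega> \<in> space M \<Longrightarrow> future_inf 0 u \<omega> = running_inf X u \<omega>"
  by (simp add: future_inf_def running_inf_def increment_from_zero)

lemma increment_right_continuous:
  assumes "\<omega> \<in> space M" "0 \<le> t" "0 \<le> s"
  shows "((\<lambda>s. increment t s \<omega>) \<longlongrightarrow> increment t s \<omega>) (at_right s)"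
proof -
  have "((\<lambda>s. X s \<omega>) \<longlongrightarrow> X (t + s) \<omega>) (at_right (t + s))"
    using cadlagD(1)[OF path_cadlag] assms by auto
  then have "((\<lambda>s. X (t + s) \<omega>) \<longlongrightarrow> X (t + s) \<omega>) (at_right s)"
    by (subst (asm) filterlim_at_right_to_0, subst filterlim_at_right_to_0) (simp add: ac_simps)
  then show ?thesis
    unfolding increment_def by (intro tendsto_intros)
qed

lemma increment_bdd_below:
  assumes "\<omega> \<in> space M" "0 \<le> t" "horizon u"
  shows "bdd_below ((\<lambda>s. increment t s \<omega>) ` {s. 0 \<le> s \<and> ennreal s \<le> u})"
proof -
  have "\<exists>S. bdd_below ((\<lambda>s. X s \<omega>) ` S) \<and> {s. t \<le> s \<and> ennreal (s - t) \<le> u} \<subseteq> S"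
  proof (cases u)
    case (real v)
    show ?thesis
      by (rule exI[of _ "{0..t+v}"])
        (use real assms cadlag_bdd_below[OF path_cadlag, of \<omega> "t+v"] in auto)
  next
    case top
    with assms have "r = 0" by (simp add: horizon_def)
    then show ?thesis
      using assms cadlag_bdd_below_at_top[OF path_cadlag path_drifts, of \<omega>]
      by (intro exI[of _ "{0..}"]) auto
  qed
  then obtain S c where S: "\<And>s. s \<in> S \<Longrightarrow> c \<le> X s \<omega>" "{s. t \<le> s \<and> ennreal (s - t) \<le> u} \<subseteq> S"
    unfolding bdd_below_def by blast
  show ?thesis
  proof (rule bdd_belowI2[of _ "c - X t \<omega>"])
    fix s assume "s \<in> {s. 0 \<le> s \<and> ennreal s \<le> u}"
    then have "t + s \<in> S" using S(2) by auto
    then show "c - X t \<omega> \<le> increment t s \<omega>" using S(1) by (simp add: increment_def)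
  qed
qed

lemma future_inf_less_iff:
  assumes "\<omega> \<in> space M" "0 \<le> t" "horizon u"
  shows "future_inf t u \<omega> < a \<longleftrightarrow> (\<exists>s\<ge>0. ennreal s \<le> u \<and> increment t s \<omega> < a)"
proof -
  have "{s. 0 \<le> s \<and> ennreal s \<le> u} \<noteq> {}" by (auto intro!: exI[of _ 0])
  then show ?thesis
    unfolding future_inf_def running_inf_def
    by (subst cInf_less_iff) (use increment_bdd_below[OF assms] in auto)
qed

lemma future_inf_le:
  assumes "\<omega> \<in> space M" "0 \<le> t" "horizon u" "0 \<le> s" "ennreal s \<le> u"
  shows "future_inf t u \<omega> \<le> increment t s \<omega>"
  unfolding future_inf_def running_inf_def
  by (rule cINF_lower[OF increment_bdd_below[OF assms(1-3)]]) (use assms in auto)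

lemma future_inf_nonpos:
  "\<omega> \<in> space M \<Longrightarrow> 0 \<le> t \<Longrightarrow> horizon u \<Longrightarrow> future_inf t u \<omega> \<le> 0"
  using future_inf_le[of \<omega> t u 0] by simp

lemma future_inf_ge:
  assumes "\<And>s. 0 \<le> s \<Longrightarrow> ennreal s \<le> u \<Longrightarrow> a \<le> increment t s \<omega>"
  shows "a \<le> future_inf t u \<omega>"
  unfolding future_inf_def running_inf_def
  by (rule cINF_greatest) (use assms in \<open>auto intro!: exI[of _ 0]\<close>)

text \<open>Times in \<open>[s, u]\<close> are among those in \<open>[0, u]\<close>. This pathwise
  inequality is the source of the supermartingale property.\<close>

lemma future_inf_shift_le:
  assumes "\<omega> \<in> space M" "0 \<le> t" "0 \<le> s" "horizon u" "ennreal s \<le> u"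
  shows "future_inf t u \<omega> \<le> increment t s \<omega> + future_inf (t + s) (u - ennreal s) \<omega>"
proof -
  have "future_inf t u \<omega> - increment t s \<omega> \<le> increment (t + s) v \<omega>"
    if "0 \<le> v" "ennreal v \<le> u - ennreal s" for v
  proof -
    have "ennreal s + ennreal v \<le> ennreal s + (u - ennreal s)"
      using that(2) by (rule add_left_mono)
    then have "ennreal (s + v) \<le> u"
      using assms that(1) by (simp add: ennreal_plus add_diff_inverse_ennreal)
    then have "future_inf t u \<omega> \<le> increment t (s + v) \<omega>"
      using that assms by (intro future_inf_le) auto
    then show ?thesis by (simp add: increment_def add.assoc)
  qed
  then have "future_inf t u \<omega> - increment t s \<omega> \<le> future_inf (t + s) (u - ennreal s) \<omega>"
    by (rule future_inf_ge)
  then show ?thesis by simp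
qed

lemma horizon_diff: "horizon u \<Longrightarrow> horizon (u - v)"
  by (auto simp: horizon_def less_top[symmetric])

section \<open>Measurability\<close>

lemma sets_F: "A \<in> sets (F t) \<Longrightarrow> A \<in> sets M"
  using subalg[of t] by (auto simp: subalgebra_def)

lemma measurable_F: "f \<in> F t \<rightarrow>\<^sub>M N \<Longrightarrow> f \<in> M \<rightarrow>\<^sub>M N"
  by (rule measurable_from_subalg[OF subalg])

lemma measurable_F_mono: "f \<in> F s \<rightarrow>\<^sub>M N \<Longrightarrow> s \<le> t \<Longrightarrow> f \<in> F t \<rightarrow>\<^sub>M N"
  using measurable_mono[OF order_refl refl sets_F_mono, of s t N] by (auto simp: space_F)

lemma X_measurable: "0 \<le> t \<Longrightarrow> X t \<in> borel_measurable M"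
  using adapted measurable_F by blast

lemma increment_measurable_F:
  "0 \<le> t \<Longrightarrow> 0 \<le> s \<Longrightarrow> increment t s \<in> borel_measurable (F (ennreal (t + s)))"
  unfolding increment_def
  by (intro borel_measurable_diff adapted measurable_F_mono[OF adapted])
    (auto intro: ennreal_leI)

lemma increment_measurable: "0 \<le> t \<Longrightarrow> 0 \<le> s \<Longrightarrow> increment t s \<in> borel_measurable M"
  using increment_measurable_F measurable_F by blast

text \<open>Grid times strictly to the right converge by right continuity, and at each level only
  countably many of them occur. The absolute value makes the process total, as nothing is known at
  negative times.\<close>

lemma increment_jointly_measurable:
  assumes t: "0 \<le> t"
  shows "(\<lambda>(\<omega>, s). increment t \<bar>s\<bar> \<omega>) \<in> borel_measurable (M \<Otimes>\<^sub>M borel)"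
proof (rule borel_measurable_LIMSEQ_real)
  fix n :: nat
  have "(\<lambda>z. increment t (real (nat \<lfloor>real (Suc n) * \<bar>snd z\<bar>\<rfloor> + 1) / real (Suc n)) (fst z))
      \<in> borel_measurable (M \<Otimes>\<^sub>M borel)"
  proof (rule measurable_compose_countable[where g="\<lambda>z. nat \<lfloor>real (Suc n) * \<bar>snd z\<bar>\<rfloor>"
        and f="\<lambda>i z. increment t (real (i + 1) / real (Suc n)) (fst z)"])
    fix i :: nat
    show "(\<lambda>z. increment t (real (i + 1) / real (Suc n)) (fst z)) \<in> borel_measurable (M \<Otimes>\<^sub>M borel)"
      by (rule measurable_compose[OF measurable_fst increment_measurable]) (use t in auto)
  qed measurable
  then show "(\<lambda>(\<omega>, s). increment t (real (nat \<lfloor>real (Suc n) * \<bar>s\<bar>\<rfloor> + 1) / real (Suc n)) \<omega>)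
      \<in> borel_measurable (M \<Otimes>\<^sub>M borel)"
    by (simp add: case_prod_beta)
next
  fix z assume "z \<in> space (M \<Otimes>\<^sub>M (borel :: real measure))"
  then obtain \<omega> s where z: "z = (\<omega>, s)" "\<omega> \<in> space M" by (auto simp: space_pair_measure)
  from filterlim_compose[OF increment_right_continuous[OF z(2) t abs_ge_zero] filterlim_grid_at_right[OF abs_ge_zero]]
  show "(\<lambda>n. (\<lambda>(\<omega>, s). increment t (real (nat \<lfloor>real (Suc n) * \<bar>s\<bar>\<rfloor> + 1) / real (Suc n)) \<omega>) z)
      \<longlonglongrightarrow> (\<lambda>(\<omega>, s). increment t \<bar>s\<bar> \<omega>) z"
    by (simp add: z)
qed

text \<open>Rescaling the rationals of \<open>[0, 1]\<close> by the horizon gives an index set that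
  does not vary with \<open>u\<close>, as joint measurability requires. The point
  \<open>q = 1\<close> is kept because right continuity does not reach the endpoint \<open>u\<close>
  from inside the horizon.\<close>

lemma future_inf_finite_eq:
  assumes "\<omega> \<in> space M" "0 \<le> t" "0 \<le> u"
  shows "future_inf t (ennreal u) \<omega> = (INF q\<in>\<rat> \<inter> {0..1}. increment t \<bar>q * u\<bar> \<omega>)"
  unfolding future_inf_def running_inf_def
proof (rule Inf_eq_of_dense)
  have "\<bar>q * u\<bar> \<le> u" if "q \<in> {0..1}" for q
    using that assms mult_right_mono[of q 1 u] by (auto simp: abs_mult)
  then show "(\<lambda>q. increment t \<bar>q * u\<bar> \<omega>) ` (\<rat> \<inter> {0..1})
    \<subseteq> (\<lambda>s. increment t s \<omega>) ` {s. 0 \<le> s \<and> ennreal s \<le> ennreal u}"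
    using assms by (auto intro!: ennreal_leI image_eqI[OF refl])
next
  fix y e :: real assume "y \<in> (\<lambda>s. increment t s \<omega>) ` {s. 0 \<le> s \<and> ennreal s \<le> ennreal u}" "0 < e"
  then obtain s where s: "0 \<le> s" "s \<le> u" "y = increment t s \<omega>" using assms by auto
  show "\<exists>s'\<in>(\<lambda>q. increment t \<bar>q * u\<bar> \<omega>) ` (\<rat> \<inter> {0..1}). s' < y + e"
  proof (cases "s = u")
    case True
    then show ?thesis using s \<open>0 < e\<close> by (auto intro!: bexI[of _ 1])
  next
    case False
    with s have "s < u" "0 < u" by auto
    obtain d where d: "0 < d" "\<And>y'. s \<le> y' \<Longrightarrow> y' < s + d \<Longrightarrow> increment t y' \<omega> < y + e"
      using right_continuous_less_near[OF increment_right_continuous[OF assms(1,2) s(1)], of "y + e"]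
        s \<open>0 < e\<close> by auto
    obtain q where q: "q \<in> \<rat>" "s / u < q" "q < min ((s + d) / u) 1"
      using Rats_dense_in_real[of "s / u" "min ((s + d) / u) 1"] \<open>s < u\<close> \<open>0 < u\<close> \<open>0 < d\<close>
      by (auto simp: divide_strict_right_mono)
    have "0 \<le> q" using divide_nonneg_pos[OF s(1) \<open>0 < u\<close>] q(2) by linarith
    moreover have "s < q * u" "q * u < s + d" "q < 1"
      using \<open>0 < u\<close> q by (auto simp: field_simps)
    ultimately have "0 \<le> q" "s < q * u" "q * u < s + d" "q < 1" by auto
    then have "increment t \<bar>q * u\<bar> \<omega> < y + e" using d(2)[of "q * u"] \<open>0 < u\<close> by simp
    then show ?thesis using q \<open>q < 1\<close> \<open>0 \<le> q\<close> by (auto intro!: bexI[of _ q])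
  qed
qed

lemma future_inf_infinite_eq:
  assumes "\<omega> \<in> space M" "0 \<le> t"
  shows "future_inf t \<infinity> \<omega> = (INF q\<in>\<rat> \<inter> {0..}. increment t \<bar>q\<bar> \<omega>)"
  unfolding future_inf_def running_inf_def
proof (rule Inf_eq_of_dense)
  show "(\<lambda>q. increment t \<bar>q\<bar> \<omega>) ` (\<rat> \<inter> {0..})
    \<subseteq> (\<lambda>s. increment t s \<omega>) ` {s. 0 \<le> s \<and> ennreal s \<le> \<infinity>}"
    by auto
next
  fix y e :: real assume "y \<in> (\<lambda>s. increment t s \<omega>) ` {s. 0 \<le> s \<and> ennreal s \<le> \<infinity>}" "0 < e"
  then obtain s where s: "0 \<le> s" "y = increment t s \<omega>" using assms by auto
  obtain d where d: "0 < d" "\<And>y'. s \<le> y' \<Longrightarrow> y' < s + d \<Longrightarrow> increment t y' \<omega> < y + e"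
    using right_continuous_less_near[OF increment_right_continuous[OF assms(1,2) s(1)], of "y + e"]
      s \<open>0 < e\<close> by auto
  obtain q where q: "q \<in> \<rat>" "s < q" "q < s + d"
    using Rats_dense_in_real[of s "s + d"] d by auto
  then show "\<exists>s'\<in>(\<lambda>q. increment t \<bar>q\<bar> \<omega>) ` (\<rat> \<inter> {0..}). s' < y + e"
    using d(2)[of q] s(1) by (intro bexI[of _ "increment t \<bar>q\<bar> \<omega>"]) auto
qed

lemma future_inf_jointly_measurable:
  assumes t: "0 \<le> t"
  shows "(\<lambda>(\<omega>, u). future_inf t u \<omega>) \<in> borel_measurable (M \<Otimes>\<^sub>M borel)"
proof -
  have [measurable]: "(\<lambda>(\<omega>, s). increment t \<bar>s\<bar> \<omega>) \<in> borel_measurable (M \<Otimes>\<^sub>M borel)"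
    by (rule increment_jointly_measurable[OF t])
  have inc[measurable]: "(\<lambda>z. increment t \<bar>g z\<bar> (fst z)) \<in> borel_measurable (M \<Otimes>\<^sub>M borel)"
    if [measurable]: "g \<in> borel_measurable (M \<Otimes>\<^sub>M (borel :: ennreal measure))" for g
  proof -
    have "(\<lambda>z. (\<lambda>(\<omega>, s). increment t \<bar>s\<bar> \<omega>) (fst z, g z)) \<in> borel_measurable (M \<Otimes>\<^sub>M borel)"
      by measurable
    then show ?thesis by simp
  qed
  have [simp]: "countable (\<rat> \<inter> A)" for A :: "real set"
    using countable_rat by (rule countable_subset[rotated]) auto
  have "(\<lambda>z. if snd z = \<infinity> then INF q\<in>\<rat> \<inter> {0..}. increment t \<bar>q\<bar> (fst z)
      else INF q\<in>\<rat> \<inter> {0..1}. increment t \<bar>q * enn2real (snd z)\<bar> (fst z))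
    \<in> borel_measurable (M \<Otimes>\<^sub>M borel)"
    by (intro measurable_If borel_measurable_cINF_real inc) simp_all
  moreover have "future_inf t u \<omega> = (if u = \<infinity> then INF q\<in>\<rat> \<inter> {0..}. increment t \<bar>q\<bar> \<omega>
      else INF q\<in>\<rat> \<inter> {0..1}. increment t \<bar>q * enn2real u\<bar> \<omega>)" if "\<omega> \<in> space M" for u \<omega>
    using future_inf_finite_eq[OF that t, of "enn2real u"] future_inf_infinite_eq[OF that t]
    by (auto simp: less_top)
  ultimately show ?thesis
    by (subst measurable_cong[where g="\<lambda>z. if snd z = \<infinity> then INF q\<in>\<rat> \<inter> {0..}. increment t \<bar>q\<bar> (fst z)
      else INF q\<in>\<rat> \<inter> {0..1}. increment t \<bar>q * enn2real (snd z)\<bar> (fst z)"])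
      (auto simp: space_pair_measure)
qed

lemma future_inf_measurable:
  assumes "0 \<le> t" shows "future_inf t u \<in> borel_measurable M"
  using measurable_compose[OF measurable_Pair2' future_inf_jointly_measurable[OF assms], of u] by simp

section \<open>Independence of the future infimum from the past\<close>

text \<open>\<open>Z\<close> only enters through its law, so \<open>Y\<close> is a copy of \<open>Z\<close> independent of \<open>F t\<close>.\<close>

definition indep_copy :: "real \<Rightarrow> ('a \<Rightarrow> real) \<Rightarrow> ('a \<Rightarrow> real) \<Rightarrow> bool" where
  "indep_copy t Y Z \<longleftrightarrow> Y \<in> borel_measurable M \<and> Z \<in> borel_measurable M \<and>
     (\<forall>C\<in>sets (F (ennreal t)). \<forall>B\<in>sets borel.
        prob (C \<inter> (Y -` B \<inter> space M)) = prob C * prob (Z -` B \<inter> space M))"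

text \<open>The joint law of \<open>(U, Y)\<close> is the product of the laws of \<open>U\<close>
  and \<open>Z\<close>, since the two agree on rectangles; Tonelli's theorem does the rest.\<close>

lemma indep_copy_nn_integral:
  assumes "indep_copy t Y Z" and U: "U \<in> F (ennreal t) \<rightarrow>\<^sub>M N"
    and [measurable]: "\<phi> \<in> borel_measurable (N \<Otimes>\<^sub>M borel)"
  shows "(\<integral>\<^sup>+\<omega>. \<phi> (U \<omega>, Y \<omega>) \<partial>M) = (\<integral>\<^sup>+\<omega>. \<integral>\<^sup>+\<omega>'. \<phi> (U \<omega>, Z \<omega>') \<partial>M \<partial>M)"
proof -
  have [measurable]: "Y \<in> borel_measurable M" "Z \<in> borel_measurable M" "U \<in> M \<rightarrow>\<^sub>M N"
    using assms(1) measurable_F[OF U] by (auto simp: indep_copy_def)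
  interpret U: prob_space "distr M N U" by (rule prob_space_distr) measurable
  interpret Z: prob_space "distr M borel Z" by (rule prob_space_distr) measurable
  have eq: "distr M N U \<Otimes>\<^sub>M distr M borel Z = distr M (N \<Otimes>\<^sub>M borel) (\<lambda>\<omega>. (U \<omega>, Y \<omega>))"
  proof (rule pair_measure_eqI)
    fix A B assume [measurable]: "A \<in> sets (distr M N U)" "B \<in> sets (distr M borel Z)"
    have "U -` A \<inter> space M \<in> sets (F (ennreal t))"
      using measurable_sets[OF U] \<open>A \<in> sets (distr M N U)\<close> by (simp add: space_F)
    then have "prob ((U -` A \<inter> space M) \<inter> (Y -` B \<inter> space M))
        = prob (U -` A \<inter> space M) * prob (Z -` B \<inter> space M)"
      using assms(1) \<open>B \<in> _\<close> by (simp add: indep_copy_def)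
    moreover have "(\<lambda>\<omega>. (U \<omega>, Y \<omega>)) -` (A \<times> B) \<inter> space M = (U -` A \<inter> space M) \<inter> (Y -` B \<inter> space M)"
      by auto
    ultimately have *: "prob ((\<lambda>\<omega>. (U \<omega>, Y \<omega>)) -` (A \<times> B) \<inter> space M)
        = prob (U -` A \<inter> space M) * prob (Z -` B \<inter> space M)" by (simp only:)
    have A: "A \<in> sets N" and B: "B \<in> sets borel" using \<open>A \<in> _\<close> \<open>B \<in> _\<close> by simp_all
    have UY: "(\<lambda>\<omega>. (U \<omega>, Y \<omega>)) \<in> M \<rightarrow>\<^sub>M N \<Otimes>\<^sub>M borel" by measurable
    show "emeasure (distr M N U) A * emeasure (distr M borel Z) B =
        emeasure (distr M (N \<Otimes>\<^sub>M borel) (\<lambda>\<omega>. (U \<omega>, Y \<omega>))) (A \<times> B)"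
      unfolding emeasure_distr[OF \<open>U \<in> M \<rightarrow>\<^sub>M N\<close> A] emeasure_distr[OF \<open>Z \<in> borel_measurable M\<close> B]
        emeasure_distr[OF UY pair_measureI[OF A B]] emeasure_eq_measure *
      by (simp only: ennreal_mult measure_nonneg)
  next
    show "sets (distr M N U \<Otimes>\<^sub>M distr M borel Z) = sets (distr M (N \<Otimes>\<^sub>M borel) (\<lambda>\<omega>. (U \<omega>, Y \<omega>)))"
      unfolding sets_distr by (rule sets_pair_measure_cong) (rule sets_distr)+
  qed (rule U.sigma_finite_measure_axioms Z.sigma_finite_measure_axioms)+
  have "(\<integral>\<^sup>+\<omega>. \<phi> (U \<omega>, Y \<omega>) \<partial>M) = (\<integral>\<^sup>+z. \<phi> z \<partial>distr M (N \<Otimes>\<^sub>M borel) (\<lambda>\<omega>. (U \<omega>, Y \<omega>)))"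
    by (subst nn_integral_distr) auto
  also have "\<dots> = (\<integral>\<^sup>+u. \<integral>\<^sup>+y. \<phi> (u, y) \<partial>distr M borel Z \<partial>distr M N U)"
    unfolding eq[symmetric] by (subst Z.nn_integral_fst) auto
  also have "\<dots> = (\<integral>\<^sup>+\<omega>. \<integral>\<^sup>+\<omega>'. \<phi> (U \<omega>, Z \<omega>') \<partial>M \<partial>M)"
    by (subst nn_integral_distr) (auto intro!: nn_integral_cong simp: nn_integral_distr)
  finally show ?thesis .
qed

lemma indep_copy_nn_integral_indicator:
  assumes Y: "indep_copy t Y Z" and C: "C \<in> sets (F (ennreal t))"
    and [measurable]: "f \<in> borel_measurable borel"
  shows "(\<integral>\<^sup>+\<omega>. indicator C \<omega> * f (Y \<omega>) \<partial>M) = emeasure M C * (\<integral>\<^sup>+\<omega>. f (Z \<omega>) \<partial>M)"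
proof -
  have [measurable]: "Z \<in> borel_measurable M" using Y by (simp add: indep_copy_def)
  have "(\<lambda>\<omega>. indicator C \<omega> :: ennreal) \<in> borel_measurable (F (ennreal t))"
    using C by (rule borel_measurable_indicator)
  moreover have "(\<lambda>z. fst z * f (snd z)) \<in> borel_measurable (borel \<Otimes>\<^sub>M borel)" by measurable
  ultimately have "(\<integral>\<^sup>+\<omega>. indicator C \<omega> * f (Y \<omega>) \<partial>M)
      = (\<integral>\<^sup>+\<omega>. \<integral>\<^sup>+\<omega>'. indicator C \<omega> * f (Z \<omega>') \<partial>M \<partial>M)"
    using indep_copy_nn_integral[OF Y, of "\<lambda>\<omega>. indicator C \<omega> :: ennreal" borel "\<lambda>z. fst z * f (snd z)"]
    by (simp only: fst_conv snd_conv)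
  also have "\<dots> = (\<integral>\<^sup>+\<omega>. indicator C \<omega> * (\<integral>\<^sup>+\<omega>'. f (Z \<omega>') \<partial>M) \<partial>M)"
    by (intro nn_integral_cong nn_integral_cmult) measurable
  also have "\<dots> = emeasure M C * (\<integral>\<^sup>+\<omega>. f (Z \<omega>) \<partial>M)"
    using sets_F[OF C] by (subst nn_integral_multc) auto
  finally show ?thesis .
qed

text \<open>Dynkin's lemma. The half-lines are open because an infimum is below \<open>a\<close>
  exactly when some sampled value is, so that approximating an infimum becomes a union of
  events.\<close>

lemma indep_copy_of_half_lines:
  assumes Y: "Y \<in> borel_measurable M" and Z: "Z \<in> borel_measurable M"
    and eq: "\<And>C a. C \<in> sets (F (ennreal t)) \<Longrightarrow>
      prob (C \<inter> {\<omega>\<in>space M. Y \<omega> < a}) = prob C * prob {\<omega>\<in>space M. Z \<omega> < a}"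
  shows "indep_copy t Y Z"
  unfolding indep_copy_def
proof (intro conjI ballI Y Z)
  fix C B assume C: "C \<in> sets (F (ennreal t))" and B: "B \<in> sets (borel :: real measure)"
  have [measurable]: "C \<in> events" using sets_F[OF C] .
  note [measurable] = Y Z
  have "B \<in> sigma_sets UNIV (range lessThan)"
    using B unfolding borel_Iio by simp
  have "Int_stable (range lessThan :: real set set)"
  proof -
    have "{..<a} \<inter> {..<b} = {..<min a b}" for a b :: real by auto
    then show ?thesis by (auto simp: Int_stable_def)
  qed
  moreover have "range lessThan \<subseteq> Pow (UNIV :: real set)" by auto
  moreover note \<open>B \<in> sigma_sets UNIV (range lessThan)\<close>
  ultimately show "prob (C \<inter> (Y -` B \<inter> space M)) = prob C * prob (Z -` B \<inter> space M)"
  proof (induction rule: sigma_sets_induct_disjoint[consumes 3, case_names basic empty compl union])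
    case (basic A)
    then obtain a where "A = {..<a}" by auto
    moreover have "Y -` {..<a} \<inter> space M = {\<omega>\<in>space M. Y \<omega> < a}"
      "Z -` {..<a} \<inter> space M = {\<omega>\<in>space M. Z \<omega> < a}" by auto
    ultimately show ?case using eq[OF C] by simp
  next
    case empty
    show ?case by simp
  next
    case (compl A)
    have [measurable]: "A \<in> sets borel"
      using compl(1) unfolding borel_Iio by simp
    have "C \<inter> (Y -` (UNIV - A) \<inter> space M) = C - (C \<inter> (Y -` A \<inter> space M))"
      using sets.sets_into_space[OF sets_F[OF C]] by auto
    moreover have "Z -` (UNIV - A) \<inter> space M = space M - (Z -` A \<inter> space M)" by auto
    moreover have "prob (C - (C \<inter> (Y -` A \<inter> space M))) = prob C - prob (C \<inter> (Y -` A \<inter> space M))"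
      by (rule finite_measure_Diff) auto
    moreover have "prob (space M - (Z -` A \<inter> space M)) = 1 - prob (Z -` A \<inter> space M)"
      by (rule prob_compl) measurable
    ultimately show ?case using compl(2) by (simp only: right_diff_distrib mult_1_right)
  next
    case (union A)
    have [measurable]: "A i \<in> sets borel" for i
      using union(2) unfolding borel_Iio by auto
    have "(\<lambda>i. prob (C \<inter> (Y -` A i \<inter> space M))) sums prob (\<Union>i. C \<inter> (Y -` A i \<inter> space M))"
      by (rule finite_measure_UNION) (use union(1) in \<open>auto simp: disjoint_family_on_def\<close>)
    moreover have "(\<lambda>i. prob (Z -` A i \<inter> space M)) sums prob (\<Union>i. Z -` A i \<inter> space M)"
      by (rule finite_measure_UNION) (use union(1) in \<open>auto simp: disjoint_family_on_def\<close>)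
    then have "(\<lambda>i. prob C * prob (Z -` A i \<inter> space M)) sums (prob C * prob (\<Union>i. Z -` A i \<inter> space M))"
      by (rule sums_mult)
    moreover have "C \<inter> (Y -` (\<Union>i. A i) \<inter> space M) = (\<Union>i. C \<inter> (Y -` A i \<inter> space M))"
      "Z -` (\<Union>i. A i) \<inter> space M = (\<Union>i. Z -` A i \<inter> space M)" by auto
    ultimately show ?case using union(3) by (simp add: sums_iff)
  qed
qed

text \<open>The assumptions \<open>lim\<close> express \<open>Y\<close> and \<open>Z\<close> as
  infima through their half-line events, and \<open>mono\<close> makes these events increase; both
  sides of the product formula then converge by continuity of the measure.\<close>

lemma indep_copy_limit:
  assumes copies: "\<And>n. indep_copy t (Yn n) (Zn n)"
    and Y: "Y \<in> borel_measurable M" and Z: "Z \<in> borel_measurable M"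
    and mono: "\<And>n \<omega>. \<omega> \<in> space M \<Longrightarrow> Yn (Suc n) \<omega> \<le> Yn n \<omega>"
      "\<And>n \<omega>. \<omega> \<in> space M \<Longrightarrow> Zn (Suc n) \<omega> \<le> Zn n \<omega>"
    and lim: "\<And>a \<omega>. \<omega> \<in> space M \<Longrightarrow> Y \<omega> < a \<longleftrightarrow> (\<exists>n. Yn n \<omega> < a)"
      "\<And>a \<omega>. \<omega> \<in> space M \<Longrightarrow> Z \<omega> < a \<longleftrightarrow> (\<exists>n. Zn n \<omega> < a)"
  shows "indep_copy t Y Z"
proof (rule indep_copy_of_half_lines[OF Y Z])
  fix C a assume C: "C \<in> sets (F (ennreal t))"
  have [measurable]: "C \<in> events" "\<And>n. Yn n \<in> borel_measurable M" "\<And>n. Zn n \<in> borel_measurable M"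
    using sets_F[OF C] copies by (auto simp: indep_copy_def)
  have "(\<lambda>n. prob (C \<inter> {\<omega>\<in>space M. Yn n \<omega> < a})) \<longlonglongrightarrow> prob (\<Union>n. C \<inter> {\<omega>\<in>space M. Yn n \<omega> < a})"
    by (rule finite_Lim_measure_incseq)
      (auto intro!: incseq_SucI intro: le_less_trans[OF mono(1)])
  moreover have "(\<Union>n. C \<inter> {\<omega>\<in>space M. Yn n \<omega> < a}) = C \<inter> {\<omega>\<in>space M. Y \<omega> < a}"
    using lim(1) by auto
  moreover have "prob (C \<inter> {\<omega>\<in>space M. Yn n \<omega> < a}) = prob C * prob {\<omega>\<in>space M. Zn n \<omega> < a}" for n
  proof -
    have "Yn n -` {..<a} \<inter> space M = {\<omega>\<in>space M. Yn n \<omega> < a}"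
      "Zn n -` {..<a} \<inter> space M = {\<omega>\<in>space M. Zn n \<omega> < a}" by auto
    then show ?thesis
      using copies[of n] C unfolding indep_copy_def by (metis lessThan_borel)
  qed
  moreover have "(\<lambda>n. prob C * prob {\<omega>\<in>space M. Zn n \<omega> < a})
      \<longlonglongrightarrow> prob C * prob (\<Union>n. {\<omega>\<in>space M. Zn n \<omega> < a})"
    by (intro tendsto_mult tendsto_const finite_Lim_measure_incseq)
      (auto intro!: incseq_SucI intro: le_less_trans[OF mono(2)])
  moreover have "(\<Union>n. {\<omega>\<in>space M. Zn n \<omega> < a}) = {\<omega>\<in>space M. Z \<omega> < a}"
    using lim(2) by auto
  ultimately show "prob (C \<inter> {\<omega>\<in>space M. Y \<omega> < a}) = prob C * prob {\<omega>\<in>space M. Z \<omega> < a}"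
    using LIMSEQ_unique by fastforce
qed

lemma indep_copy_increment:
  assumes "0 \<le> t" "0 \<le> h"
  shows "indep_copy t (increment t h) (X h)"
  unfolding indep_copy_def
proof (intro conjI ballI)
  note [measurable] = increment_measurable[OF assms] X_measurable[OF assms(2)]
  show "increment t h \<in> borel_measurable M" "X h \<in> borel_measurable M" by measurable
  fix C B assume C: "C \<in> sets (F (ennreal t))" and B[measurable]: "B \<in> sets (borel :: real measure)"
  have inc: "increment t h = (\<lambda>\<omega>. X (t + h) \<omega> - X t \<omega>)"
    by (simp add: increment_def fun_eq_iff)
  have "prob (C \<inter> (increment t h -` B \<inter> space M)) = prob C * prob (increment t h -` B \<inter> space M)"
  proof -
    have "increment t h -` B \<inter> space M \<in> {(\<lambda>\<omega>. X (t + h) \<omega> - X t \<omega>) -` B \<inter> space M | B. B \<in> sets borel}"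
      using B unfolding inc by blast
    moreover have "indep_set (sets (F (ennreal t))) {(\<lambda>\<omega>. X (t + h) \<omega> - X t \<omega>) -` B \<inter> space M | B. B \<in> sets borel}"
      using assms by (intro indep_increments) auto
    ultimately show ?thesis using C by (intro indep_setD)
  qed
  also have "prob (increment t h -` B \<inter> space M) = prob (X h -` B \<inter> space M)"
  proof -
    have "measure (distr M borel (increment t h)) B = measure (distr M borel (X h)) B"
      using stationary_increments[of t "t + h"] assms unfolding inc by simp
    then show ?thesis by (simp add: measure_distr)
  qed
  finally show "prob (C \<inter> (increment t h -` B \<inter> space M)) = prob C * prob (X h -` B \<inter> space M)" .
qed

text \<open>Two replacements in succession: given the past of \<open>t + h\<close>, \<open>Y\<close>
  may be exchanged for \<open>Z\<close>, and given the past of \<open>t\<close>, the increment for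
  \<open>X h\<close>.\<close>

lemma indep_copy_increment_step:
  assumes t: "0 \<le> t" and h: "0 \<le> h"
    and Y: "indep_copy (t + h) Y Z" and Y0: "indep_copy h Y0 Z"
    and g[measurable]: "g \<in> borel_measurable (borel \<Otimes>\<^sub>M borel)"
  shows "indep_copy t (\<lambda>\<omega>. g (increment t h \<omega>, Y \<omega>)) (\<lambda>\<omega>. g (increment 0 h \<omega>, Y0 \<omega>))"
proof -
  have [measurable]: "Z \<in> borel_measurable M" "X h \<in> borel_measurable M"
    using Y X_measurable[OF h] by (auto simp: indep_copy_def)
  define \<psi> where "\<psi> B y = (\<integral>\<^sup>+\<omega>'. indicator B (g (y, Z \<omega>')) \<partial>M)" for B :: "real set" and y
  have [measurable]: "\<psi> B \<in> borel_measurable borel" if [measurable]: "B \<in> sets borel" for B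
    unfolding \<psi>_def by measurable
  \<comment> \<open>The second factor depends only on \<open>B\<close> and the law of
    \<open>X h\<close>, so the same formula at time 0 with \<open>C = space M\<close> identifies the
    law of the copy.\<close>
  have step: "emeasure M (C \<inter> ((\<lambda>\<omega>. g (increment t h \<omega>, Y \<omega>)) -` B \<inter> space M))
      = emeasure M C * (\<integral>\<^sup>+\<omega>'. \<psi> B (X h \<omega>') \<partial>M)"
    if t: "0 \<le> t" and C: "C \<in> sets (F (ennreal t))" and B[measurable]: "B \<in> sets borel"
      and Y: "indep_copy (t + h) Y Z" for t C B Y
  proof -
    have C'[measurable]: "C \<in> events" using sets_F[OF C] .
    have Ch: "C \<in> sets (F (ennreal (t + h)))"
      using C sets_F_mono[of "ennreal t" "ennreal (t + h)"] h t by (auto simp: ennreal_leI)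
    have [measurable]: "Y \<in> borel_measurable M" "increment t h \<in> borel_measurable M"
      using Y h t increment_measurable by (auto simp: indep_copy_def)
    have U: "(\<lambda>\<omega>. (indicator C \<omega> :: ennreal, increment t h \<omega>)) \<in> F (ennreal (t + h)) \<rightarrow>\<^sub>M borel \<Otimes>\<^sub>M borel"
      by (intro measurable_Pair borel_measurable_indicator Ch increment_measurable_F h t)
    have "emeasure M (C \<inter> ((\<lambda>\<omega>. g (increment t h \<omega>, Y \<omega>)) -` B \<inter> space M))
        = (\<integral>\<^sup>+\<omega>. indicator (C \<inter> ((\<lambda>\<omega>. g (increment t h \<omega>, Y \<omega>)) -` B \<inter> space M)) \<omega> \<partial>M)"
      by (rule nn_integral_indicator[symmetric]) measurable
    also have "\<dots> = (\<integral>\<^sup>+\<omega>. indicator C \<omega> * indicator B (g (increment t h \<omega>, Y \<omega>)) \<partial>M)"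
      by (intro nn_integral_cong) (simp split: split_indicator)
    also have "\<dots> = (\<integral>\<^sup>+\<omega>. \<integral>\<^sup>+\<omega>'. indicator C \<omega> * indicator B (g (increment t h \<omega>, Z \<omega>')) \<partial>M \<partial>M)"
    proof -
      have "(\<lambda>z. (fst (fst z) :: ennreal) * indicator B (g (snd (fst z), snd z)))
          \<in> borel_measurable ((borel \<Otimes>\<^sub>M borel) \<Otimes>\<^sub>M (borel :: real measure))" by measurable
      then show ?thesis
        using indep_copy_nn_integral[OF Y U, of "\<lambda>z. fst (fst z) * indicator B (g (snd (fst z), snd z))"]
        by (simp only: fst_conv snd_conv)
    qed
    also have "\<dots> = (\<integral>\<^sup>+\<omega>. indicator C \<omega> * \<psi> B (increment t h \<omega>) \<partial>M)"
      unfolding \<psi>_def by (intro nn_integral_cong nn_integral_cmult) measurable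
    also have "\<dots> = emeasure M C * (\<integral>\<^sup>+\<omega>'. \<psi> B (X h \<omega>') \<partial>M)"
      by (rule indep_copy_nn_integral_indicator[OF indep_copy_increment[OF t h] C]) measurable
    finally show ?thesis .
  qed
  have sp: "space M \<in> sets (F (ennreal 0))" using sets.top[of "F 0"] by (simp add: space_F)
  have [measurable]: "Y \<in> borel_measurable M" "Y0 \<in> borel_measurable M"
      "increment t h \<in> borel_measurable M" "increment 0 h \<in> borel_measurable M"
    using Y Y0 h t increment_measurable by (auto simp: indep_copy_def)
  show ?thesis
    unfolding indep_copy_def
  proof (intro conjI ballI)
    fix C B assume C: "C \<in> sets (F (ennreal t))" and B: "B \<in> sets (borel :: real measure)"
    let ?V = "\<lambda>\<omega>. g (increment t h \<omega>, Y \<omega>)" and ?W = "\<lambda>\<omega>. g (increment 0 h \<omega>, Y0 \<omega>)"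
    have "emeasure M (space M \<inter> (?W -` B \<inter> space M)) = emeasure M (space M) * (\<integral>\<^sup>+\<omega>'. \<psi> B (X h \<omega>') \<partial>M)"
      using Y0 by (intro step[OF order_refl sp B]) simp
    then have "emeasure M (?W -` B \<inter> space M) = (\<integral>\<^sup>+\<omega>'. \<psi> B (X h \<omega>') \<partial>M)"
      by (simp add: emeasure_space_1 Int_absorb1)
    then have "emeasure M (C \<inter> (?V -` B \<inter> space M)) = emeasure M C * emeasure M (?W -` B \<inter> space M)"
      using step[OF t C B Y] by simp
    then show "prob (C \<inter> (?V -` B \<inter> space M)) = prob C * prob (?W -` B \<inter> space M)"
      by (simp add: measure_def enn2real_mult)
  qed measurable
qed

text \<open>Splitting off the first step rather than the last leaves a remainder that involves only
  the process after \<open>t + h\<close>, which is the shape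
  \<open>indep_copy_increment_step\<close> asks for. The value is the minimum of the increments over
  \<open>n + 1\<close> grid times.\<close>

fun grid_min :: "real \<Rightarrow> real \<Rightarrow> nat \<Rightarrow> 'a \<Rightarrow> real" where
  "grid_min h t 0 \<omega> = 0"
| "grid_min h t (Suc n) \<omega> = min 0 (increment t h \<omega> + grid_min h (t + h) n \<omega>)"

lemma grid_min_less_iff:
  "grid_min h t n \<omega> < a \<longleftrightarrow> (\<exists>k\<le>n. increment t (real k * h) \<omega> < a)"
proof (induction n arbitrary: t a)
  case (Suc n)
  have "grid_min h t (Suc n) \<omega> < a
      \<longleftrightarrow> 0 < a \<or> grid_min h (t + h) n \<omega> < a - increment t h \<omega>" by auto
  also have "\<dots> \<longleftrightarrow> 0 < a \<or> (\<exists>k\<le>n. increment (t + h) (real k * h) \<omega> < a - increment t h \<omega>)"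
    unfolding Suc.IH ..
  also have "\<dots> \<longleftrightarrow> 0 < a \<or> (\<exists>k\<le>n. increment t (real (Suc k) * h) \<omega> < a)"
    by (simp add: increment_def algebra_simps)
  also have "\<dots> \<longleftrightarrow> (\<exists>k\<le>Suc n. increment t (real k * h) \<omega> < a)"
  proof -
    have "(\<exists>k\<le>Suc n. P k) \<longleftrightarrow> P 0 \<or> (\<exists>k\<le>n. P (Suc k))" for P
      by (metis Suc_le_mono le0 not0_implies_Suc)
    then show ?thesis by simp
  qed
  finally show ?case .
qed simp

lemma indep_copy_grid_min:
  assumes "0 \<le> h" "0 \<le> t"
  shows "indep_copy t (grid_min h t n) (grid_min h 0 n)"
  using assms(2)
proof (induction n arbitrary: t)
  case 0
  show ?case
    unfolding indep_copy_def
  proof (intro conjI ballI)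
    fix C B assume "C \<in> sets (F (ennreal t))"
    then have "C \<subseteq> space M" using sets.sets_into_space sets_F by blast
    then show "prob (C \<inter> (grid_min h t 0 -` B \<inter> space M)) = prob C * prob (grid_min h 0 0 -` B \<inter> space M)"
      by (cases "0 \<in> B") (auto simp: vimage_def prob_space Int_absorb2)
  qed (simp_all add: grid_min.simps(1)[abs_def])
next
  case (Suc n)
  have "indep_copy t (\<lambda>\<omega>. min 0 (increment t h \<omega> + grid_min h (t + h) n \<omega>))
      (\<lambda>\<omega>. min 0 (increment 0 h \<omega> + grid_min h h n \<omega>))"
    using indep_copy_increment_step[OF Suc.prems assms(1) Suc.IH Suc.IH, of "\<lambda>z. min 0 (fst z + snd z)"]
      assms Suc.prems by simp
  then show ?case by (simp add: grid_min.simps(2)[abs_def])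
qed

lemma future_inf_less_iff_grid:
  assumes "\<omega> \<in> space M" "0 \<le> t" "0 \<le> u"
  shows "future_inf t (ennreal u) \<omega> < a \<longleftrightarrow> (\<exists>n. grid_min (u / 2 ^ n) t (2 ^ n) \<omega> < a)"
proof -
  have "horizon (ennreal u)" by (simp add: horizon_def)
  note less_iff = future_inf_less_iff[OF assms(1,2) this, of a]
  show ?thesis
    unfolding less_iff grid_min_less_iff
  proof safe
    fix s assume s: "0 \<le> s" "ennreal s \<le> ennreal u" "increment t s \<omega> < a"
    then have "s \<le> u" using assms by simp
    show "\<exists>n. \<exists>k\<le>2 ^ n. increment t (real k * (u / 2 ^ n)) \<omega> < a"
    proof (cases "s = u")
      case True
      then show ?thesis using s by (intro exI[of _ 0] exI[of _ 1]) auto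
    next
      case False
      with \<open>s \<le> u\<close> s have "s < u" "0 < u" by auto
      obtain d where d: "0 < d" "\<And>y. s \<le> y \<Longrightarrow> y < s + d \<Longrightarrow> increment t y \<omega> < a"
        using right_continuous_less_near[OF increment_right_continuous[OF assms(1,2) s(1)] s(3)] by blast
      \<comment> \<open>The bound \<open>u - s\<close> keeps the grid point within the horizon;
        \<open>d / 2\<close> keeps it strictly inside the interval where the path is below
        \<open>a\<close>.\<close>
      define d' where "d' = min (d / 2) (u - s)"
      have "0 < d' / u" using d \<open>s < u\<close> \<open>0 < u\<close> by (auto simp: d'_def)
      then obtain n where "(1/2::real) ^ n < d' / u"
        using real_arch_pow_inv[of "d' / u" "1/2"] by auto
      then have "u / 2 ^ n \<le> d'" using \<open>0 < u\<close> by (simp add: field_simps power_one_over)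
      then obtain k :: nat where k: "s < real k * (u / 2 ^ n)" "real k * (u / 2 ^ n) \<le> s + d'"
        using exists_grid_point[of "u / 2 ^ n" d' s] \<open>0 < u\<close> s by auto
      have "real k * (u / 2 ^ n) \<le> u" using k(2) by (auto simp: d'_def)
      then have "real k \<le> 2 ^ n" using \<open>0 < u\<close> by (simp add: field_simps)
      then have "k \<le> 2 ^ n" by (metis of_nat_le_iff of_nat_numeral of_nat_power)
      moreover have "increment t (real k * (u / 2 ^ n)) \<omega> < a"
        using d(1) k by (intro d(2)) (auto simp: d'_def)
      ultimately show ?thesis by blast
    qed
  next
    fix n k assume "k \<le> (2::nat) ^ n" "increment t (real k * (u / 2 ^ n)) \<omega> < a"
    moreover have "real k * (u / 2 ^ n) \<le> u"
    proof -
      have "real k \<le> 2 ^ n" using \<open>k \<le> 2 ^ n\<close> by (metis of_nat_le_iff of_nat_numeral of_nat_power)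
      then have "real k * u \<le> 2 ^ n * u" using assms by (intro mult_right_mono) auto
      then show ?thesis by (simp add: field_simps)
    qed
    ultimately show "\<exists>s\<ge>0. ennreal s \<le> ennreal u \<and> increment t s \<omega> < a"
      using assms by (intro exI[of _ "real k * (u / 2 ^ n)"]) (auto intro: ennreal_leI)
  qed
qed

lemma grid_min_refine: "grid_min (u / 2 ^ Suc n) t (2 ^ Suc n) \<omega> \<le> grid_min (u / 2 ^ n) t (2 ^ n) \<omega>"
proof (rule ccontr)
  assume "\<not> ?thesis"
  then obtain k where k: "k \<le> 2 ^ n" "increment t (real k * (u / 2 ^ n)) \<omega> < grid_min (u / 2 ^ Suc n) t (2 ^ Suc n) \<omega>"
    using grid_min_less_iff by (auto simp: not_le)
  then have "grid_min (u / 2 ^ Suc n) t (2 ^ Suc n) \<omega> < grid_min (u / 2 ^ Suc n) t (2 ^ Suc n) \<omega>"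
    by (subst grid_min_less_iff, intro exI[of _ "2 * k"]) (auto simp: field_simps)
  then show False by simp
qed

text \<open>Refining dyadic grids, which are nested and contain the endpoint, reach a finite
  horizon; growing integer horizons then reach the infinite one, which occurs only for
  \<open>r = 0\<close>.\<close>

lemma indep_copy_future_inf:
  assumes t: "0 \<le> t" and u: "horizon u"
  shows "indep_copy t (future_inf t u) (future_inf 0 u)"
proof -
  have finite: "indep_copy t (future_inf t (ennreal v)) (future_inf 0 (ennreal v))" if "0 \<le> v" for v
    by (rule indep_copy_limit[where Yn="\<lambda>n. grid_min (v / 2 ^ n) t (2 ^ n)" and Zn="\<lambda>n. grid_min (v / 2 ^ n) 0 (2 ^ n)"])
      (use t that in \<open>auto intro!: indep_copy_grid_min future_inf_measurable grid_min_refine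
        simp: future_inf_less_iff_grid simp del: power_Suc\<close>)
  show ?thesis
  proof (cases u)
    case (real v)
    then show ?thesis using finite by simp
  next
    case top
    with u have r: "r = 0" by (simp add: horizon_def)
    have hor: "horizon v" for v unfolding horizon_def using r by (rule disjI2)
    have mono: "future_inf s (ennreal (real (Suc n))) \<omega> \<le> future_inf s (ennreal (real n)) \<omega>"
      if "\<omega> \<in> space M" "0 \<le> s" for s n \<omega>
    proof (rule future_inf_ge)
      fix v assume v: "0 \<le> v" "ennreal v \<le> ennreal (real n)"
      have "ennreal (real n) \<le> ennreal (real (Suc n))" by (rule ennreal_leI) simp
      with v(2) have "ennreal v \<le> ennreal (real (Suc n))" by (rule order_trans)
      then show "future_inf s (ennreal (real (Suc n))) \<omega> \<le> increment s v \<omega>"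
        by (rule future_inf_le[OF that hor v(1)])
    qed
    have lim: "future_inf s \<infinity> \<omega> < a \<longleftrightarrow> (\<exists>n. future_inf s (ennreal (real n)) \<omega> < a)"
      if "\<omega> \<in> space M" "0 \<le> s" for s a \<omega>
      unfolding future_inf_less_iff[OF that hor]
    proof safe
      fix v assume v: "0 \<le> v" "increment s v \<omega> < a"
      then show "\<exists>n. \<exists>v\<ge>0. ennreal v \<le> ennreal (real n) \<and> increment s v \<omega> < a"
        by (intro exI[of _ "nat \<lceil>v\<rceil>"] exI[of _ v] conjI ennreal_leI real_nat_ceiling_ge)
    qed (auto intro: exI)
    show ?thesis
      unfolding top infinity_ennreal_def[symmetric]
      by (rule indep_copy_limit[where Yn="\<lambda>n. future_inf t (ennreal (real n))"
            and Zn="\<lambda>n. future_inf 0 (ennreal (real n))"])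
        (use t mono lim in \<open>auto intro!: finite future_inf_measurable simp del: of_nat_Suc\<close>)
  qed
qed

end

section \<open>The exponential time\<close>

lemma sets_exp_time_law [measurable_cong, simp]: "sets (exp_time_law r) = sets borel"
  by (simp add: exp_time_law_def)

lemma space_exp_time_law [simp]: "space (exp_time_law r) = UNIV"
  using sets_eq_imp_space_eq[OF sets_exp_time_law] by simp

lemma prob_space_exp_time_law:
  assumes "0 \<le> r" shows "prob_space (exp_time_law r)"
proof (cases "r = 0")
  case False
  interpret prob_space "density lborel (\<lambda>t. ennreal (exponential_density r t))"
    by (rule prob_space_exponential_density) (use False assms in simp)
  show ?thesis using False by (auto simp: exp_time_law_def intro: prob_space_distr)
qed (simp add: exp_time_law_def prob_space_return)

lemma nn_integral_exp_time_law:
  assumes "0 < r" and [measurable]: "\<phi> \<in> borel_measurable borel"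
  shows "(\<integral>\<^sup>+e. \<phi> e \<partial>exp_time_law r) = (\<integral>\<^sup>+t. ennreal (exponential_density r t) * \<phi> (ennreal t) \<partial>lborel)"
  using assms by (simp add: exp_time_law_def nn_integral_distr nn_integral_density)

text \<open>The law has a density, so it does not charge countable sets. Later \<open>S\<close> is
  the set of discontinuities of a running infimum.\<close>

lemma AE_exp_time_law:
  assumes "0 < r" "countable S"
  shows "AE e in exp_time_law r. \<exists>t>0. e = ennreal t \<and> t \<notin> S"
proof -
  have "{e. \<exists>t>0. e = ennreal t \<and> t \<notin> S} = {0<..<\<infinity>} - ennreal ` (S \<inter> {0..})"
  proof (intro set_eqI iffI)
    fix e assume "e \<in> {0<..<\<infinity>} - ennreal ` (S \<inter> {0..})"
    then show "e \<in> {e. \<exists>t>0. e = ennreal t \<and> t \<notin> S}"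
      by (cases e) auto
  qed (auto simp: image_iff)
  moreover have "ennreal ` (S \<inter> {0..}) \<in> sets borel"
    by (rule sets.countable) (use assms in auto)
  ultimately have [measurable]: "{e. \<exists>t>0. e = ennreal t \<and> t \<notin> S} \<in> sets borel"
    by simp
  have "AE t in lborel. t \<notin> S \<union> {0}"
    by (rule AE_not_in) (use assms in \<open>simp add: countable_imp_null_set_lborel\<close>)
  then have "AE t in lborel. ennreal (exponential_density r t) > 0 \<longrightarrow> (\<exists>t'>0. ennreal t = ennreal t' \<and> t' \<notin> S)"
  proof eventually_elim
    case (elim t)
    then show ?case by (auto simp: exponential_density_def split: if_splits intro!: exI[of _ t])
  qed
  then have "AE t in density lborel (\<lambda>t. ennreal (exponential_density r t)).
      \<exists>t'>0. ennreal t = ennreal t' \<and> t' \<notin> S"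
    by (subst AE_density) auto
  then show ?thesis
    using assms unfolding exp_time_law_def by (simp add: AE_distr_iff del: ennreal_inj)
qed

text \<open>Shifting the integration variable by \<open>t\<close> splits \<open>e^(-rt)\<close> off
  the density. For \<open>r = 0\<close> the time is infinite, exceeds \<open>t\<close> and stays
  infinite after subtraction, so the formula holds with factor 1.\<close>

lemma exp_time_law_memoryless:
  assumes r: "0 \<le> r" and t: "0 \<le> t" and [measurable]: "\<phi> \<in> borel_measurable borel"
  shows "(\<integral>\<^sup>+e. (if ennreal t < e then \<phi> (e - ennreal t) else 0) \<partial>exp_time_law r)
    = ennreal (exp (- r * t)) * (\<integral>\<^sup>+e. \<phi> e \<partial>exp_time_law r)"
proof (cases "r = 0")
  case True
  then show ?thesis by (simp add: exp_time_law_def nn_integral_return)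
next
  case False
  with r have r': "0 < r" by simp
  have "(\<integral>\<^sup>+e. (if ennreal t < e then \<phi> (e - ennreal t) else 0) \<partial>exp_time_law r)
      = (\<integral>\<^sup>+u. ennreal (exponential_density r u) * (if ennreal t < ennreal u then \<phi> (ennreal u - ennreal t) else 0) \<partial>lborel)"
    by (rule nn_integral_exp_time_law[OF r']) measurable
  also have "\<dots> = (\<integral>\<^sup>+u. ennreal (exponential_density r (t + u)) *
      (if ennreal t < ennreal (t + u) then \<phi> (ennreal (t + u) - ennreal t) else 0) \<partial>lborel)"
    using nn_integral_real_affine[of "\<lambda>u. ennreal (exponential_density r u) *
        (if ennreal t < ennreal u then \<phi> (ennreal u - ennreal t) else 0)" 1 t]
    by (simp only: mult_1_left measurable abs_one ennreal_1) simp
  also have "\<dots> = (\<integral>\<^sup>+u. ennreal (exp (- r * t)) * (ennreal (exponential_density r u) * \<phi> (ennreal u)) \<partial>lborel)"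
  proof (rule nn_integral_cong_AE)
    \<comment> \<open>The point \<open>u = 0\<close> must be excluded: there the strict inequality
      fails while the density equals \<open>r\<close>.\<close>
    show "AE u in lborel. ennreal (exponential_density r (t + u)) *
        (if ennreal t < ennreal (t + u) then \<phi> (ennreal (t + u) - ennreal t) else 0)
      = ennreal (exp (- r * t)) * (ennreal (exponential_density r u) * \<phi> (ennreal u))"
      using AE_lborel_singleton[of 0]
    proof eventually_elim
      case (elim u)
      show ?case
      proof (cases "0 < u")
        case True
        have "exponential_density r (t + u) = exp (- r * t) * exponential_density r u"
          using True t by (simp add: exponential_density_def algebra_simps flip: exp_add)
        then show ?thesis
          using True t r' by (simp add: ennreal_less_iff ennreal_minus ennreal_mult exponential_density_def ac_simps)
      next
        case False
        then have "u < 0" using elim by simp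
        then have "\<not> ennreal t < ennreal (t + u)" by (auto simp: not_less intro!: ennreal_leI)
        then show ?thesis using \<open>u < 0\<close> by (simp add: exponential_density_def)
      qed
    qed
  qed
  also have "\<dots> = ennreal (exp (- r * t)) * (\<integral>\<^sup>+e. \<phi> e \<partial>exp_time_law r)"
    unfolding nn_integral_exp_time_law[OF r' assms(3)] by (rule nn_integral_cmult) measurable
  finally show ?thesis .
qed

context regular_path_levy
begin

abbreviation time_law :: "ennreal measure" where "time_law \<equiv> exp_time_law r"

sublocale time: prob_space time_law
  using rate_nonneg by (rule prob_space_exp_time_law)

sublocale product: pair_prob_space M time_law ..

lemma AE_horizon: "AE e in time_law. horizon e"
proof (cases "r = 0")
  case True
  have "horizon e" for e unfolding horizon_def using True by (rule disjI2)
  then show ?thesis by (intro AE_I2)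
next
  case False
  then have "AE e in time_law. \<exists>t>0. e = ennreal t \<and> t \<notin> {}"
    using rate_nonneg by (intro AE_exp_time_law) auto
  then show ?thesis by eventually_elim (auto simp: horizon_def)
qed

lemma future_inf_compose_measurable:
  assumes "0 \<le> t" and [measurable]: "g \<in> L \<rightarrow>\<^sub>M M" "u \<in> L \<rightarrow>\<^sub>M borel"
  shows "(\<lambda>z. future_inf t (u z) (g z)) \<in> borel_measurable L"
proof -
  have "(\<lambda>z. (g z, u z)) \<in> L \<rightarrow>\<^sub>M M \<Otimes>\<^sub>M borel" by measurable
  from measurable_compose[OF this future_inf_jointly_measurable[OF assms(1)]] show ?thesis by simp
qed

text \<open>The simple Markov property at the fixed time \<open>t\<close>, together with the lack of memory of \<open>e\<^sub>r\<close>.\<close>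

lemma markov_nn_integral:
  assumes t: "0 \<le> t" and U: "U \<in> F (ennreal t) \<rightarrow>\<^sub>M N"
    and [measurable]: "\<phi> \<in> borel_measurable (N \<Otimes>\<^sub>M borel)"
  shows "(\<integral>\<^sup>+\<omega>. \<integral>\<^sup>+e. (if ennreal t < e then \<phi> (U \<omega>, future_inf t (e - ennreal t) \<omega>) else 0) \<partial>time_law \<partial>M)
    = ennreal (exp (- r * t)) * (\<integral>\<^sup>+\<omega>. \<integral>\<^sup>+\<omega>'. \<integral>\<^sup>+e. \<phi> (U \<omega>, future_inf 0 e \<omega>') \<partial>time_law \<partial>M \<partial>M)"
proof -
  have [measurable]: "U \<in> M \<rightarrow>\<^sub>M N" using measurable_F[OF U] .
  note [measurable] = future_inf_compose_measurable[OF t] future_inf_compose_measurable[OF order_refl]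
  \<comment> \<open>At a fixed horizon the past and the future infimum decouple by independence; the
    lack of memory then acts on the remaining function of the horizon.\<close>
  define \<psi> where "\<psi> e = (\<integral>\<^sup>+\<omega>. \<integral>\<^sup>+\<omega>'. \<phi> (U \<omega>, future_inf 0 e \<omega>') \<partial>M \<partial>M)" for e
  have [measurable]: "\<psi> \<in> borel_measurable borel"
    unfolding \<psi>_def by measurable
  have "(\<integral>\<^sup>+\<omega>. \<integral>\<^sup>+e. (if ennreal t < e then \<phi> (U \<omega>, future_inf t (e - ennreal t) \<omega>) else 0) \<partial>time_law \<partial>M)
      = (\<integral>\<^sup>+e. \<integral>\<^sup>+\<omega>. (if ennreal t < e then \<phi> (U \<omega>, future_inf t (e - ennreal t) \<omega>) else 0) \<partial>M \<partial>time_law)"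
    by (rule product.Fubini'[symmetric]) measurable
  also have "\<dots> = (\<integral>\<^sup>+e. (if ennreal t < e then \<psi> (e - ennreal t) else 0) \<partial>time_law)"
  proof (rule nn_integral_cong_AE)
    show "AE e in time_law. (\<integral>\<^sup>+\<omega>. (if ennreal t < e then \<phi> (U \<omega>, future_inf t (e - ennreal t) \<omega>) else 0) \<partial>M)
        = (if ennreal t < e then \<psi> (e - ennreal t) else 0)"
      using AE_horizon
    proof eventually_elim
      case (elim e)
      show ?case
        using indep_copy_nn_integral[OF indep_copy_future_inf[OF t horizon_diff[OF elim]] U, of \<phi>]
        by (simp add: \<psi>_def)
    qed
  qed
  also have "\<dots> = ennreal (exp (- r * t)) * (\<integral>\<^sup>+e. \<psi> e \<partial>time_law)"
    by (rule exp_time_law_memoryless[OF rate_nonneg t]) measurable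
  also have "(\<integral>\<^sup>+e. \<psi> e \<partial>time_law) = (\<integral>\<^sup>+\<omega>. \<integral>\<^sup>+e. \<integral>\<^sup>+\<omega>'. \<phi> (U \<omega>, future_inf 0 e \<omega>') \<partial>M \<partial>time_law \<partial>M)"
    unfolding \<psi>_def by (rule product.Fubini') measurable
  also have "\<dots> = (\<integral>\<^sup>+\<omega>. \<integral>\<^sup>+\<omega>'. \<integral>\<^sup>+e. \<phi> (U \<omega>, future_inf 0 e \<omega>') \<partial>time_law \<partial>M \<partial>M)"
    by (intro nn_integral_cong product.Fubini') measurable
  finally show ?thesis .
qed

section \<open>The value function\<close>

text \<open>This is E f (y + I). For \<open>f z = (c - e^z)^+\<close> with \<open>c = K m\<close> it
  turns out to be \<open>m\<close> times the value function.\<close>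

definition inf_mean :: "(real \<Rightarrow> ennreal) \<Rightarrow> real \<Rightarrow> ennreal" where
  "inf_mean f y = (\<integral>\<^sup>+\<omega>. \<integral>\<^sup>+e. f (y + future_inf 0 e \<omega>) \<partial>time_law \<partial>M)"

lemma inf_mean_measurable:
  assumes [measurable]: "f \<in> borel_measurable borel"
  shows "inf_mean f \<in> borel_measurable borel"
proof -
  note [measurable] = future_inf_compose_measurable[OF order_refl]
  show ?thesis unfolding inf_mean_def by measurable
qed

text \<open>The discount is the probability that the exponential time outlives \<open>t\<close>. On
  that event the remaining time has the original law and the future infimum is a fresh copy of
  I.\<close>

lemma markov_inf_mean:
  assumes t: "0 \<le> t" and C: "C \<in> sets (F (ennreal t))" and f[measurable]: "f \<in> borel_measurable borel"
  shows "(\<integral>\<^sup>+\<omega>. \<integral>\<^sup>+e. indicator C \<omega> * (if ennreal t < e then f (x + X t \<omega> + future_inf t (e - ennreal t) \<omega>) else 0) \<partial>time_law \<partial>M)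
    = ennreal (exp (- r * t)) * (\<integral>\<^sup>+\<omega>. indicator C \<omega> * inf_mean f (x + X t \<omega>) \<partial>M)"
proof -
  note [measurable] = future_inf_compose_measurable[OF order_refl]
  have [measurable]: "X t \<in> borel_measurable M" using X_measurable t .
  have U: "(\<lambda>\<omega>. (indicator C \<omega> :: ennreal, X t \<omega>)) \<in> F (ennreal t) \<rightarrow>\<^sub>M borel \<Otimes>\<^sub>M borel"
    by (intro measurable_Pair borel_measurable_indicator C adapted t)
  have \<phi>: "(\<lambda>z. fst (fst z) * f (x + snd (fst z) + snd z)) \<in> borel_measurable ((borel \<Otimes>\<^sub>M borel) \<Otimes>\<^sub>M borel)"
    by measurable
  have "(\<integral>\<^sup>+\<omega>. \<integral>\<^sup>+e. indicator C \<omega> * (if ennreal t < e then f (x + X t \<omega> + future_inf t (e - ennreal t) \<omega>) else 0) \<partial>time_law \<partial>M)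
    = (\<integral>\<^sup>+\<omega>. \<integral>\<^sup>+e. (if ennreal t < e then indicator C \<omega> * f (x + X t \<omega> + future_inf t (e - ennreal t) \<omega>) else 0) \<partial>time_law \<partial>M)"
    by (intro nn_integral_cong) simp
  also have "\<dots> = ennreal (exp (- r * t)) *
      (\<integral>\<^sup>+\<omega>. \<integral>\<^sup>+\<omega>'. \<integral>\<^sup>+e. indicator C \<omega> * f (x + X t \<omega> + future_inf 0 e \<omega>') \<partial>time_law \<partial>M \<partial>M)"
    using markov_nn_integral[OF t U \<phi>] by (simp only: fst_conv snd_conv)
  also have "(\<integral>\<^sup>+\<omega>. \<integral>\<^sup>+\<omega>'. \<integral>\<^sup>+e. indicator C \<omega> * f (x + X t \<omega> + future_inf 0 e \<omega>') \<partial>time_law \<partial>M \<partial>M)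
      = (\<integral>\<^sup>+\<omega>. indicator C \<omega> * inf_mean f (x + X t \<omega>) \<partial>M)"
  proof (rule nn_integral_cong)
    fix \<omega> assume [simp]: "\<omega> \<in> space M"
    have "(\<integral>\<^sup>+\<omega>'. \<integral>\<^sup>+e. indicator C \<omega> * f (x + X t \<omega> + future_inf 0 e \<omega>') \<partial>time_law \<partial>M)
        = (\<integral>\<^sup>+\<omega>'. indicator C \<omega> * (\<integral>\<^sup>+e. f (x + X t \<omega> + future_inf 0 e \<omega>') \<partial>time_law) \<partial>M)"
      by (intro nn_integral_cong nn_integral_cmult) measurable
    also have "\<dots> = indicator C \<omega> * inf_mean f (x + X t \<omega>)"
      unfolding inf_mean_def by (rule nn_integral_cmult) measurable
    finally show "(\<integral>\<^sup>+\<omega>'. \<integral>\<^sup>+e. indicator C \<omega> * f (x + X t \<omega> + future_inf 0 e \<omega>') \<partial>time_law \<partial>M)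
        = indicator C \<omega> * inf_mean f (x + X t \<omega>)" .
  qed
  finally show ?thesis .
qed

text \<open>Discrete optional stopping for the supermartingale \<open>e\<^sup>-\<^sup>r\<^sup>t E f (x + X\<^sub>t + I)\<close>; the events
  \<open>C k\<close> are those on which stopping occurs at time \<open>\<tau> k\<close>.\<close>

lemma stopped_inf_mean_le:
  assumes \<tau>: "\<And>k. 0 \<le> \<tau> k" and C: "\<And>k. C k \<in> sets (F (ennreal (\<tau> k)))" and disj: "disjoint_family C"
    and f[measurable]: "f \<in> borel_measurable borel" and "antimono f"
  shows "(\<Sum>k::nat. ennreal (exp (- r * \<tau> k)) * (\<integral>\<^sup>+\<omega>. indicator (C k) \<omega> * inf_mean f (x + X (\<tau> k) \<omega>) \<partial>M))
    \<le> inf_mean f x"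
proof -
  note [measurable] = future_inf_compose_measurable[OF order_refl] sets_F[OF C]
  let ?g = "\<lambda>\<omega>. \<integral>\<^sup>+e. f (x + future_inf 0 e \<omega>) \<partial>time_law"
  have "ennreal (exp (- r * \<tau> k)) * (\<integral>\<^sup>+\<omega>. indicator (C k) \<omega> * inf_mean f (x + X (\<tau> k) \<omega>) \<partial>M)
      \<le> (\<integral>\<^sup>+\<omega>. indicator (C k) \<omega> * ?g \<omega> \<partial>M)" for k
    unfolding markov_inf_mean[OF \<tau> C f, symmetric]
  proof (rule nn_integral_mono)
    fix \<omega> assume [simp]: "\<omega> \<in> space M"
    have "(\<integral>\<^sup>+e. indicator (C k) \<omega> * (if ennreal (\<tau> k) < e then f (x + X (\<tau> k) \<omega> + future_inf (\<tau> k) (e - ennreal (\<tau> k)) \<omega>) else 0) \<partial>time_law)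
        \<le> (\<integral>\<^sup>+e. indicator (C k) \<omega> * f (x + future_inf 0 e \<omega>) \<partial>time_law)"
    proof (rule nn_integral_mono_AE)
      show "AE e in time_law. indicator (C k) \<omega> * (if ennreal (\<tau> k) < e then f (x + X (\<tau> k) \<omega> + future_inf (\<tau> k) (e - ennreal (\<tau> k)) \<omega>) else 0)
          \<le> indicator (C k) \<omega> * f (x + future_inf 0 e \<omega>)"
        using AE_horizon
      proof eventually_elim
        case (elim e)
        show ?case
        proof (cases "ennreal (\<tau> k) < e")
          case True
          have "future_inf 0 e \<omega> \<le> X (\<tau> k) \<omega> + future_inf (\<tau> k) (e - ennreal (\<tau> k)) \<omega>"
            using future_inf_shift_le[OF \<open>\<omega> \<in> space M\<close> order_refl \<tau> elim less_imp_le[OF True]]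
            by (simp add: increment_from_zero)
          then have "f (x + X (\<tau> k) \<omega> + future_inf (\<tau> k) (e - ennreal (\<tau> k)) \<omega>) \<le> f (x + future_inf 0 e \<omega>)"
            by (intro antimonoD[OF \<open>antimono f\<close>]) linarith
          then show ?thesis using True by (simp add: mult_left_mono)
        qed simp
      qed
    qed
    also have "\<dots> = indicator (C k) \<omega> * ?g \<omega>"
      by (rule nn_integral_cmult) measurable
    finally show "(\<integral>\<^sup>+e. indicator (C k) \<omega> * (if ennreal (\<tau> k) < e then f (x + X (\<tau> k) \<omega> + future_inf (\<tau> k) (e - ennreal (\<tau> k)) \<omega>) else 0) \<partial>time_law)
        \<le> indicator (C k) \<omega> * ?g \<omega>" .
  qed
  then have "(\<Sum>k. ennreal (exp (- r * \<tau> k)) * (\<integral>\<^sup>+\<omega>. indicator (C k) \<omega> * inf_mean f (x + X (\<tau> k) \<omega>) \<partial>M))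
      \<le> (\<Sum>k. \<integral>\<^sup>+\<omega>. indicator (C k) \<omega> * ?g \<omega> \<partial>M)"
    by (intro suminf_le summableI)
  also have "\<dots> = (\<integral>\<^sup>+\<omega>. (\<Sum>k. indicator (C k) \<omega> * ?g \<omega>) \<partial>M)"
    by (rule nn_integral_suminf[symmetric]) measurable
  also have "\<dots> = (\<integral>\<^sup>+\<omega>. indicator (\<Union>k. C k) \<omega> * ?g \<omega> \<partial>M)"
    by (intro nn_integral_cong) (simp add: ennreal_suminf_multc suminf_indicator[OF disj])
  also have "\<dots> \<le> inf_mean f x"
    unfolding inf_mean_def by (rule nn_integral_mono) (simp split: split_indicator)
  finally show ?thesis .
qed

end

section \<open>Jensen's inequality for the put function, and the upper bound of the value\<close>

text \<open>Since \<open>ennreal\<close> sends negative reals to 0, it supplies the positive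
  part.\<close>

lemma put_payoff_scaled:
  assumes "0 \<le> m"
  shows "ennreal (m * put_payoff K y) = ennreal (K * m - exp y * m)"
proof (cases "exp y \<le> K")
  case True
  then have "m * put_payoff K y = K * m - exp y * m"
    by (simp add: put_payoff_def algebra_simps)
  then show ?thesis by simp
next
  case False
  then have "K * m \<le> exp y * m" using assms by (intro mult_right_mono) auto
  then show ?thesis using False by (simp add: put_payoff_def ennreal_neg)
qed

context regular_path_levy
begin

lemma inf_mean_product:
  assumes [measurable]: "f \<in> borel_measurable borel"
  shows "inf_mean f y = (\<integral>\<^sup>+z. f (y + future_inf 0 (snd z) (fst z)) \<partial>(M \<Otimes>\<^sub>M time_law))"
proof -
  note [measurable] = future_inf_compose_measurable[OF order_refl]
  show ?thesis
    unfolding inf_mean_def by (subst time.nn_integral_fst[symmetric]) simp_all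
qed

lemma inf_mean_mono:
  assumes "\<And>i. i \<le> 0 \<Longrightarrow> f (y + i) \<le> g (y + i)"
  shows "inf_mean f y \<le> inf_mean g y"
  unfolding inf_mean_def
proof (rule nn_integral_mono, rule nn_integral_mono_AE)
  fix \<omega> assume "\<omega> \<in> space M"
  show "AE e in time_law. f (y + future_inf 0 e \<omega>) \<le> g (y + future_inf 0 e \<omega>)"
    using AE_horizon by eventually_elim (auto intro!: assms future_inf_nonpos \<open>\<omega> \<in> space M\<close>)
qed

lemma inf_mean_const [simp]: "inf_mean (\<lambda>_. c) y = c"
  by (simp add: inf_mean_def emeasure_space_1 time.emeasure_space_1[simplified])

definition mean_exp_inf :: real where
  "mean_exp_inf = enn2real (inf_mean (\<lambda>z. ennreal (exp z)) 0)"

lemma inf_mean_exp: "inf_mean (\<lambda>z. ennreal (exp z)) y = ennreal (exp y * mean_exp_inf)"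
  and mean_exp_inf_le_1: "mean_exp_inf \<le> 1"
  and mean_exp_inf_pos: "0 < mean_exp_inf"
proof -
  note [measurable] = future_inf_compose_measurable[OF order_refl]
  interpret P: prob_space "M \<Otimes>\<^sub>M time_law"
    by (rule prob_space_pair[OF prob_space_axioms time.prob_space_axioms])
  let ?e = "inf_mean (\<lambda>z. ennreal (exp z)) 0"
  have "?e \<le> inf_mean (\<lambda>_. 1) 0" by (rule inf_mean_mono) simp
  then have le: "?e \<le> 1" by simp
  then have m: "ennreal mean_exp_inf = ?e"
    unfolding mean_exp_inf_def by (intro ennreal_enn2real) (auto simp: less_top[symmetric] top_unique)
  then show "mean_exp_inf \<le> 1" using le by (metis ennreal_le_1)
  have "inf_mean (\<lambda>z. ennreal (exp z)) y = ennreal (exp y) * ?e"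
    unfolding inf_mean_product[OF measurable_compose[OF borel_measurable_exp measurable_ennreal]] by (subst nn_integral_cmult[symmetric])
      (auto simp: exp_add ennreal_mult intro!: nn_integral_cong)
  then show "inf_mean (\<lambda>z. ennreal (exp z)) y = ennreal (exp y * mean_exp_inf)"
    unfolding m[symmetric] by (simp add: ennreal_mult')
  have "?e \<noteq> 0"
  proof
    assume "?e = 0"
    then have "AE z in M \<Otimes>\<^sub>M time_law. ennreal (exp (0 + future_inf 0 (snd z) (fst z))) = 0"
      by (subst (asm) inf_mean_product, simp) (subst (asm) nn_integral_0_iff_AE, auto)
    then show False by (simp add: ennreal_eq_0_iff not_le)
  qed
  then have "mean_exp_inf \<noteq> 0" using m by (metis ennreal_0)
  then show "0 < mean_exp_inf" unfolding mean_exp_inf_def by (simp add: order_less_le)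
qed

lemma inf_mean_add:
  assumes [measurable]: "f \<in> borel_measurable borel" "g \<in> borel_measurable borel"
  shows "inf_mean (\<lambda>z. f z + g z) y = inf_mean f y + inf_mean g y"
proof -
  note [measurable] = future_inf_compose_measurable[OF order_refl]
  show ?thesis
    by (simp add: inf_mean_product nn_integral_add)
qed

text \<open>Jensen's inequality, obtained by integrating \<open>c \<le> (c - e^z)^+ + e^z\<close> at
  \<open>z = y + I\<close> and using E e^(y + I) = e^y m.\<close>

lemma inf_mean_put_ge:
  assumes "0 \<le> c"
  shows "ennreal (c - exp y * mean_exp_inf) \<le> inf_mean (\<lambda>z. ennreal (c - exp z)) y"
proof -
  have "ennreal c = inf_mean (\<lambda>_. ennreal c) y" by simp
  also have "\<dots> \<le> inf_mean (\<lambda>z. ennreal (c - exp z) + ennreal (exp z)) y"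
  proof (rule inf_mean_mono)
    fix i
    show "ennreal c \<le> ennreal (c - exp (y + i)) + ennreal (exp (y + i))"
    proof (cases "exp (y + i) \<le> c")
      case True
      then have "ennreal (c - exp (y + i)) + ennreal (exp (y + i)) = ennreal (c - exp (y + i) + exp (y + i))"
        by (intro ennreal_plus[symmetric]) auto
      then show ?thesis by simp
    next
      case False
      then have "ennreal c \<le> ennreal (exp (y + i))" by (intro ennreal_leI) simp
      then show ?thesis by (rule order_trans) simp
    qed
  qed
  also have "\<dots> = inf_mean (\<lambda>z. ennreal (c - exp z)) y + ennreal (exp y * mean_exp_inf)"
    by (subst inf_mean_add) (auto simp: inf_mean_exp)
  finally have "ennreal c \<le> inf_mean (\<lambda>z. ennreal (c - exp z)) y + ennreal (exp y * mean_exp_inf)" .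
  then have "ennreal c - ennreal (exp y * mean_exp_inf) \<le> inf_mean (\<lambda>z. ennreal (c - exp z)) y"
    by (subst ennreal_minus_le_iff) (auto simp: add.commute)
  then show ?thesis using mean_exp_inf_pos by (subst ennreal_minus[symmetric]) auto
qed

text \<open>The equality case: as long as \<open>e^z \<le> c\<close> the function is affine in
  \<open>e^z\<close>, and \<open>y + I\<close> never leaves that region because I is
  nonpositive.\<close>

lemma inf_mean_put_le:
  assumes "exp y \<le> c"
  shows "inf_mean (\<lambda>z. ennreal (c - exp z)) y \<le> ennreal (c - exp y * mean_exp_inf)"
proof -
  have "0 \<le> c" using assms order_trans[OF exp_ge_zero] by blast
  have "inf_mean (\<lambda>z. ennreal (c - exp z)) y + ennreal (exp y * mean_exp_inf)
      = inf_mean (\<lambda>z. ennreal (c - exp z) + ennreal (exp z)) y"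
    by (subst inf_mean_add) (auto simp: inf_mean_exp)
  also have "\<dots> \<le> inf_mean (\<lambda>_. ennreal c) y"
  proof (rule inf_mean_mono)
    fix i :: real assume "i \<le> 0"
    then have "exp (y + i) \<le> c" using assms by (intro order_trans[OF _ assms]) simp
    then show "ennreal (c - exp (y + i)) + ennreal (exp (y + i)) \<le> ennreal c"
      by (subst ennreal_plus[symmetric]) auto
  qed
  finally have *: "inf_mean (\<lambda>z. ennreal (c - exp z)) y + ennreal (exp y * mean_exp_inf) \<le> ennreal c"
    by simp
  have "exp y * mean_exp_inf \<le> c"
    using mult_left_mono[OF mean_exp_inf_le_1, of "exp y"] order_trans[OF _ assms] by simp
  then have "ennreal c = ennreal (c - exp y * mean_exp_inf) + ennreal (exp y * mean_exp_inf)"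
    using mean_exp_inf_pos by (subst ennreal_plus[symmetric]) auto
  with * show ?thesis by simp
qed

lemma put_function_measurable [measurable]: "(\<lambda>z::real. ennreal (c - exp z)) \<in> borel_measurable borel"
  by measurable

text \<open>The times \<open>(k + 1) / (n + 1)\<close> approximate \<open>T\<close> from above, and on the grid the value dominates by
  Jensen's inequality and discrete optional stopping.\<close>

lemma stopped_payoff_le:
  assumes "0 < K" and T: "stopping_time F T"
  shows "ennreal (mean_exp_inf * (\<integral>\<omega>. stopped_payoff K r (\<lambda>t \<omega>. x + X t \<omega>) T \<omega> \<partial>M))
    \<le> inf_mean (\<lambda>z. ennreal (K * mean_exp_inf - exp z)) x"
proof -
  let ?m = mean_exp_inf and ?f = "\<lambda>z. ennreal (K * mean_exp_inf - exp z)"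
  let ?S = "stopped_payoff K r (\<lambda>t \<omega>. x + X t \<omega>) T"
  have m0: "0 \<le> ?m" using mean_exp_inf_pos by simp
  define \<tau> where "\<tau> n k = real (k + 1) / real (Suc n)" for n k
  have \<tau>0: "0 \<le> \<tau> n k" for n k by (simp add: \<tau>_def)
  \<comment> \<open>The slots are half-open. A finite value of \<open>T\<close> is thus rounded to a
    strictly later grid time, at which right continuity can be used and at which the slot event is
    already known.\<close>
  define C where "C n k = {\<omega>\<in>space M. ennreal (real k / real (Suc n)) \<le> T \<omega> \<and> T \<omega> < ennreal (\<tau> n k)}" for n k
  have C: "C n k \<in> sets (F (ennreal (\<tau> n k)))" for n k
  proof -
    have le: "ennreal (real k / real (Suc n)) \<le> ennreal (\<tau> n k)"
      by (rule ennreal_leI) (simp add: \<tau>_def divide_right_mono)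
    have "Measurable.pred (F (ennreal (\<tau> n k))) (\<lambda>\<omega>. T \<omega> < ennreal (\<tau> n k))"
      "Measurable.pred (F (ennreal (\<tau> n k))) (\<lambda>\<omega>. \<not> T \<omega> < ennreal (real k / real (Suc n)))"
      by (intro pred_intros_logic(2) measurable_F_mono[OF stopping_time_less_const[OF T]] le order_refl)+
    then have "Measurable.pred (F (ennreal (\<tau> n k)))
        (\<lambda>\<omega>. ennreal (real k / real (Suc n)) \<le> T \<omega> \<and> T \<omega> < ennreal (\<tau> n k))"
      by (simp add: not_less)
    then show ?thesis unfolding C_def by (simp add: pred_def space_F)
  qed
  have disj: "disjoint_family (C n)" for n
  proof -
    have "C n j \<inter> C n k = {}" if "j < k" for j k
    proof -
      have "\<tau> n j \<le> real k / real (Suc n)" using that by (simp add: \<tau>_def divide_right_mono)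
      then have le: "ennreal (\<tau> n j) \<le> ennreal (real k / real (Suc n))" by (rule ennreal_leI)
      have False if "\<omega> \<in> C n j" "\<omega> \<in> C n k" for \<omega>
      proof -
        have "T \<omega> < ennreal (\<tau> n j)" "ennreal (real k / real (Suc n)) \<le> T \<omega>"
          using that unfolding C_def by blast+
        with le show False by (meson leD order_trans)
      qed
      then show ?thesis by blast
    qed
    then show ?thesis unfolding disjoint_family_on_def by (metis Int_commute linorder_neqE_nat)
  qed
  define G where "G u \<omega> = exp (- r * u) * (?m * put_payoff K (x + X u \<omega>))" for u \<omega>
  \<comment> \<open>This is \<open>m\<close> times the payoff at the rounded time, as a sum whose
    terms each involve one fixed time. Where \<open>T\<close> is infinite no slot applies and the
    sum is 0.\<close>
  define P where "P n \<omega> = (\<Sum>k. indicator (C n k) \<omega> * ennreal (G (\<tau> n k) \<omega>))" for n \<omega>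
  have Gm[measurable]: "G (\<tau> n k) \<in> borel_measurable M" for n k
  proof -
    have [measurable]: "X (\<tau> n k) \<in> borel_measurable M" using X_measurable \<tau>0 .
    show ?thesis unfolding G_def put_payoff_def by measurable
  qed
  note [measurable] = sets_F[OF C]
  have P_le: "(\<integral>\<^sup>+\<omega>. P n \<omega> \<partial>M) \<le> inf_mean ?f x" for n
  proof -
    have "(\<integral>\<^sup>+\<omega>. P n \<omega> \<partial>M) = (\<Sum>k. \<integral>\<^sup>+\<omega>. indicator (C n k) \<omega> * ennreal (G (\<tau> n k) \<omega>) \<partial>M)"
      unfolding P_def by (rule nn_integral_suminf) measurable
    also have "\<dots> \<le> (\<Sum>k. ennreal (exp (- r * \<tau> n k)) *
        (\<integral>\<^sup>+\<omega>. indicator (C n k) \<omega> * inf_mean ?f (x + X (\<tau> n k) \<omega>) \<partial>M))"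
    proof (intro suminf_le summableI)
      fix k
      have [measurable]: "X (\<tau> n k) \<in> borel_measurable M" using X_measurable \<tau>0 .
      note [measurable] = inf_mean_measurable[OF put_function_measurable]
      have "(\<integral>\<^sup>+\<omega>. indicator (C n k) \<omega> * ennreal (G (\<tau> n k) \<omega>) \<partial>M)
          \<le> (\<integral>\<^sup>+\<omega>. ennreal (exp (- r * \<tau> n k)) * (indicator (C n k) \<omega> * inf_mean ?f (x + X (\<tau> n k) \<omega>)) \<partial>M)"
      proof (rule nn_integral_mono)
        fix \<omega>
        have "ennreal (?m * put_payoff K (x + X (\<tau> n k) \<omega>)) \<le> inf_mean ?f (x + X (\<tau> n k) \<omega>)"
          unfolding put_payoff_scaled[OF m0] using assms(1) m0 by (intro inf_mean_put_ge) simp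
        then show "indicator (C n k) \<omega> * ennreal (G (\<tau> n k) \<omega>)
            \<le> ennreal (exp (- r * \<tau> n k)) * (indicator (C n k) \<omega> * inf_mean ?f (x + X (\<tau> n k) \<omega>))"
          unfolding G_def by (simp add: ennreal_mult' mult_left_mono split: split_indicator)
      qed
      also have "\<dots> = ennreal (exp (- r * \<tau> n k)) *
          (\<integral>\<^sup>+\<omega>. indicator (C n k) \<omega> * inf_mean ?f (x + X (\<tau> n k) \<omega>) \<partial>M)"
        by (rule nn_integral_cmult) measurable
      finally show "(\<integral>\<^sup>+\<omega>. indicator (C n k) \<omega> * ennreal (G (\<tau> n k) \<omega>) \<partial>M)
          \<le> ennreal (exp (- r * \<tau> n k)) * (\<integral>\<^sup>+\<omega>. indicator (C n k) \<omega> * inf_mean ?f (x + X (\<tau> n k) \<omega>) \<partial>M)" .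
    qed
    also have "\<dots> \<le> inf_mean ?f x"
      by (rule stopped_inf_mean_le[OF \<tau>0 C disj put_function_measurable])
        (auto intro!: antimonoI ennreal_leI)
    finally show ?thesis .
  qed
  have liminf: "ennreal (?m * ?S \<omega>) \<le> liminf (\<lambda>n. P n \<omega>)" if \<omega>: "\<omega> \<in> space M" for \<omega>
  proof (cases "T \<omega>")
    case (real s)
    let ?k = "\<lambda>n. nat \<lfloor>real (Suc n) * s\<rfloor>"
    have "((\<lambda>u. X u \<omega>) \<longlongrightarrow> X s \<omega>) (at_right s)"
      using cadlagD(1)[OF path_cadlag[OF \<omega>]] real by simp
    then have "((\<lambda>u. G u \<omega>) \<longlongrightarrow> G s \<omega>) (at_right s)"
      unfolding G_def put_payoff_def by (intro tendsto_intros)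
    from filterlim_compose[OF this filterlim_grid_at_right[OF real(1)]]
    have "(\<lambda>n. ennreal (G (\<tau> n (?k n)) \<omega>)) \<longlonglongrightarrow> ennreal (G s \<omega>)"
      by (intro tendsto_ennrealI) (simp add: \<tau>_def)
    then have "ennreal (G s \<omega>) = liminf (\<lambda>n. ennreal (G (\<tau> n (?k n)) \<omega>))"
      by (rule lim_imp_Liminf[OF sequentially_bot, symmetric])
    also have "\<dots> \<le> liminf (\<lambda>n. P n \<omega>)"
    proof (rule Liminf_mono, rule always_eventually, rule allI)
      fix n
      have k: "real (?k n) = of_int \<lfloor>real (Suc n) * s\<rfloor>" using real by (simp add: of_nat_nat)
      have "real (?k n) / real (Suc n) \<le> s" "s < \<tau> n (?k n)"
      proof -
        have "real (Suc n) * s < of_int \<lfloor>real (Suc n) * s\<rfloor> + 1"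
          "of_int \<lfloor>real (Suc n) * s\<rfloor> \<le> real (Suc n) * s" by linarith+
        then show "real (?k n) / real (Suc n) \<le> s" "s < \<tau> n (?k n)"
          unfolding \<tau>_def of_nat_add k by (simp_all add: field_simps del: of_nat_Suc)
      qed
      then have "\<omega> \<in> C n (?k n)" using \<omega> real by (auto simp: C_def ennreal_less_iff intro!: ennreal_leI simp del: of_nat_Suc)
      then have "ennreal (G (\<tau> n (?k n)) \<omega>) = (\<Sum>k\<in>{?k n}. indicator (C n k) \<omega> * ennreal (G (\<tau> n k) \<omega>))"
        by simp
      also have "\<dots> \<le> P n \<omega>" unfolding P_def by (rule sum_le_suminf) auto
      finally show "ennreal (G (\<tau> n (?k n)) \<omega>) \<le> P n \<omega>" .
    qed
    finally show ?thesis
      using real by (simp add: stopped_payoff_def G_def mult.left_commute)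
  qed (simp add: stopped_payoff_def)
  show ?thesis
  \<comment> \<open>If the stopped payoff is not integrable, its Bochner integral is the default 0
    and the bound is trivial; the case distinction stands in for a proof that the payoff is
    measurable.\<close>
  proof (cases "integrable M ?S")
    case True
    have "?S \<omega> \<ge> 0" for \<omega> by (simp add: stopped_payoff_def put_payoff_def)
    then have "ennreal (?m * (\<integral>\<omega>. ?S \<omega> \<partial>M)) = (\<integral>\<^sup>+\<omega>. ennreal (?m * ?S \<omega>) \<partial>M)"
      using True m0 by (subst nn_integral_eq_integral) auto
    also have "\<dots> \<le> (\<integral>\<^sup>+\<omega>. liminf (\<lambda>n. P n \<omega>) \<partial>M)"
      by (rule nn_integral_mono) (rule liminf)
    also have "\<dots> \<le> liminf (\<lambda>n. \<integral>\<^sup>+\<omega>. P n \<omega> \<partial>M)"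
      by (rule nn_integral_liminf) (simp add: P_def)
    also have "\<dots> \<le> inf_mean ?f x"
      by (rule Liminf_le[OF sequentially_bot always_eventually]) (use P_le in blast)
    finally show ?thesis .
  qed (simp add: not_integrable_integral_eq)
qed

section \<open>First passage along a grid, and the lower bound of the value\<close>

text \<open>On a grid the stopping time property reduces to countable unions of events at fixed
  times, with no appeal to hitting times in continuous time.\<close>

definition grid_passage :: "real \<Rightarrow> real \<Rightarrow> 'a \<Rightarrow> ennreal" where
  "grid_passage h a \<omega> =
     (if \<exists>k. X (real k * h) \<omega> < a then ennreal (real (LEAST k. X (real k * h) \<omega> < a) * h) else \<infinity>)"

definition grid_passage_event :: "real \<Rightarrow> real \<Rightarrow> nat \<Rightarrow> 'a set" where
  "grid_passage_event h a k =
     {\<omega>\<in>space M. X (real k * h) \<omega> < a \<and> (\<forall>j<k. \<not> X (real j * h) \<omega> < a)}"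

lemma grid_point_event:
  assumes "0 \<le> h" "real k * h \<le> t"
  shows "Measurable.pred (F (ennreal t)) (\<lambda>\<omega>. X (real k * h) \<omega> < a)"
proof -
  have "X (real k * h) \<in> borel_measurable (F (ennreal t))"
    by (rule measurable_F_mono[OF adapted]) (use assms in \<open>auto intro: ennreal_leI\<close>)
  then show ?thesis by measurable
qed

lemma grid_passage_event_sets:
  assumes "0 \<le> h"
  shows "grid_passage_event h a k \<in> sets (F (ennreal (real k * h)))"
proof -
  have "Measurable.pred (F (ennreal (real k * h)))
      (\<lambda>\<omega>. X (real k * h) \<omega> < a \<and> (\<forall>j\<in>{..<k}. \<not> X (real j * h) \<omega> < a))"
    using assms
    by (intro pred_intros_logic pred_intros_finite grid_point_event) (auto intro: mult_right_mono)
  then show ?thesis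
    by (simp add: grid_passage_event_def pred_def space_F lessThan_def)
qed

text \<open>The definition shows that passage at step \<open>k\<close> is decided by the path up to
  that step; this form, with \<open>LEAST\<close>, gives disjointness and the value of
  \<open>grid_passage\<close>.\<close>

lemma grid_passage_event_eq:
  "grid_passage_event h a k =
     {\<omega>\<in>space M. (\<exists>k. X (real k * h) \<omega> < a) \<and> (LEAST k. X (real k * h) \<omega> < a) = k}"
proof -
  have "P k \<and> (\<forall>j<k. \<not> P j) \<longleftrightarrow> (\<exists>k. P k) \<and> (LEAST k. P k) = k" for P :: "nat \<Rightarrow> bool"
    by (metis LeastI Least_equality linorder_not_less not_less_Least)
  from this[of "\<lambda>k. X (real k * h) _ < a"] show ?thesis
    unfolding grid_passage_event_def by (simp only:)
qed

lemma disjoint_grid_passage_event: "disjoint_family (grid_passage_event h a)"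
  unfolding grid_passage_event_eq disjoint_family_on_def by blast

lemma grid_passage_on_event:
  assumes "\<omega> \<in> grid_passage_event h a k"
  shows "grid_passage h a \<omega> = ennreal (real k * h)"
proof -
  have "\<exists>k. X (real k * h) \<omega> < a" "(LEAST k. X (real k * h) \<omega> < a) = k"
    using assms unfolding grid_passage_event_eq by blast+
  then show ?thesis unfolding grid_passage_def by presburger
qed

lemma grid_passage_infinite:
  assumes "\<omega> \<in> space M" "\<And>k. \<omega> \<notin> grid_passage_event h a k"
  shows "grid_passage h a \<omega> = \<infinity>"
proof -
  have "\<not> (\<exists>k. X (real k * h) \<omega> < a)"
    using assms unfolding grid_passage_event_eq by blast
  then show ?thesis unfolding grid_passage_def by (rule if_not_P)
qed

lemma stopping_time_grid_passage:
  assumes "0 \<le> h"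
  shows "stopping_time F (grid_passage h a)"
proof (rule stopping_timeI)
  fix t
  show "Measurable.pred (F t) (\<lambda>\<omega>. grid_passage h a \<omega> \<le> t)"
  proof (cases t)
    case (real u)
    have "grid_passage h a \<omega> \<le> t \<longleftrightarrow> (\<exists>k\<in>{k. real k * h \<le> u}. X (real k * h) \<omega> < a)" for \<omega>
    proof
      assume "grid_passage h a \<omega> \<le> t"
      then have "(\<exists>k. X (real k * h) \<omega> < a) \<and> real (LEAST k. X (real k * h) \<omega> < a) * h \<le> u"
        unfolding grid_passage_def real(2) using real(1)
        by (cases "\<exists>k. X (real k * h) \<omega> < a") (simp_all add: top_unique)
      then show "\<exists>k\<in>{k. real k * h \<le> u}. X (real k * h) \<omega> < a"
        using LeastI_ex[of "\<lambda>k. X (real k * h) \<omega> < a"] by blast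
    next
      assume "\<exists>k\<in>{k. real k * h \<le> u}. X (real k * h) \<omega> < a"
      then obtain k where k: "real k * h \<le> u" "X (real k * h) \<omega> < a" by auto
      have "(LEAST k. X (real k * h) \<omega> < a) \<le> k" using k(2) by (rule Least_le)
      then have "real (LEAST k. X (real k * h) \<omega> < a) * h \<le> real k * h"
        using assms by (intro mult_right_mono) simp_all
      then have "ennreal (real (LEAST k. X (real k * h) \<omega> < a) * h) \<le> t"
        unfolding real(2) using k(1) by (intro ennreal_leI) linarith
      moreover have "\<exists>k. X (real k * h) \<omega> < a" using k(2) by blast
      ultimately show "grid_passage h a \<omega> \<le> t"
        unfolding grid_passage_def by (simp only: if_True)
    qed
    moreover have "Measurable.pred (F (ennreal u)) (\<lambda>\<omega>. \<exists>k\<in>{k. real k * h \<le> u}. X (real k * h) \<omega> < a)"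
      by (intro pred_intros_countable_bounded(4) grid_point_event[OF assms]) simp_all
    ultimately show ?thesis unfolding real(2) by (simp only:)
  qed simp
qed

lemma suminf_indicator_at:
  fixes f :: "nat \<Rightarrow> ennreal"
  assumes "disjoint_family C" "\<omega> \<in> C k"
  shows "(\<Sum>j. indicator (C j) \<omega> * f j) = f k"
proof -
  have "indicator (C j) \<omega> * f j = (if j = k then f k else 0)" for j
    using assms by (auto simp: disjoint_family_on_def split: split_indicator)
  then have "(\<lambda>j. indicator (C j) \<omega> * f j) = (\<lambda>j. if j = k then f j else 0)" by auto
  then show ?thesis using sums_single[of k f] by (simp add: sums_iff)
qed

lemma stopped_payoff_grid_passage:
  assumes "0 \<le> h" "\<omega> \<in> space M"
  shows "ennreal (stopped_payoff K r (\<lambda>t \<omega>. x + X t \<omega>) (grid_passage h a) \<omega>)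
    = (\<Sum>k. indicator (grid_passage_event h a k) \<omega> *
        ennreal (exp (- r * (real k * h)) * put_payoff K (x + X (real k * h) \<omega>)))"
proof (cases "\<exists>k. \<omega> \<in> grid_passage_event h a k")
  case True
  then obtain k where k: "\<omega> \<in> grid_passage_event h a k" ..
  show ?thesis
    unfolding suminf_indicator_at[OF disjoint_grid_passage_event k]
    using grid_passage_on_event[OF k] assms by (simp add: stopped_payoff_def)
next
  case False
  then show ?thesis
    using grid_passage_infinite[OF assms(2)] by (simp add: stopped_payoff_def)
qed

text \<open>For a lower bound on the supremum a default value of the Bochner integral would be of no
  use. Along a grid the payoff is measurable, being a countable sum over the steps, and lies in
  \<open>[0, K]\<close>.\<close>

lemma payoff_nn_integral_grid_passage:
  assumes h: "0 \<le> h" and "0 < K"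
  shows "(\<integral>\<^sup>+\<omega>. ennreal (stopped_payoff K r (\<lambda>t \<omega>. x + X t \<omega>) (grid_passage h a) \<omega>) \<partial>M)
    = ennreal (\<integral>\<omega>. stopped_payoff K r (\<lambda>t \<omega>. x + X t \<omega>) (grid_passage h a) \<omega> \<partial>M)"
proof (rule nn_integral_eq_integral)
  let ?S = "stopped_payoff K r (\<lambda>t \<omega>. x + X t \<omega>) (grid_passage h a)"
  have S0: "0 \<le> ?S \<omega>" for \<omega> by (simp add: stopped_payoff_def put_payoff_def)
  have S: "?S \<omega> \<le> K" for \<omega>
  proof -
    have "exp (- r * enn2real (grid_passage h a \<omega>)) * put_payoff K y \<le> 1 * K" for y
      using rate_nonneg assms by (intro mult_mono) (auto simp: put_payoff_def)
    then show ?thesis using assms by (auto simp: stopped_payoff_def)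
  qed
  note [measurable] = sets_F[OF grid_passage_event_sets[OF h]]
  have [measurable]: "X (real k * h) \<in> borel_measurable M" for k using h by (intro X_measurable) simp
  have "(\<lambda>\<omega>. \<Sum>k. indicator (grid_passage_event h a k) \<omega> *
      ennreal (exp (- r * (real k * h)) * put_payoff K (x + X (real k * h) \<omega>))) \<in> borel_measurable M"
    unfolding put_payoff_def by measurable
  then have "(\<lambda>\<omega>. ennreal (?S \<omega>)) \<in> borel_measurable M"
    by (subst measurable_cong[OF stopped_payoff_grid_passage[OF h]])
  then have "(\<lambda>\<omega>. enn2real (ennreal (?S \<omega>))) \<in> borel_measurable M" by measurable
  then have "?S \<in> borel_measurable M" using S0 by simp
  then show "integrable M ?S"
    by (rule integrable_const_bound[of _ K, rotated]) (use S0 S in auto)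
qed (simp add: stopped_payoff_def put_payoff_def)

text \<open>To stop before \<open>e\<close> one needs a visit strictly before \<open>e\<close>, but
  the path might first go low at \<open>e\<close> itself. For a fixed path the infimum is monotone
  in the horizon, hence has countably many discontinuities, and an exponential time almost surely
  avoids them. For \<open>r = 0\<close> every real time precedes \<open>e\<close>.\<close>

lemma AE_no_jump_of_inf:
  assumes "\<omega> \<in> space M"
  shows "AE e in time_law. horizon e \<and>
    (\<forall>a. future_inf 0 e \<omega> < a \<longrightarrow> (\<exists>s\<ge>0. ennreal s < e \<and> X s \<omega> < a))"
proof (cases "r = 0")
  case True
  have hor: "horizon e" for e unfolding horizon_def using True by (rule disjI2)
  have "AE e in time_law. e = \<infinity>"
    unfolding exp_time_law_def using True by (simp add: AE_return)
  then show ?thesis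
    by eventually_elim
      (auto simp: future_inf_less_iff[OF assms order_refl hor] increment_from_zero[OF assms] hor ennreal_less_top)
next
  case False
  then have "0 < r" using rate_nonneg by simp
  have hor: "horizon (ennreal u)" for u by (simp add: horizon_def)
  define G where "G u = - future_inf 0 (ennreal u) \<omega>" for u
  have "mono G"
  proof (rule monoI)
    fix u v :: real assume "u \<le> v"
    then have "future_inf 0 (ennreal v) \<omega> \<le> future_inf 0 (ennreal u) \<omega>"
      by (intro future_inf_ge future_inf_le assms hor) (auto intro: order_trans ennreal_leI)
    then show "G u \<le> G v" by (simp add: G_def)
  qed
  then have "countable {u. \<not> isCont G u}" by (rule mono_ctble_discont)
  from AE_exp_time_law[OF \<open>0 < r\<close> this] show ?thesis
  proof eventually_elim
    case (elim e)
    then obtain u where u: "0 < u" "e = ennreal u" "isCont G u" by auto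
    have "\<exists>s\<ge>0. ennreal s < e \<and> X s \<omega> < a" if "future_inf 0 e \<omega> < a" for a
    proof -
      have "(G \<longlongrightarrow> G u) (at_left u)"
        using u(3) by (auto simp: isCont_def filterlim_at_split)
      then have "eventually (\<lambda>v. - a < G v) (at_left u)"
        by (rule order_tendstoD) (use that u in \<open>simp add: G_def\<close>)
      moreover have "eventually (\<lambda>v. v \<in> {0<..<u}) (at_left u)"
        using u(1) by (intro eventually_at_left_real)
      ultimately have "eventually (\<lambda>v. - a < G v \<and> v \<in> {0<..<u}) (at_left u)"
        by (rule eventually_conj)
      then obtain v where v: "- a < G v" "0 < v" "v < u"
        using eventually_happens[of _ "at_left u"] by auto
      then have "future_inf 0 (ennreal v) \<omega> < a" by (simp add: G_def)
      then obtain s where "0 \<le> s" "s \<le> v" "X s \<omega> < a"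
        using v by (auto simp: future_inf_less_iff[OF assms order_refl hor] increment_from_zero[OF assms])
      then show ?thesis using v u by (intro exI[of _ s]) (auto simp: ennreal_less_iff)
    qed
    then show ?case using u hor by auto
  qed
qed

text \<open>Stopping at the first grid time with \<open>x + X < ln c\<close> is asymptotically optimal: after that time
  the exponential functional is computed by the Markov property, and no mass is lost by Fatou.\<close>

lemma inf_mean_le_put_value:
  assumes K: "0 < K" and v: "\<And>T. stopping_time F T \<Longrightarrow>
      ennreal (mean_exp_inf * (\<integral>\<omega>. stopped_payoff K r (\<lambda>t \<omega>. x + X t \<omega>) T \<omega> \<partial>M)) \<le> V"
  shows "inf_mean (\<lambda>z. ennreal (K * mean_exp_inf - exp z)) x \<le> V"
proof -
  let ?m = mean_exp_inf
  define c where "c = K * ?m"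
  have c: "0 < c" using K mean_exp_inf_pos by (simp add: c_def)
  have m0: "0 \<le> ?m" using mean_exp_inf_pos by simp
  define f where "f z = ennreal (c - exp z)" for z
  have f[measurable]: "f \<in> borel_measurable borel" unfolding f_def by measurable
  \<comment> \<open>Here \<open>ln c\<close> is the optimal boundary, as \<open>c = K m\<close>.
    Below it Jensen's inequality is an equality, so the functional restarted at passage equals
    \<open>m\<close> times the payoff.\<close>
  define a where "a = ln c - x"
  have below: "X s \<omega> < a \<longleftrightarrow> exp (x + X s \<omega>) < c" for s \<omega>
  proof -
    have "exp (x + X s \<omega>) < exp (ln c) \<longleftrightarrow> X s \<omega> < a" unfolding exp_less_cancel_iff a_def by linarith
    then show ?thesis using c by simp
  qed
  define h where "h n = 1 / real (Suc n)" for n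
  have h: "0 \<le> h n" "0 < h n" for n by (auto simp: h_def)
  define \<tau> where "\<tau> n k = real k * h n" for n k
  have \<tau>: "0 \<le> \<tau> n k" for n k using h by (simp add: \<tau>_def)
  define C where "C n k = grid_passage_event (h n) a k" for n k
  have C: "C n k \<in> sets (F (ennreal (\<tau> n k)))" for n k
    unfolding C_def \<tau>_def using grid_passage_event_sets h(1) .
  note [measurable] = sets_F[OF C] future_inf_compose_measurable[OF \<tau>]
  have [measurable]: "X (\<tau> n k) \<in> borel_measurable M" for n k using X_measurable \<tau> .
  \<comment> \<open>The functional restarted at the \<open>k\<close>-th grid time, on the event of
    passage there; it is set to 0 once the exponential time has elapsed, which produces the
    discount.\<close>
  define B where "B n k \<omega> e = indicator (C n k) \<omega> *
      (if ennreal (\<tau> n k) < e then f (x + X (\<tau> n k) \<omega> + future_inf (\<tau> n k) (e - ennreal (\<tau> n k)) \<omega>) else 0)" for n k \<omega> e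
  have Bm[measurable]: "(\<lambda>z. B n k (fst z) (snd z)) \<in> borel_measurable (M \<Otimes>\<^sub>M borel)" for n k
    unfolding B_def by measurable
  have Bm'[measurable]: "B n k \<omega> \<in> borel_measurable borel" if "\<omega> \<in> space M" for n k \<omega>
    using measurable_compose[OF measurable_Pair1'[OF that] Bm[of n k]] by simp
  define Z where "Z n \<omega> e = (\<Sum>k. B n k \<omega> e)" for n \<omega> e
  have Z_le: "(\<integral>\<^sup>+\<omega>. \<integral>\<^sup>+e. Z n \<omega> e \<partial>time_law \<partial>M) \<le> V" for n
  proof -
    let ?S = "stopped_payoff K r (\<lambda>t \<omega>. x + X t \<omega>) (grid_passage (h n) a)"
    have "(\<integral>\<^sup>+\<omega>. \<integral>\<^sup>+e. Z n \<omega> e \<partial>time_law \<partial>M) = (\<integral>\<^sup>+\<omega>. (\<Sum>k. \<integral>\<^sup>+e. B n k \<omega> e \<partial>time_law) \<partial>M)"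
      unfolding Z_def by (intro nn_integral_cong nn_integral_suminf) (use Bm' in measurable)
    also have "\<dots> = (\<Sum>k. \<integral>\<^sup>+\<omega>. \<integral>\<^sup>+e. B n k \<omega> e \<partial>time_law \<partial>M)"
      by (intro nn_integral_suminf) measurable
    also have "\<dots> = (\<Sum>k. \<integral>\<^sup>+\<omega>. indicator (C n k) \<omega> * ennreal (?m * (exp (- r * \<tau> n k) * put_payoff K (x + X (\<tau> n k) \<omega>))) \<partial>M)"
    proof (intro suminf_cong)
      fix k
      note [measurable] = inf_mean_measurable[OF f]
      have "(\<integral>\<^sup>+\<omega>. \<integral>\<^sup>+e. B n k \<omega> e \<partial>time_law \<partial>M)
          = ennreal (exp (- r * \<tau> n k)) * (\<integral>\<^sup>+\<omega>. indicator (C n k) \<omega> * inf_mean f (x + X (\<tau> n k) \<omega>) \<partial>M)"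
        unfolding B_def by (rule markov_inf_mean[OF \<tau> C f])
      also have "\<dots> = (\<integral>\<^sup>+\<omega>. ennreal (exp (- r * \<tau> n k)) * (indicator (C n k) \<omega> * inf_mean f (x + X (\<tau> n k) \<omega>)) \<partial>M)"
        by (rule nn_integral_cmult[symmetric]) measurable
      also have "\<dots> = (\<integral>\<^sup>+\<omega>. indicator (C n k) \<omega> * ennreal (?m * (exp (- r * \<tau> n k) * put_payoff K (x + X (\<tau> n k) \<omega>))) \<partial>M)"
      proof (rule nn_integral_cong)
        fix \<omega>
        show "ennreal (exp (- r * \<tau> n k)) * (indicator (C n k) \<omega> * inf_mean f (x + X (\<tau> n k) \<omega>))
          = indicator (C n k) \<omega> * ennreal (?m * (exp (- r * \<tau> n k) * put_payoff K (x + X (\<tau> n k) \<omega>)))"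
        proof (cases "\<omega> \<in> C n k")
          case True
          then have "exp (x + X (\<tau> n k) \<omega>) \<le> c"
            using below by (auto simp: C_def grid_passage_event_def \<tau>_def intro: less_imp_le)
          then have "inf_mean f (x + X (\<tau> n k) \<omega>) = ennreal (c - exp (x + X (\<tau> n k) \<omega>) * ?m)"
            unfolding f_def using c by (intro antisym inf_mean_put_le inf_mean_put_ge) auto
          also have "\<dots> = ennreal (?m * put_payoff K (x + X (\<tau> n k) \<omega>))"
            unfolding c_def by (rule put_payoff_scaled[OF m0, symmetric])
          finally show ?thesis
            using True by (simp add: ennreal_mult'[symmetric] ac_simps)
        qed simp
      qed
      finally show "(\<integral>\<^sup>+\<omega>. \<integral>\<^sup>+e. B n k \<omega> e \<partial>time_law \<partial>M)
        = (\<integral>\<^sup>+\<omega>. indicator (C n k) \<omega> * ennreal (?m * (exp (- r * \<tau> n k) * put_payoff K (x + X (\<tau> n k) \<omega>))) \<partial>M)" .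
    qed
    also have "\<dots> = (\<integral>\<^sup>+\<omega>. (\<Sum>k. indicator (C n k) \<omega> * ennreal (?m * (exp (- r * \<tau> n k) * put_payoff K (x + X (\<tau> n k) \<omega>)))) \<partial>M)"
      unfolding put_payoff_def by (intro nn_integral_suminf[symmetric]) measurable
    also have "\<dots> = (\<integral>\<^sup>+\<omega>. ennreal ?m * ennreal (?S \<omega>) \<partial>M)"
    proof (rule nn_integral_cong)
      fix \<omega> assume \<omega>: "\<omega> \<in> space M"
      have "(\<Sum>k. indicator (C n k) \<omega> * ennreal (?m * (exp (- r * \<tau> n k) * put_payoff K (x + X (\<tau> n k) \<omega>))))
          = (\<Sum>k. ennreal ?m * (indicator (C n k) \<omega> * ennreal (exp (- r * \<tau> n k) * put_payoff K (x + X (\<tau> n k) \<omega>))))"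
        using m0 by (intro suminf_cong) (simp add: ennreal_mult' ac_simps)
      also have "\<dots> = ennreal ?m * (\<Sum>k. indicator (C n k) \<omega> * ennreal (exp (- r * \<tau> n k) * put_payoff K (x + X (\<tau> n k) \<omega>)))"
        by (rule ennreal_suminf_cmult)
      also have "\<dots> = ennreal ?m * ennreal (?S \<omega>)"
        unfolding stopped_payoff_grid_passage[OF h(1) \<omega>] C_def \<tau>_def ..
      finally show "(\<Sum>k. indicator (C n k) \<omega> * ennreal (?m * (exp (- r * \<tau> n k) * put_payoff K (x + X (\<tau> n k) \<omega>))))
        = ennreal ?m * ennreal (?S \<omega>)" .
    qed
    also have "\<dots> = (\<integral>\<^sup>+\<omega>. ennreal (?m * ?S \<omega>) \<partial>M)"
      using m0 by (simp add: ennreal_mult')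
    also have "\<dots> = (\<integral>\<^sup>+\<omega>. ennreal (?S \<omega>) * ennreal ?m \<partial>M)"
      using m0 by (simp add: ennreal_mult' mult.commute)
    also have "\<dots> = ennreal (\<integral>\<omega>. ?S \<omega> \<partial>M) * ennreal ?m"
    proof -
      have "(\<lambda>\<omega>. ennreal (?S \<omega>)) \<in> borel_measurable M"
        by (subst measurable_cong[OF stopped_payoff_grid_passage[OF h(1)]])
          (simp_all add: put_payoff_def flip: C_def \<tau>_def)
      then show ?thesis
        by (subst nn_integral_multc) (auto simp: payoff_nn_integral_grid_passage[OF h(1) K])
    qed
    also have "\<dots> = ennreal (?m * (\<integral>\<omega>. ?S \<omega> \<partial>M))"
      using m0 by (simp add: ennreal_mult' mult.commute)
    also have "\<dots> \<le> V" by (rule v[OF stopping_time_grid_passage[OF h(1)]])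
    finally show ?thesis .
  qed
  have liminf: "f (x + future_inf 0 e \<omega>) \<le> liminf (\<lambda>n. Z n \<omega> e)"
    if \<omega>: "\<omega> \<in> space M" and hor: "horizon e"
      and jump: "\<And>a. future_inf 0 e \<omega> < a \<Longrightarrow> \<exists>s\<ge>0. ennreal s < e \<and> X s \<omega> < a" for \<omega> e
    unfolding le_Liminf_iff
  proof (intro allI impI)
    fix y assume y: "y < f (x + future_inf 0 e \<omega>)"
    have "(f \<longlongrightarrow> f (x + future_inf 0 e \<omega>)) (at_right (x + future_inf 0 e \<omega>))"
      unfolding f_def by (intro tendsto_intros)
    from order_tendstoD(1)[OF this y]
    obtain b0 where b0: "x + future_inf 0 e \<omega> < b0" "\<And>b. x + future_inf 0 e \<omega> < b \<Longrightarrow> b < b0 \<Longrightarrow> y < f b"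
      unfolding eventually_at_right_field by blast
    obtain b where b: "x + future_inf 0 e \<omega> < b" "b < b0" using dense[OF b0(1)] by blast
    then have b: "x + future_inf 0 e \<omega> < b" "y < f b" using b0(2) by blast+
    \<comment> \<open>Positivity of \<open>f b\<close> puts \<open>b\<close> strictly below
      \<open>ln c\<close>, so a grid time at which the path is below \<open>b\<close> forces passage
      to have happened by then.\<close>
    have "0 < f b" using b(2) by (rule le_less_trans[OF zero_le])
    then have "exp b < c" by (simp add: f_def)
    then have "b - x < a" using c unfolding a_def by (metis diff_strict_right_mono exp_less_cancel_iff exp_ln)
    obtain s where s: "0 \<le> s" "ennreal s < e" "X s \<omega> < b - x"
      using jump[of "b - x"] b(1) by auto
    obtain d where d: "0 < d" "\<And>u. s \<le> u \<Longrightarrow> u < s + d \<Longrightarrow> X u \<omega> < b - x"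
      using right_continuous_less_near[OF cadlagD(1)[OF path_cadlag[OF \<omega>] s(1)] s(3)] by blast
    \<comment> \<open>Grid times are rounded up, so some room between \<open>s\<close> and
      \<open>e\<close> is required; the strict inequality of \<open>s\<close> and \<open>e\<close>
      provides it.\<close>
    obtain d' where d': "0 < d'" "ennreal (s + d') < e"
    proof (cases e)
      case (real u)
      then have "s < u" using s by (simp add: ennreal_less_iff)
      then show ?thesis using that[of "(u - s) / 2"] real s(1) by (simp add: ennreal_less_iff field_simps)
    next
      case top
      then show ?thesis using that[of 1] by (simp add: ennreal_less_top)
    qed
    define \<delta> where "\<delta> = min (d / 2) d'"
    have \<delta>: "0 < \<delta>" "\<delta> < d" "\<delta> \<le> d'" using d d' by (auto simp: \<delta>_def)
    obtain N where N: "\<And>n. N \<le> n \<Longrightarrow> h n < \<delta>"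
      using order_tendstoD(2)[OF LIMSEQ_Suc[OF lim_1_over_n] \<delta>(1)]
      unfolding h_def eventually_sequentially by blast
    show "\<forall>\<^sub>F n in sequentially. y < Z n \<omega> e"
      unfolding eventually_sequentially
    proof (intro exI[of _ N] allI impI)
      fix n assume "N \<le> n"
      then have "h n \<le> \<delta>" using N by (simp add: less_imp_le)
      then obtain k :: nat where k: "s < real k * h n" "real k * h n \<le> s + \<delta>"
        using exists_grid_point[OF h(2) _ s(1)] by blast
      have Xk: "X (real k * h n) \<omega> < b - x" using k \<delta> by (intro d(2)) auto
      then have ex: "\<exists>k. X (real k * h n) \<omega> < a" using \<open>b - x < a\<close> by (intro exI[of _ k]) simp
      define j where "j = (LEAST k. X (real k * h n) \<omega> < a)"
      have j: "\<omega> \<in> C n j"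
        unfolding C_def grid_passage_event_eq j_def using ex \<omega> by (intro CollectI conjI refl)
      have "j \<le> k" unfolding j_def by (rule Least_le) (use Xk \<open>b - x < a\<close> in linarith)
      then have jk: "\<tau> n j \<le> \<tau> n k" unfolding \<tau>_def using h by (intro mult_right_mono) auto
      have "\<tau> n k \<le> s + d'" using k \<delta> by (simp add: \<tau>_def)
      then have ke: "ennreal (\<tau> n k) < e" using d'(2) by (meson ennreal_leI le_less_trans)
      then have je: "ennreal (\<tau> n j) < e" using jk by (meson ennreal_leI le_less_trans)
      \<comment> \<open>Passage occurs at step \<open>j\<close>, no later than the step
        \<open>k\<close> at which the path is below \<open>b\<close>. Since step \<open>k\<close>
        still precedes \<open>e\<close>, the infimum restarted at \<open>j\<close> takes it into
        account.\<close>
      have "ennreal (\<tau> n k - \<tau> n j) \<le> e - ennreal (\<tau> n j)"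
        using ke \<tau> by (subst ennreal_minus[symmetric]) (simp_all add: ennreal_minus_mono)
      then have "future_inf (\<tau> n j) (e - ennreal (\<tau> n j)) \<omega> \<le> increment (\<tau> n j) (\<tau> n k - \<tau> n j) \<omega>"
        using jk by (intro future_inf_le \<omega> \<tau> horizon_diff hor) auto
      then have "x + X (\<tau> n j) \<omega> + future_inf (\<tau> n j) (e - ennreal (\<tau> n j)) \<omega> \<le> b"
        using Xk by (simp add: increment_def \<tau>_def)
      then have "f b \<le> f (x + X (\<tau> n j) \<omega> + future_inf (\<tau> n j) (e - ennreal (\<tau> n j)) \<omega>)"
        unfolding f_def by (intro ennreal_leI) simp
      also have "\<dots> = (\<Sum>k\<in>{j}. B n k \<omega> e)" using j je by (simp add: B_def)
      also have "\<dots> \<le> Z n \<omega> e" unfolding Z_def by (rule sum_le_suminf) auto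
      finally show "y < Z n \<omega> e" using b(2) by (rule less_le_trans[rotated])
    qed
  qed
  have "inf_mean f x \<le> (\<integral>\<^sup>+\<omega>. \<integral>\<^sup>+e. liminf (\<lambda>n. Z n \<omega> e) \<partial>time_law \<partial>M)"
    unfolding inf_mean_def
  proof (rule nn_integral_mono, rule nn_integral_mono_AE)
    fix \<omega> assume \<omega>: "\<omega> \<in> space M"
    show "AE e in time_law. f (x + future_inf 0 e \<omega>) \<le> liminf (\<lambda>n. Z n \<omega> e)"
      using AE_no_jump_of_inf[OF \<omega>] by eventually_elim (use liminf[OF \<omega>] in blast)
  qed
  also have "\<dots> \<le> (\<integral>\<^sup>+\<omega>. liminf (\<lambda>n. \<integral>\<^sup>+e. Z n \<omega> e \<partial>time_law) \<partial>M)"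
    unfolding Z_def by (intro nn_integral_mono nn_integral_liminf borel_measurable_suminf) (use Bm' in measurable)
  also have "\<dots> \<le> liminf (\<lambda>n. \<integral>\<^sup>+\<omega>. \<integral>\<^sup>+e. Z n \<omega> e \<partial>time_law \<partial>M)"
    unfolding Z_def by (intro nn_integral_liminf) measurable
  also have "\<dots> \<le> V"
    by (rule Liminf_le[OF sequentially_bot always_eventually]) (use Z_le in blast)
  finally show ?thesis unfolding f_def[abs_def] c_def .
qed

text \<open>The bound of \<open>stopped_payoff_le\<close> holds for every stopping time, which also
  makes the real supremum a genuine one; the reverse inequality comes from passage along finer and
  finer grids.\<close>

lemma put_value_eq: "ennreal (mean_exp_inf * put_value M F X K r x)
      = inf_mean (\<lambda>z. ennreal (K * mean_exp_inf - exp z)) x" (is ?eq)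
  and put_value_nonneg: "0 \<le> put_value M F X K r x" (is ?nonneg)
  if K: "0 < K"
proof -
  let ?m = mean_exp_inf
  let ?E = "\<lambda>T. \<integral>\<omega>. stopped_payoff K r (\<lambda>t \<omega>. x + X t \<omega>) T \<omega> \<partial>M"
  let ?V = "inf_mean (\<lambda>z. ennreal (K * ?m - exp z)) x"
  note m = mean_exp_inf_pos
  have "?V \<le> inf_mean (\<lambda>_. ennreal (K * ?m)) x"
    by (rule inf_mean_mono) (simp add: ennreal_leI)
  then have V: "?V = ennreal (enn2real ?V)"
    by (subst ennreal_enn2real) (auto simp: less_top[symmetric] top_unique)
  have le: "?E T \<le> enn2real ?V / ?m" if "stopping_time F T" for T
  proof -
    have "ennreal (?m * ?E T) \<le> ennreal (enn2real ?V)" using stopped_payoff_le[OF K that] V by simp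
    then have "?m * ?E T \<le> enn2real ?V" by (simp add: ennreal_le_iff)
    then show ?thesis using m by (simp add: field_simps)
  qed
  have upper: "?E T \<le> put_value M F X K r x" if "stopping_time F T" for T
    unfolding put_value_def
    by (intro cSUP_upper bdd_aboveI2[of _ _ "enn2real ?V / ?m"]) (use le that in auto)
  have ne: "stopping_time F (\<lambda>_. 0)" by (rule stopping_time_const)
  have "0 \<le> ?E (\<lambda>_. 0)"
    by (rule Bochner_Integration.integral_nonneg) (simp add: stopped_payoff_def put_payoff_def)
  with upper[OF ne] show ?nonneg by linarith
  have "put_value M F X K r x \<le> enn2real ?V / ?m"
    unfolding put_value_def by (rule cSUP_least) (use ne le in auto)
  then have "?m * put_value M F X K r x \<le> enn2real ?V" using m by (simp add: field_simps)
  then have "ennreal (?m * put_value M F X K r x) \<le> ?V" by (subst V) (rule ennreal_leI)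
  moreover have "?V \<le> ennreal (?m * put_value M F X K r x)"
    by (rule inf_mean_le_put_value[OF K]) (use upper m in \<open>intro ennreal_leI mult_left_mono; simp\<close>)
  ultimately show ?eq by (rule antisym)
qed

end

section \<open>Difference quotients of the put function\<close>

text \<open>The function \<open>(1 - e^u)^+\<close> has slope \<open>- e^u\<close> below 0 and is
  constant above, so it is 1-Lipschitz. The bound is the dominating constant when the limit is taken
  under the expectation.\<close>

lemma put_slope_bound:
  assumes "(i::real) \<le> 0" "0 < h"
  shows "\<bar>(max 0 (1 - exp (h + i)) - max 0 (1 - exp i)) / h\<bar> \<le> 1"
proof -
  have i: "max 0 (1 - exp i) = 1 - exp i" using assms by simp
  have "\<bar>max 0 (1 - exp (h + i)) - (1 - exp i)\<bar> \<le> h"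
  proof (cases "h + i \<le> 0")
    case True
    have "exp (h + i) * (1 - exp (- h)) \<le> 1 * (1 - exp (- h))"
      using True assms by (intro mult_right_mono) auto
    also have "\<dots> \<le> h" using exp_ge_add_one_self[of "- h"] by simp
    finally have "exp (h + i) - exp i \<le> h" by (simp add: algebra_simps flip: exp_add)
    then show ?thesis using True assms by (simp add: abs_le_iff)
  next
    case False
    then have "1 - exp i \<le> h" using exp_ge_add_one_self[of i] by linarith
    then show ?thesis using False assms by (simp add: abs_le_iff max_def)
  qed
  then show ?thesis unfolding i using assms by (simp add: abs_divide)
qed

text \<open>The function \<open>(1 - e^u)^+\<close> has a kink at 0: its slope there is 0 from the
  right and -1 from the left. This is how the atom of I at 0 enters the derivative of the
  value.\<close>

lemma put_slope_tendsto:
  assumes "(i::real) \<le> 0" and h: "filterlim h (at_right 0) F"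
  shows "((\<lambda>n. (max 0 (1 - exp (h n + i)) - max 0 (1 - exp i)) / h n) \<longlongrightarrow> (if i = 0 then 0 else - exp i)) F"
proof -
  have pos: "eventually (\<lambda>n. 0 < h n) F" and lim: "(h \<longlongrightarrow> 0) F"
    using h by (auto simp: filterlim_at elim: eventually_mono)
  show ?thesis
  proof (cases "i = 0")
    case True
    have "eventually (\<lambda>n. 0 = (max 0 (1 - exp (h n + i)) - max 0 (1 - exp i)) / h n) F"
      using pos by eventually_elim (simp add: True)
    then have "((\<lambda>n. (max 0 (1 - exp (h n + i)) - max 0 (1 - exp i)) / h n) \<longlongrightarrow> 0) F"
      by (rule Lim_transform_eventually[OF tendsto_const])
    then show ?thesis using True by simp
  next
    case False
    then have "i < 0" using assms by simp
    have "((\<lambda>u::real. (exp u - exp 0) / (u - 0)) \<longlongrightarrow> exp 0) (at 0)"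
      using DERIV_exp[of 0] unfolding has_field_derivative_iff .
    then have "((\<lambda>u::real. (exp u - 1) / u) \<longlongrightarrow> 1) (at_right 0)"
      by (simp add: tendsto_mono[OF at_le[OF subset_UNIV]])
    then have "((\<lambda>n. (exp (h n) - 1) / h n) \<longlongrightarrow> 1) F" using h by (rule filterlim_compose)
    then have "((\<lambda>n. - exp i * ((exp (h n) - 1) / h n)) \<longlongrightarrow> - exp i * 1) F"
      by (intro tendsto_intros)
    moreover have "eventually (\<lambda>n. h n < - i) F"
      using order_tendstoD(2)[OF lim] \<open>i < 0\<close> by simp
    then have "eventually (\<lambda>n. - exp i * ((exp (h n) - 1) / h n)
        = (max 0 (1 - exp (h n + i)) - max 0 (1 - exp i)) / h n) F"
      using pos
    proof eventually_elim
      case (elim n)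
      then have "max 0 (1 - exp (h n + i)) = 1 - exp (h n + i)" "max 0 (1 - exp i) = 1 - exp i"
        using \<open>i < 0\<close> by simp_all
      have "- exp i * (exp (h n) - 1) = (1 - exp (h n + i)) - (1 - exp i)"
        by (simp add: exp_add algebra_simps)
      then show ?case using elim \<open>max 0 (1 - exp (h n + i)) = _\<close> \<open>max 0 (1 - exp i) = _\<close>
        by (simp only: times_divide_eq_right)
    qed
    ultimately have "((\<lambda>n. (max 0 (1 - exp (h n + i)) - max 0 (1 - exp i)) / h n) \<longlongrightarrow> - exp i * 1) F"
      by (rule Lim_transform_eventually)
    then show ?thesis using False by simp
  qed
qed

section \<open>Right derivative at the boundary and smooth pasting\<close>

context regular_path_levy
begin

definition joint :: "('a \<times> ennreal) measure" where "joint = M \<Otimes>\<^sub>M time_law"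

definition terminal_inf :: "'a \<times> ennreal \<Rightarrow> real" where
  "terminal_inf z = future_inf 0 (snd z) (fst z)"

sublocale joint: prob_space joint
  unfolding joint_def by (rule prob_space_pair[OF prob_space_axioms time.prob_space_axioms])

lemma terminal_inf_measurable [measurable]: "terminal_inf \<in> borel_measurable joint"
  unfolding terminal_inf_def[abs_def] joint_def
  by (rule future_inf_compose_measurable) simp_all

lemma inf_mean_joint:
  assumes "f \<in> borel_measurable borel"
  shows "inf_mean f y = (\<integral>\<^sup>+z. f (y + terminal_inf z) \<partial>joint)"
  unfolding joint_def terminal_inf_def using assms by (rule inf_mean_product)

text \<open>Only almost surely: for \<open>r > 0\<close> the horizon \<open>\<infinity>\<close> is a
  null event, but the infimum over it may be a default value.\<close>

lemma AE_terminal_inf_nonpos: "AE z in joint. terminal_inf z \<le> 0"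
proof -
  have "inf_mean (indicator {0<..}) 0 \<le> inf_mean (\<lambda>_. 0) 0"
    by (rule inf_mean_mono) simp
  then have "(\<integral>\<^sup>+z. indicator {0<..} (terminal_inf z) \<partial>joint) = 0"
    by (simp add: inf_mean_joint)
  then have "AE z in joint. (indicator {0<..} (terminal_inf z) :: ennreal) = 0"
    by (subst (asm) nn_integral_0_iff_AE) simp_all
  then show ?thesis by eventually_elim (simp add: indicator_eq_0_iff not_less)
qed

lemma inf_mean_integral:
  assumes [measurable]: "f \<in> borel_measurable borel" and "\<And>z. 0 \<le> f z"
  shows "(\<integral>z. f (y + terminal_inf z) \<partial>joint) = enn2real (inf_mean (\<lambda>z. ennreal (f z)) y)"
  using assms(2) by (subst integral_eq_nn_integral) (simp_all add: inf_mean_joint)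

lemma inf_at_exp_time_eq: "z \<in> space joint \<Longrightarrow> inf_at_exp_time X z = terminal_inf z"
  by (cases z) (simp add: inf_at_exp_time_def terminal_inf_def joint_def space_pair_measure future_inf_zero)

lemma with_exp_time_eq: "with_exp_time M r = completion joint"
  by (simp add: with_exp_time_def joint_def)

lemma exp_put_boundary:
  assumes "0 < K"
  shows "exp (put_boundary M X K r) = K * mean_exp_inf"
proof -
  have "(\<integral>z. exp (inf_at_exp_time X z) \<partial>with_exp_time M r) = (\<integral>z. exp (terminal_inf z) \<partial>completion joint)"
    unfolding with_exp_time_eq by (rule Bochner_Integration.integral_cong) (simp_all add: inf_at_exp_time_eq)
  also have "\<dots> = (\<integral>z. exp (terminal_inf z) \<partial>joint)"
    by (rule integral_completion) measurable
  also have "\<dots> = mean_exp_inf"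
    using inf_mean_integral[of exp 0] by (simp add: mean_exp_inf_def)
  finally show ?thesis
    using assms mean_exp_inf_pos by (simp add: put_boundary_def)
qed

lemma prob_inf_at_exp_time_zero:
  "\<P>(z in with_exp_time M r. inf_at_exp_time X z = 0) = \<P>(z in joint. terminal_inf z = 0)"
proof -
  have "{z \<in> space (completion joint). inf_at_exp_time X z = 0} = {z \<in> space joint. terminal_inf z = 0}"
    by (auto simp: inf_at_exp_time_eq)
  moreover have "{z \<in> space joint. terminal_inf z = 0} \<in> sets joint" by measurable
  ultimately show ?thesis unfolding with_exp_time_eq by simp
qed

lemma put_value_integral:
  assumes "0 < K"
  shows "put_value M F X K r x = (\<integral>z. max 0 (K * mean_exp_inf - exp (x + terminal_inf z)) \<partial>joint) / mean_exp_inf"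
proof -
  have "(\<integral>z. max 0 (K * mean_exp_inf - exp (x + terminal_inf z)) \<partial>joint)
      = enn2real (inf_mean (\<lambda>z. ennreal (max 0 (K * mean_exp_inf - exp z))) x)"
    by (rule inf_mean_integral) auto
  also have "(\<lambda>z. ennreal (max 0 (K * mean_exp_inf - exp z))) = (\<lambda>z. ennreal (K * mean_exp_inf - exp z))"
    by (auto simp: max_def ennreal_neg)
  also have "enn2real (inf_mean (\<lambda>z. ennreal (K * mean_exp_inf - exp z)) x) = mean_exp_inf * put_value M F X K r x"
    using put_value_nonneg[OF assms, of x] mean_exp_inf_pos
    by (simp add: put_value_eq[OF assms, symmetric])
  finally show ?thesis using mean_exp_inf_pos by simp
qed

lemma put_value_below_boundary:
  assumes "0 < K" "exp x \<le> K * mean_exp_inf"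
  shows "put_value M F X K r x = K - exp x"
proof -
  have "exp x \<le> K" using assms mult_left_mono[OF mean_exp_inf_le_1, of K] by linarith
  then have m: "0 < mean_exp_inf" "exp x * mean_exp_inf \<le> K * mean_exp_inf"
    using mean_exp_inf_pos by auto
  have "ennreal (mean_exp_inf * put_value M F X K r x) = ennreal (K * mean_exp_inf - exp x * mean_exp_inf)"
    unfolding put_value_eq[OF assms(1)]
    using assms m by (intro antisym inf_mean_put_le inf_mean_put_ge) auto
  then have "mean_exp_inf * put_value M F X K r x = mean_exp_inf * (K - exp x)"
    using m put_value_nonneg[OF assms(1), of x] by (subst (asm) ennreal_inj) (auto simp: algebra_simps)
  then show ?thesis using m by simp
qed

lemma put_value_right_slope:
  assumes K: "0 < K"
  defines "b \<equiv> put_boundary M X K r"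
  shows "(put_value M F X K r has_real_derivative
      - exp b + K * \<P>(z in joint. terminal_inf z = 0)) (at_right b)"
  unfolding has_field_derivative_iff
proof (rule tendsto_at_right_sequentially[of b "b + 1"])
  let ?m = mean_exp_inf and ?v = "put_value M F X K r"
  have b: "exp b = K * ?m" unfolding b_def by (rule exp_put_boundary[OF K])
  fix S :: "nat \<Rightarrow> real" assume S: "\<And>n. b < S n" "S \<longlonglongrightarrow> b"
  define h where "h n = S n - b" for n
  have h: "filterlim h (at_right 0) sequentially"
    unfolding filterlim_at h_def using S(1) tendsto_diff[OF S(2) tendsto_const, of b]
    by (auto simp: less_imp_neq[symmetric] intro!: always_eventually)
  have h0: "0 < h n" for n using S(1) by (simp add: h_def)
  let ?\<phi> = "\<lambda>n z. (max 0 (1 - exp (h n + terminal_inf z)) - max 0 (1 - exp (terminal_inf z))) / h n"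
  let ?\<psi> = "\<lambda>z. if terminal_inf z = 0 then 0 else - exp (terminal_inf z)"
  have lim: "(\<lambda>n. \<integral>z. ?\<phi> n z \<partial>joint) \<longlonglongrightarrow> (\<integral>z. ?\<psi> z \<partial>joint)"
  proof (rule integral_dominated_convergence[where w="\<lambda>_. 1"])
    show "AE z in joint. (\<lambda>n. ?\<phi> n z) \<longlonglongrightarrow> ?\<psi> z"
      using AE_terminal_inf_nonpos by eventually_elim (rule put_slope_tendsto[OF _ h])
    show "AE z in joint. norm (?\<phi> n z) \<le> 1" for n
      using AE_terminal_inf_nonpos
    proof eventually_elim
      case (elim z)
      then show ?case unfolding real_norm_def by (rule put_slope_bound[OF _ h0])
    qed
  qed measurable
  have int: "integrable joint (\<lambda>z. max 0 (1 - exp (y + terminal_inf z)))" for y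
    by (rule joint.integrable_const_bound[of _ 1]) auto
  have slope: "(?v (S n) - ?v b) / (S n - b) = K * (\<integral>z. ?\<phi> n z \<partial>joint)" for n
  proof -
    \<comment> \<open>As \<open>e^b = K m\<close>, the constant \<open>m\<close> cancels and the
      value at \<open>b + y\<close> is K E (1 - e^(y + I))^+.\<close>
    have scale: "max 0 (K * ?m - exp (b + y)) = K * ?m * max 0 (1 - exp y)" for y
    proof -
      have "max 0 (K * ?m - exp (b + y)) = max (K * ?m * 0) (K * ?m * (1 - exp y))"
        by (simp add: exp_add b algebra_simps)
      also have "\<dots> = K * ?m * max 0 (1 - exp y)"
        using K mean_exp_inf_pos by (simp add: max_def mult_le_0_iff zero_le_mult_iff)
      finally show ?thesis .
    qed
    have v: "?v (b + y) = K * (\<integral>z. max 0 (1 - exp (y + terminal_inf z)) \<partial>joint)" for y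
      unfolding put_value_integral[OF K] add.assoc scale using mean_exp_inf_pos by simp
    have "?v (S n) - ?v b = K * ((\<integral>z. max 0 (1 - exp (h n + terminal_inf z)) \<partial>joint)
        - (\<integral>z. max 0 (1 - exp (0 + terminal_inf z)) \<partial>joint))"
      using v[of "h n"] v[of 0] by (simp add: h_def algebra_simps)
    also have "\<dots> = K * (\<integral>z. max 0 (1 - exp (h n + terminal_inf z)) - max 0 (1 - exp (0 + terminal_inf z)) \<partial>joint)"
      by (subst Bochner_Integration.integral_diff[OF int int]) simp
    finally show ?thesis by (simp add: h_def)
  qed
  \<comment> \<open>On the event I = 0 the two terms 1 and e^I cancel, so the indicator merely
    switches off the slope there.\<close>
  have "(\<integral>z. ?\<psi> z \<partial>joint) = (\<integral>z. indicator {z \<in> space joint. terminal_inf z = 0} z - exp (terminal_inf z) \<partial>joint)"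
    by (rule Bochner_Integration.integral_cong) (auto split: split_indicator)
  also have "\<dots> = \<P>(z in joint. terminal_inf z = 0) - ?m"
  proof (subst Bochner_Integration.integral_diff)
    have "AE z in joint. exp (terminal_inf z) \<le> 1"
      using AE_terminal_inf_nonpos by eventually_elim simp
    then show "integrable joint (\<lambda>z. exp (terminal_inf z))"
      by (intro joint.integrable_const_bound[of _ 1]) auto
    have "(\<integral>z. exp (terminal_inf z) \<partial>joint) = ?m"
      using inf_mean_integral[of exp 0] by (simp add: mean_exp_inf_def)
    then show "(\<integral>z. indicator {z \<in> space joint. terminal_inf z = 0} z \<partial>joint) - (\<integral>z. exp (terminal_inf z) \<partial>joint)
        = \<P>(z in joint. terminal_inf z = 0) - ?m" by simp
  qed (simp add: joint.emeasure_eq_measure)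
  finally have "K * (\<integral>z. ?\<psi> z \<partial>joint) = - exp b + K * \<P>(z in joint. terminal_inf z = 0)"
    unfolding b by (simp only: right_diff_distrib)
  with tendsto_mult[OF tendsto_const lim, of K]
  show "(\<lambda>n. (?v (S n) - ?v b) / (S n - b)) \<longlonglongrightarrow> - exp b + K * \<P>(z in joint. terminal_inf z = 0)"
    unfolding slope by simp
qed simp

lemma smooth_pasting_iff:
  assumes K: "0 < K"
  shows "smooth_pasting (put_value M F X K r) (put_payoff K) (put_boundary M X K r)
    \<longleftrightarrow> \<P>(z in joint. terminal_inf z = 0) = 0"
proof -
  let ?v = "put_value M F X K r" and ?b = "put_boundary M X K r" and ?p = "\<P>(z in joint. terminal_inf z = 0)"
  have b: "exp ?b = K * mean_exp_inf" by (rule exp_put_boundary[OF K])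
  have bK: "exp ?b \<le> K" unfolding b using K mean_exp_inf_le_1 by simp
  have v: "?v x = K - exp x" if "x \<le> ?b" for x
  proof -
    have "exp x \<le> exp ?b" using that by simp
    then show ?thesis using put_value_below_boundary[OF K] b by simp
  qed
  have left: "(?v has_real_derivative - exp ?b) (at_left ?b)"
  proof -
    have "((\<lambda>x. K - exp x) has_real_derivative - exp ?b) (at_left ?b)"
      by (auto intro!: derivative_eq_intros)
    then have "((\<lambda>y. ((K - exp y) - (K - exp ?b)) / (y - ?b)) \<longlongrightarrow> - exp ?b) (at_left ?b)"
      unfolding has_field_derivative_iff .
    moreover have "eventually (\<lambda>y. ((K - exp y) - (K - exp ?b)) / (y - ?b) = (?v y - ?v ?b) / (y - ?b)) (at_left ?b)"
      unfolding eventually_at_filter by (rule always_eventually) (use v in simp)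
    ultimately show ?thesis
      unfolding has_field_derivative_iff by (rule Lim_transform_eventually)
  qed
  note right = put_value_right_slope[OF K]
  have pasting: "?v ?b = put_payoff K ?b" using v[of ?b] bK by (simp add: put_payoff_def)
  show ?thesis
  proof
    assume "smooth_pasting ?v (put_payoff K) ?b"
    then obtain D where D: "(?v has_real_derivative D) (at_left ?b)" "(?v has_real_derivative D) (at_right ?b)"
      by (auto simp: smooth_pasting_def)
    have "D = - exp ?b"
      using D(1) left unfolding has_field_derivative_iff by (rule tendsto_unique[OF trivial_limit_at_left_real])
    moreover have "D = - exp ?b + K * ?p"
      using D(2) right unfolding has_field_derivative_iff by (rule tendsto_unique[OF trivial_limit_at_right_real])
    ultimately show "?p = 0" using K by simp
  next
    assume "?p = 0"
    then have "(?v has_real_derivative - exp ?b) (at_right ?b)" using right by simp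
    then show "smooth_pasting ?v (put_payoff K) ?b"
      unfolding smooth_pasting_def using left pasting by blast
  qed
qed

end

section \<open>Regularity of the lower half-line\<close>

context regular_path_levy
begin

text \<open>Both sides say that negative values occur at arbitrarily small times. The passage time
  is an infimum over uncountably many times; countably many running infima show that its vanishing
  is an event.\<close>

lemma first_passage_below_zero_iff:
  assumes "\<omega> \<in> space M"
  shows "first_passage_below X 0 \<omega> = 0 \<longleftrightarrow> (\<forall>n. future_inf 0 (ennreal (1 / real (Suc n))) \<omega> < 0)"
proof -
  have less: "first_passage_below X 0 \<omega> < e \<longleftrightarrow> (\<exists>t\<ge>0. X t \<omega> < 0 \<and> ennreal t < e)" for e
    unfolding first_passage_below_def by (auto simp: INF_less_iff)
  have inf: "future_inf 0 (ennreal d) \<omega> < 0 \<longleftrightarrow> (\<exists>t\<ge>0. ennreal t \<le> ennreal d \<and> X t \<omega> < 0)" for d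
    by (subst future_inf_less_iff) (auto simp: assms horizon_def increment_from_zero)
  show ?thesis
  proof
    assume zero: "first_passage_below X 0 \<omega> = 0"
    show "\<forall>n. future_inf 0 (ennreal (1 / real (Suc n))) \<omega> < 0"
    proof
      fix n
      have "first_passage_below X 0 \<omega> < ennreal (1 / real (Suc n))" unfolding zero by simp
      then show "future_inf 0 (ennreal (1 / real (Suc n))) \<omega> < 0"
        unfolding less inf by (blast intro: less_imp_le)
    qed
  next
    assume all: "\<forall>n. future_inf 0 (ennreal (1 / real (Suc n))) \<omega> < 0"
    show "first_passage_below X 0 \<omega> = 0"
    proof (rule ccontr)
      assume "first_passage_below X 0 \<omega> \<noteq> 0"
      then obtain e where e: "0 < e" "e < first_passage_below X 0 \<omega>"
        using dense[of 0 "first_passage_below X 0 \<omega>"] by (auto simp: zero_less_iff_neq_zero)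
      obtain d where d: "e = ennreal d" "0 < d"
        using e by (cases e) auto
      obtain n where n: "1 / real (Suc n) < d" using d nat_approx_posE by metis
      obtain t where t: "0 \<le> t" "ennreal t \<le> ennreal (1 / real (Suc n))" "X t \<omega> < 0"
        using all inf by blast
      have "ennreal (1 / real (Suc n)) < e" unfolding d using n by (intro ennreal_lessI) (use d in auto)
      then have "first_passage_below X 0 \<omega> < e" unfolding less using t by (blast intro: le_less_trans)
      with e show False by simp
    qed
  qed
qed

lemma regular_below_iff:
  "regular_below M X \<longleftrightarrow> (\<forall>d>0. AE \<omega> in M. future_inf 0 (ennreal d) \<omega> < 0)"
proof -
  note [measurable] = future_inf_measurable[OF order_refl]
  have "{\<omega> \<in> space M. first_passage_below X 0 \<omega> = 0}
      = {\<omega> \<in> space M. \<forall>n. future_inf 0 (ennreal (1 / real (Suc n))) \<omega> < 0}"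
    using first_passage_below_zero_iff by blast
  moreover have "{\<omega> \<in> space M. \<forall>n. future_inf 0 (ennreal (1 / real (Suc n))) \<omega> < 0} \<in> events"
    by measurable
  ultimately have "regular_below M X \<longleftrightarrow> (\<forall>n. AE \<omega> in M. future_inf 0 (ennreal (1 / real (Suc n))) \<omega> < 0)"
    unfolding regular_below_def by (simp add: prob_Collect_eq_1 AE_all_countable del: of_nat_Suc)
  also have "\<dots> \<longleftrightarrow> (\<forall>d>0. AE \<omega> in M. future_inf 0 (ennreal d) \<omega> < 0)"
  proof (intro iffI allI impI)
    fix d :: real assume all: "\<forall>n. AE \<omega> in M. future_inf 0 (ennreal (1 / real (Suc n))) \<omega> < 0" and "0 < d"
    then obtain n where n: "1 / real (Suc n) < d" using nat_approx_posE by metis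
    have le: "ennreal (1 / real (Suc n)) \<le> ennreal d" using n by (intro ennreal_leI) simp
    have mono: "future_inf 0 (ennreal d) \<omega> \<le> future_inf 0 (ennreal (1 / real (Suc n))) \<omega>" if "\<omega> \<in> space M" for \<omega>
      by (rule future_inf_ge, rule future_inf_le[OF that order_refl])
        (use order_trans[OF _ le] in \<open>simp_all add: horizon_def\<close>)
    from all[rule_format, of n] AE_space show "AE \<omega> in M. future_inf 0 (ennreal d) \<omega> < 0"
      by eventually_elim (use mono in \<open>blast intro: le_less_trans\<close>)
  qed simp
  finally show ?thesis .
qed

lemma prob_terminal_inf_zero_iff:
  "\<P>(z in joint. terminal_inf z = 0) = 0 \<longleftrightarrow> (AE \<omega> in M. AE e in time_law. future_inf 0 e \<omega> \<noteq> 0)"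
proof -
  note [measurable] = future_inf_compose_measurable[OF order_refl]
  have "\<P>(z in joint. terminal_inf z = 0) = 0 \<longleftrightarrow> (AE z in joint. terminal_inf z \<noteq> 0)"
    by (rule joint.prob_Collect_eq_0) measurable
  also have "\<dots> \<longleftrightarrow> (AE \<omega> in M. AE e in time_law. future_inf 0 e \<omega> \<noteq> 0)"
    unfolding joint_def terminal_inf_def by (rule product.AE_pair_iff[symmetric]) measurable
  finally show ?thesis .
qed

lemma terminal_inf_zero_of_regular:
  assumes "regular_below M X"
  shows "\<P>(z in joint. terminal_inf z = 0) = 0"
  unfolding prob_terminal_inf_zero_iff
proof -
  have pos: "AE e in time_law. horizon e \<and> 0 < e"
  proof (cases "r = 0")
    case True
    have "AE e in time_law. e = \<infinity>"
      unfolding exp_time_law_def using True by (simp add: AE_return)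
    with AE_horizon show ?thesis by eventually_elim simp
  next
    case False
    then have "AE e in time_law. \<exists>t>0. e = ennreal t \<and> t \<notin> {}"
      using rate_nonneg by (intro AE_exp_time_law) auto
    with AE_horizon show ?thesis by eventually_elim auto
  qed
  have "AE \<omega> in M. \<forall>n. future_inf 0 (ennreal (1 / real (Suc n))) \<omega> < 0"
    using assms unfolding regular_below_iff by (subst AE_all_countable) simp
  then show "AE \<omega> in M. AE e in time_law. future_inf 0 e \<omega> \<noteq> 0"
    using AE_space
  proof eventually_elim
    case (elim \<omega>)
    show ?case using pos
    proof eventually_elim
      case (elim e)
      then obtain d where d: "0 < d" "ennreal d \<le> e"
        by (cases e) (auto intro: that[of 1])
      obtain n where "1 / real (Suc n) < d" using d nat_approx_posE by metis
      then have le: "ennreal (1 / real (Suc n)) \<le> e"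
        using d by (meson ennreal_leI less_imp_le order_trans)
      have "future_inf 0 e \<omega> \<le> future_inf 0 (ennreal (1 / real (Suc n))) \<omega>"
        by (rule future_inf_ge, rule future_inf_le[OF \<open>\<omega> \<in> space M\<close> order_refl])
          (use elim order_trans[OF _ le] in simp_all)
      also have "\<dots> < 0" using \<open>\<forall>n. _ n\<close> by blast
      finally show ?case by simp
    qed
  qed
qed

text \<open>The exponential time is at most \<open>d\<close> with positive probability, and a path
  that stays nonnegative on \<open>[0, d]\<close> has infimum 0 at every such time.\<close>

lemma regular_of_terminal_inf_zero_discounted:
  assumes "0 < r" "\<P>(z in joint. terminal_inf z = 0) = 0"
  shows "regular_below M X"
  unfolding regular_below_iff
proof (intro allI impI)
  fix d :: real assume d: "0 < d"
  \<comment> \<open>If the time almost surely exceeded \<open>d\<close>, the lack of memory applied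
    to the constant 1 would give \<open>e^(-rd) = 1\<close>.\<close>
  have not_null: "\<not> (AE e in time_law. ennreal d < e)"
  proof
    assume "AE e in time_law. ennreal d < e"
    from this have "(\<integral>\<^sup>+e. (if ennreal d < e then 1 else 0) \<partial>time_law) = (\<integral>\<^sup>+e. 1 \<partial>time_law)"
      by (intro nn_integral_cong_AE, eventually_elim) simp
    also have "\<dots> = 1" using time.emeasure_space_1 by simp
    also have "(\<integral>\<^sup>+e. (if ennreal d < e then 1 else 0) \<partial>time_law) = ennreal (exp (- r * d)) * (\<integral>\<^sup>+e. 1 \<partial>time_law)"
      using exp_time_law_memoryless[OF rate_nonneg, of d "\<lambda>_. 1"] d by simp
    finally have "ennreal (exp (- r * d)) = 1" using time.emeasure_space_1 by simp
    then show False using assms(1) d by (simp add: ennreal_eq_1)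
  qed
  have "AE \<omega> in M. AE e in time_law. future_inf 0 e \<omega> \<noteq> 0"
    using assms(2) unfolding prob_terminal_inf_zero_iff .
  then show "AE \<omega> in M. future_inf 0 (ennreal d) \<omega> < 0"
    using AE_space
  proof eventually_elim
    case (elim \<omega>)
    note \<omega> = \<open>\<omega> \<in> space M\<close>
    show ?case
    proof (rule ccontr)
      assume "\<not> future_inf 0 (ennreal d) \<omega> < 0"
      then have pos: "0 \<le> X s \<omega>" if "0 \<le> s" "ennreal s \<le> ennreal d" for s
        using future_inf_le[OF \<omega> order_refl _ that] increment_from_zero[OF \<omega>, of s]
        by (simp add: horizon_def)
      \<comment> \<open>On this path the infimum vanishes at every horizon up to \<open>d\<close>,
        while it is nonzero at almost every horizon.\<close>
      have "AE e in time_law. ennreal d < e"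
        using elim(1) AE_horizon
      proof eventually_elim
        case (elim e)
        show ?case
        proof (rule ccontr)
          assume "\<not> ennreal d < e"
          then have "0 \<le> future_inf 0 e \<omega>"
            by (intro future_inf_ge) (use pos increment_from_zero[OF \<omega>] in \<open>simp add: order_trans not_less\<close>)
          then show False using elim future_inf_nonpos[OF \<omega> order_refl elim(2)] by simp
        qed
      qed
      with not_null show False ..
    qed
  qed
qed

text \<open>The undiscounted case, without the strong Markov property. Let \<open>e R\<close> be the probability of a visit to
  \<open>(-\<infinity>, 0)\<close> after time \<open>R\<close>. Restarting at the first grid time \<open>\<tau>\<close> with \<open>X < 0\<close> gives
  \<open>e R \<ge> P (\<tau> < d) e R + P (d \<le> \<tau> < \<infinity>) e (R - d)\<close>; on refining the grid \<open>P (\<tau> < \<infinity>)\<close> tends to \<open>1\<close> while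
  \<open>P (\<tau> \<ge> d)\<close> stays away from \<open>0\<close> in the irregular case, whence \<open>e R = e 0 = 1\<close>, against the drift to \<open>\<infinity>\<close>.\<close>

lemma late_visit_iff:
  assumes r: "r = 0" and "\<omega> \<in> space M" "0 \<le> t" "0 \<le> R"
  shows "increment t R \<omega> + future_inf (t + R) \<infinity> \<omega> < 0 \<longleftrightarrow> (\<exists>s\<ge>R. increment t s \<omega> < 0)"
proof -
  have hor: "horizon \<infinity>" unfolding horizon_def using r by (rule disjI2)
  have "increment t R \<omega> + future_inf (t + R) \<infinity> \<omega> < 0 \<longleftrightarrow> future_inf (t + R) \<infinity> \<omega> < - increment t R \<omega>"
    by linarith
  also have "\<dots> \<longleftrightarrow> (\<exists>s\<ge>0. increment (t + R) s \<omega> < - increment t R \<omega>)"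
    using assms by (subst future_inf_less_iff[OF _ _ hor]) auto
  also have "\<dots> \<longleftrightarrow> (\<exists>s\<ge>0. increment t (R + s) \<omega> < 0)"
    by (simp add: increment_def add.assoc)
  also have "\<dots> \<longleftrightarrow> (\<exists>s\<ge>R. increment t s \<omega> < 0)"
    by (metis add_increasing2 add.commute diff_add_cancel diff_ge_0_iff_ge le_add_same_cancel1)
  finally show ?thesis .
qed

definition late_visit :: "real \<Rightarrow> real \<Rightarrow> 'a set" where
  "late_visit t R = {\<omega>\<in>space M. \<exists>s\<ge>R. increment t s \<omega> < 0}"

text \<open>A late visit means that an increment plus the future infimum after it is negative.
  \<open>indep_copy_increment_step\<close> applies to this sum and yields independence of the past
  and stationarity together.\<close>

lemma prob_late_visit:
  assumes r: "r = 0" and t: "0 \<le> t" and R: "0 \<le> R"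
  shows late_visit_sets: "late_visit t R \<in> events"
    and "C \<in> sets (F (ennreal t)) \<Longrightarrow> prob (C \<inter> late_visit t R) = prob C * prob (late_visit 0 R)"
proof -
  have hor: "horizon \<infinity>" unfolding horizon_def using r by (rule disjI2)
  have "indep_copy t (\<lambda>\<omega>. increment t R \<omega> + future_inf (t + R) \<infinity> \<omega>) (\<lambda>\<omega>. increment 0 R \<omega> + future_inf R \<infinity> \<omega>)"
    using indep_copy_increment_step[OF t R indep_copy_future_inf[OF _ hor] indep_copy_future_inf[OF _ hor],
        of "\<lambda>z. fst z + snd z"] t R by simp
  note copy = this[unfolded indep_copy_def]
  have *: "late_visit t R = (\<lambda>\<omega>. increment t R \<omega> + future_inf (t + R) \<infinity> \<omega>) -` {..<0} \<inter> space M"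
    using late_visit_iff[OF r _ t R] by (auto simp: late_visit_def)
  have **: "late_visit 0 R = (\<lambda>\<omega>. increment 0 R \<omega> + future_inf R \<infinity> \<omega>) -` {..<0} \<inter> space M"
    using late_visit_iff[OF r _ order_refl R] by (auto simp: late_visit_def)
  have half: "{..<0::real} \<in> sets borel" by simp
  show "late_visit t R \<in> events"
    unfolding * by (rule measurable_sets[OF _ half]) (use copy in blast)
  show "prob (C \<inter> late_visit t R) = prob C * prob (late_visit 0 R)" if "C \<in> sets (F (ennreal t))"
    unfolding * ** using copy that half by blast
qed

lemma late_visit_antimono: "R \<le> R' \<Longrightarrow> late_visit t R' \<subseteq> late_visit t R"
  unfolding late_visit_def by (blast intro: order_trans)

text \<open>The renewal inequality solved for the drop of the late visit probability from
  \<open>R - d\<close> to \<open>R\<close>: a path nonnegative on \<open>[0, d]\<close> has no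
  passage before \<open>d\<close>, and the right-hand side bounds the loss from paths without any
  passage on the grid.\<close>

lemma late_visit_recurrence:
  assumes r: "r = 0" and h: "0 < h" and d: "0 < d" "d \<le> R"
  shows "prob {\<omega>\<in>space M. 0 \<le> future_inf 0 (ennreal d) \<omega>} * (prob (late_visit 0 (R - d)) - prob (late_visit 0 R))
    \<le> 1 - prob {\<omega>\<in>space M. \<exists>k. X (real k * h) \<omega> < 0}"
proof -
  let ?e = "\<lambda>R. prob (late_visit 0 R)"
  define C where "C k = grid_passage_event h 0 k" for k
  define D where "D k = (if real k * h < d then C k else {})" for k
  \<comment> \<open>A visit after \<open>R\<close> results from waiting a further \<open>R\<close>
    after an early passage, but only \<open>R - d\<close> after a passage at or beyond
    \<open>d\<close>.\<close>
  define R' where "R' k = (if real k * h < d then R else R - d)" for k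
  have h0: "0 \<le> h" using h by simp
  have t: "0 \<le> real k * h" for k using h by simp
  have R0: "0 \<le> R' k" for k using d by (simp add: R'_def)
  have C: "C k \<in> sets (F (ennreal (real k * h)))" for k
    unfolding C_def by (rule grid_passage_event_sets[OF h0])
  note [measurable] = sets_F[OF C] late_visit_sets[OF r t R0] future_inf_measurable[OF order_refl]
  have Dm[measurable]: "D k \<in> events" for k by (simp add: D_def)
  have disj: "disjoint_family C" unfolding C_def by (rule disjoint_grid_passage_event)
  then have disjD: "disjoint_family D" by (auto simp: disjoint_family_on_def D_def)
  have disjE: "disjoint_family (\<lambda>k. C k \<inter> late_visit (real k * h) (R' k))"
    using disj by (auto simp: disjoint_family_on_def)
  have "(\<lambda>k. prob (C k \<inter> late_visit (real k * h) (R' k))) sums prob (\<Union>k. C k \<inter> late_visit (real k * h) (R' k))"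
    by (rule finite_measure_UNION[OF _ disjE]) auto
  moreover have "prob (C k \<inter> late_visit (real k * h) (R' k)) = ?e (R - d) * prob (C k) - (?e (R - d) - ?e R) * prob (D k)" for k
    unfolding prob_late_visit(2)[OF r t R0 C] by (simp add: R'_def D_def algebra_simps)
  moreover have "(\<lambda>k. ?e (R - d) * prob (C k) - (?e (R - d) - ?e R) * prob (D k))
      sums (?e (R - d) * prob (\<Union>k. C k) - (?e (R - d) - ?e R) * prob (\<Union>k. D k))"
    by (intro sums_diff sums_mult finite_measure_UNION disj disjD) auto
  ultimately have "prob (\<Union>k. C k \<inter> late_visit (real k * h) (R' k))
      = ?e (R - d) * prob (\<Union>k. C k) - (?e (R - d) - ?e R) * prob (\<Union>k. D k)"
    by (simp add: sums_iff)
  moreover have "prob (\<Union>k. C k \<inter> late_visit (real k * h) (R' k)) \<le> ?e R"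
  proof (rule finite_measure_mono)
    show "(\<Union>k. C k \<inter> late_visit (real k * h) (R' k)) \<subseteq> late_visit 0 R"
    proof
      fix \<omega> assume "\<omega> \<in> (\<Union>k. C k \<inter> late_visit (real k * h) (R' k))"
      then obtain k s where \<omega>: "\<omega> \<in> space M" and k: "X (real k * h) \<omega> < 0"
        and s: "R' k \<le> s" "increment (real k * h) s \<omega> < 0"
        by (auto simp: C_def grid_passage_event_def late_visit_def)
      have "R \<le> real k * h + s" using s(1) t[of k] by (auto simp: R'_def split: if_splits)
      moreover have "increment 0 (real k * h + s) \<omega> < 0"
        using k s(2) by (simp add: increment_from_zero[OF \<omega>]) (simp add: increment_def)
      ultimately show "\<omega> \<in> late_visit 0 R" using \<omega> by (auto simp: late_visit_def)
    qed
    show "late_visit 0 R \<in> events" using late_visit_sets[OF r order_refl] d by simp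
  qed
  ultimately have main: "?e (R - d) * prob (\<Union>k. C k) - (?e (R - d) - ?e R) * prob (\<Union>k. D k) \<le> ?e R" by simp
  have UC: "(\<Union>k. C k) = {\<omega>\<in>space M. \<exists>k. X (real k * h) \<omega> < 0}"
    unfolding C_def grid_passage_event_eq by blast
  have D: "prob (\<Union>k. D k) \<le> 1 - prob {\<omega>\<in>space M. 0 \<le> future_inf 0 (ennreal d) \<omega>}"
  proof -
    have "(\<Union>k. D k) \<subseteq> space M - {\<omega>\<in>space M. 0 \<le> future_inf 0 (ennreal d) \<omega>}"
    proof
      fix \<omega> assume "\<omega> \<in> (\<Union>k. D k)"
      then obtain k where \<omega>: "\<omega> \<in> space M" and k: "X (real k * h) \<omega> < 0" "real k * h < d"
        by (auto simp: D_def C_def grid_passage_event_def split: if_splits)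
      have "future_inf 0 (ennreal d) \<omega> \<le> increment 0 (real k * h) \<omega>"
        using k t by (intro future_inf_le[OF \<omega>]) (auto simp: horizon_def intro: ennreal_leI)
      then show "\<omega> \<in> space M - {\<omega>\<in>space M. 0 \<le> future_inf 0 (ennreal d) \<omega>}"
        using k \<omega> by (auto simp: increment_from_zero)
    qed
    then have "prob (\<Union>k. D k) \<le> prob (space M - {\<omega>\<in>space M. 0 \<le> future_inf 0 (ennreal d) \<omega>})"
      by (rule finite_measure_mono) measurable
    also have "\<dots> = 1 - prob {\<omega>\<in>space M. 0 \<le> future_inf 0 (ennreal d) \<omega>}"
      by (rule prob_compl) measurable
    finally show ?thesis .
  qed
  have e: "?e R \<le> ?e (R - d)"
    using d by (intro finite_measure_mono late_visit_antimono late_visit_sets[OF r]) auto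
  have "(?e (R - d) - ?e R) * prob (\<Union>k. D k)
      \<le> (?e (R - d) - ?e R) * (1 - prob {\<omega>\<in>space M. 0 \<le> future_inf 0 (ennreal d) \<omega>})"
    using D e by (intro mult_left_mono) auto
  moreover have "?e (R - d) * (1 - prob (\<Union>k. C k)) \<le> 1 * (1 - prob (\<Union>k. C k))"
    by (intro mult_right_mono) auto
  ultimately show ?thesis using main unfolding UC by (simp add: algebra_simps)
qed

text \<open>Dyadic grids are nested, so the events increase, and right continuity brings every visit
  below 0 onto a fine enough grid.\<close>

lemma prob_grid_visit_tendsto:
  assumes r: "r = 0" and inf: "AE \<omega> in M. future_inf 0 \<infinity> \<omega> < 0"
  shows "(\<lambda>n. prob {\<omega>\<in>space M. \<exists>k. X (real k * (1 / 2 ^ n)) \<omega> < 0}) \<longlonglongrightarrow> 1"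
proof -
  let ?A = "\<lambda>n. {\<omega>\<in>space M. \<exists>k. X (real k * (1 / 2 ^ n)) \<omega> < 0}"
  have hor: "horizon \<infinity>" unfolding horizon_def using r by (rule disjI2)
  have [measurable]: "X (real k * (1 / 2 ^ n)) \<in> borel_measurable M" for k n
    by (rule X_measurable) simp
  have "?A n \<in> events" for n by measurable
  moreover have "incseq ?A"
  proof (rule incseq_SucI, rule subsetI)
    fix n \<omega> assume "\<omega> \<in> ?A n"
    then obtain k where "\<omega> \<in> space M" "X (real k * (1 / 2 ^ n)) \<omega> < 0" by blast
    moreover have "real k * (1 / 2 ^ n) = real (2 * k) * (1 / 2 ^ Suc n)" by simp
    ultimately show "\<omega> \<in> ?A (Suc n)" by (metis (mono_tags, lifting) mem_Collect_eq)
  qed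
  ultimately have "(\<lambda>n. prob (?A n)) \<longlonglongrightarrow> prob (\<Union>n. ?A n)"
    by (intro finite_Lim_measure_incseq) auto
  moreover have "prob (\<Union>n. ?A n) = 1"
  proof -
    have "(\<Union>n. ?A n) \<in> events" by measurable
    moreover have "AE \<omega> in M. \<omega> \<in> (\<Union>n. ?A n)"
      using inf AE_space
    proof eventually_elim
      case (elim \<omega>)
      note \<omega> = \<open>\<omega> \<in> space M\<close>
      obtain s where s: "0 \<le> s" "X s \<omega> < 0"
        using elim(1) unfolding future_inf_less_iff[OF \<omega> order_refl hor] increment_from_zero[OF \<omega>] by blast
      obtain d where d: "0 < d" "\<And>u. s \<le> u \<Longrightarrow> u < s + d \<Longrightarrow> X u \<omega> < 0"
        using right_continuous_less_near[OF cadlagD(1)[OF path_cadlag[OF \<omega>] s(1)] s(2)] by blast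
      obtain n where "(1/2::real) ^ n < d / 2"
        using real_arch_pow_inv[of "d / 2" "1/2"] d(1) by auto
      then have "1 / 2 ^ n \<le> d / 2" by (simp add: power_one_over)
      then obtain k :: nat where "s < real k * (1 / 2 ^ n)" "real k * (1 / 2 ^ n) \<le> s + d / 2"
        using exists_grid_point[of "1 / 2 ^ n" "d / 2" s] s(1) by auto
      then have "X (real k * (1 / 2 ^ n)) \<omega> < 0" using d(1) by (intro d(2)) linarith+
      then show "\<omega> \<in> (\<Union>n. ?A n)" using \<omega> by blast
    qed
    ultimately show ?thesis by (rule prob_eq_1[THEN iffD2])
  qed
  ultimately show ?thesis by simp
qed

lemma regular_of_terminal_inf_zero_undiscounted:
  assumes r: "r = 0" and zero: "\<P>(z in joint. terminal_inf z = 0) = 0"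
  shows "regular_below M X"
  unfolding regular_below_iff
proof (rule ccontr)
  have hor: "horizon \<infinity>" unfolding horizon_def using r by (rule disjI2)
  note [measurable] = future_inf_measurable[OF order_refl]
  have law: "time_law = return borel \<infinity>"
    unfolding exp_time_law_def using r by (rule if_P)
  have "AE \<omega> in M. AE e in time_law. future_inf 0 e \<omega> \<noteq> 0"
    using zero unfolding prob_terminal_inf_zero_iff .
  then have inf: "AE \<omega> in M. future_inf 0 \<infinity> \<omega> < 0"
    using AE_space
  proof eventually_elim
    case (elim \<omega>)
    have "Measurable.pred borel (\<lambda>e. future_inf 0 e \<omega> \<noteq> 0)"
    proof -
      have "(\<lambda>e. future_inf 0 e \<omega>) \<in> borel_measurable borel"
        using future_inf_compose_measurable[OF order_refl, of "\<lambda>_. \<omega>" borel "\<lambda>e. e"] elim by simp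
      then show ?thesis by measurable
    qed
    then have "future_inf 0 \<infinity> \<omega> \<noteq> 0"
      using elim(1) unfolding law by (subst (asm) AE_return) simp_all
    then show ?case using future_inf_nonpos[OF elim(2) order_refl hor] by simp
  qed
  assume "\<not> (\<forall>d>0. AE \<omega> in M. future_inf 0 (ennreal d) \<omega> < 0)"
  then obtain d where d: "0 < d" and not: "\<not> (AE \<omega> in M. future_inf 0 (ennreal d) \<omega> < 0)" by blast
  define p where "p = prob {\<omega>\<in>space M. 0 \<le> future_inf 0 (ennreal d) \<omega>}"
  have "p \<noteq> 0"
  proof
    assume "p = 0"
    then have "AE \<omega> in M. \<not> 0 \<le> future_inf 0 (ennreal d) \<omega>"
      unfolding p_def by (subst (asm) prob_Collect_eq_0) measurable
    with not show False by (simp add: not_le)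
  qed
  then have p: "0 < p" by (simp add: p_def less_le)
  \<comment> \<open>The recurrence holds on every grid. Its right-hand side vanishes under
    refinement while \<open>p\<close> does not depend on the grid, so the late visit probability
    cannot drop over a distance \<open>d\<close>.\<close>
  have step: "prob (late_visit 0 (R - d)) \<le> prob (late_visit 0 R)" if "d \<le> R" for R
  proof -
    have "(\<lambda>n. 1 - prob {\<omega>\<in>space M. \<exists>k. X (real k * (1 / 2 ^ n)) \<omega> < 0}) \<longlonglongrightarrow> 1 - 1"
      by (intro tendsto_diff tendsto_const prob_grid_visit_tendsto r inf)
    then have "p * (prob (late_visit 0 (R - d)) - prob (late_visit 0 R)) \<le> 1 - 1"
      unfolding p_def
      by (rule LIMSEQ_le_const) (intro exI[of _ 0] allI impI late_visit_recurrence r d(1) that; simp)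
    then show ?thesis using p by (simp add: mult_le_0_iff)
  qed
  have "prob (late_visit 0 (real n * d)) = 1" for n
  proof (induction n)
    case 0
    have "AE \<omega> in M. \<omega> \<in> late_visit 0 0"
      using inf AE_space
    proof eventually_elim
      case (elim \<omega>)
      then show ?case
        using late_visit_iff[OF r elim(2) order_refl order_refl] by (simp add: late_visit_def)
    qed
    then show ?case using late_visit_sets[OF r order_refl order_refl] by (simp add: prob_eq_1)
  next
    case (Suc n)
    have "real (Suc n) * d - d = real n * d" by (simp add: algebra_simps)
    moreover have "d \<le> real (Suc n) * d" using d by simp
    ultimately have "1 \<le> prob (late_visit 0 (real (Suc n) * d))"
      using step[of "real (Suc n) * d"] Suc.IH by simp
    then show ?case using prob_le_1 by (intro antisym)
  qed
  moreover have "(\<lambda>n. prob (late_visit 0 (real n * d))) \<longlonglongrightarrow> prob (\<Inter>n. late_visit 0 (real n * d))"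
  proof (rule finite_Lim_measure_decseq)
    show "decseq (\<lambda>n. late_visit 0 (real n * d))"
      using d by (intro decseq_SucI late_visit_antimono mult_right_mono) auto
    show "range (\<lambda>n. late_visit 0 (real n * d)) \<subseteq> events"
      using late_visit_sets[OF r order_refl] d by auto
  qed
  \<comment> \<open>A path that drifts to infinity is eventually nonnegative, so it has no
    arbitrarily late negative visits.\<close>
  moreover have "(\<Inter>n. late_visit 0 (real n * d)) = {}"
  proof (rule ccontr)
    assume "(\<Inter>n. late_visit 0 (real n * d)) \<noteq> {}"
    then obtain \<omega> where "\<And>n. \<omega> \<in> late_visit 0 (real n * d)" by blast
    then have \<omega>: "\<omega> \<in> space M" and "\<And>n. \<exists>s\<ge>real n * d. increment 0 s \<omega> < 0"
      unfolding late_visit_def by blast+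
    then have late: "\<And>n. \<exists>s\<ge>real n * d. X s \<omega> < 0"
      using increment_from_zero[OF \<omega>] by simp
    obtain N where N: "\<And>s. N \<le> s \<Longrightarrow> 0 \<le> X s \<omega>"
      using path_drifts[OF r \<omega>] unfolding filterlim_at_top eventually_at_top_linorder by blast
    obtain n :: nat where "N / d \<le> real n" using real_arch_simple by blast
    then have "N \<le> real n * d" using d by (simp add: field_simps)
    then show False using late[of n] N by (meson not_less order_trans)
  qed
  ultimately show False
    by (simp add: LIMSEQ_const_iff)
qed

lemma terminal_inf_zero_iff_regular:
  "\<P>(z in joint. terminal_inf z = 0) = 0 \<longleftrightarrow> regular_below M X"
  using regular_of_terminal_inf_zero_undiscounted regular_of_terminal_inf_zero_discounted
    terminal_inf_zero_of_regular rate_nonneg by (metis order_le_less)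

end

section \<open>Reduction to regular paths\<close>

lemma (in complete_measure) measurable_cong_AE_complete:
  assumes ae: "AE x in M. f x = g x" and f: "f \<in> M \<rightarrow>\<^sub>M N" and "\<And>x. x \<in> space M \<Longrightarrow> g x \<in> space N"
  shows "g \<in> M \<rightarrow>\<^sub>M N"
proof (rule measurableI)
  fix A assume A: "A \<in> sets N"
  show "g -` A \<inter> space M \<in> sets M"
  proof (rule in_sets_AE)
    show "f -` A \<inter> space M \<in> sets M" using f A by (rule measurable_sets)
    show "AE x in M. x \<in> f -` A \<inter> space M \<longleftrightarrow> x \<in> g -` A \<inter> space M"
      using ae by eventually_elim simp
  qed simp
qed (use assms in blast)

text \<open>On a complete space two functions equal almost everywhere are measurable together, and
  otherwise both integrals are the default 0. The value function needs this generality, as its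
  supremum runs over all stopping times.\<close>

lemma (in complete_measure) integral_cong_AE_complete:
  fixes f g :: "'a \<Rightarrow> real"
  assumes ae: "AE x in M. f x = g x"
  shows "integral\<^sup>L M f = integral\<^sup>L M g"
proof (cases "f \<in> borel_measurable M")
  case True
  then have "g \<in> borel_measurable M" using measurable_cong_AE_complete[OF ae] by simp
  with True ae show ?thesis by (intro integral_cong_AE)
next
  case False
  have "AE x in M. g x = f x" using ae by eventually_elim simp
  then have "g \<notin> borel_measurable M" using False measurable_cong_AE_complete[of g f borel] by auto
  with False show ?thesis
    by (metis borel_measurable_integrable not_integrable_integral_eq)
qed

lemma (in complete_measure) measure_cong_AE_complete:
  assumes "AE x in M. P x \<longleftrightarrow> Q x"
  shows "measure M {x\<in>space M. P x} = measure M {x\<in>space M. Q x}"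
proof -
  have "AE x in M. (indicator {x\<in>space M. P x} x :: real) = indicator {x\<in>space M. Q x} x"
    using assms AE_space by eventually_elim (simp add: indicator_def)
  from integral_cong_AE_complete[OF this] show ?thesis
    by (simp add: Int_absorb2 subset_eq)
qed

text \<open>By the usual conditions every subset of the exceptional null set already lies in
  \<open>F 0\<close>, so the changed process stays adapted to the same filtration; the laws do not
  notice the change.\<close>

lemma (in levy_process) levy_process_modification:
  assumes eq: "AE \<omega> in M. \<forall>t. Y t \<omega> = X t \<omega>"
  shows "levy_process M F Y"
proof -
  interpret complete_measure M by (rule complete)
  have F_sets: "A \<in> sets M" if "A \<in> sets (F t)" for A t
    using subalg[of t] that by (auto simp: subalgebra_def)
  define N where "N = {\<omega>\<in>space M. \<not> (\<forall>t. Y t \<omega> = X t \<omega>)}"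
  have N: "N \<in> null_sets M" using eq unfolding N_def AE_iff_null_sets .
  have null_F: "B \<in> sets (F t)" if "B \<subseteq> N" for B t
  proof -
    have "B \<in> null_sets M" using that N by (rule complete2)
    then have "B \<in> sets (F 0)" using null_sets_F0 by blast
    then show ?thesis using sets_F_mono[of 0 t] by auto
  qed
  have adapted': "Y t \<in> borel_measurable (F (ennreal t))" if t: "0 \<le> t" for t
  proof (rule measurableI)
    fix B :: "real set" assume B: "B \<in> sets borel"
    have "Y t -` B \<inter> space M = ((X t -` B \<inter> space M) - N) \<union> (Y t -` B \<inter> N)"
      using N_def by auto
    moreover have "X t -` B \<inter> space M \<in> sets (F (ennreal t))"
      using measurable_sets[OF adapted[OF t] B] by (simp add: space_F)
    moreover have "N \<in> sets (F (ennreal t))" "Y t -` B \<inter> N \<in> sets (F (ennreal t))"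
      by (rule null_F; simp)+
    ultimately show "Y t -` B \<inter> space (F (ennreal t)) \<in> sets (F (ennreal t))"
      by (simp add: space_F sets.Diff sets.Un)
  qed simp
  have X: "X t \<in> borel_measurable M" and Y: "Y t \<in> borel_measurable M" if "0 \<le> t" for t
    using adapted[OF that] adapted'[OF that] measurable_from_subalg[OF subalg] by blast+
  show ?thesis
  proof (unfold_locales, goal_cases)
    case (1 t)
    then show ?case by (rule adapted')
  next
    case 2
    show ?case using eq start_zero by eventually_elim simp
  next
    case 3
    show ?case using eq cadlag_paths by eventually_elim simp
  next
    case (4 s t)
    have [measurable]: "X s \<in> borel_measurable M" "X t \<in> borel_measurable M"
      "Y s \<in> borel_measurable M" "Y t \<in> borel_measurable M"
      using X Y 4 by auto
    have "prob (C \<inter> ((\<lambda>\<omega>. Y t \<omega> - Y s \<omega>) -` B \<inter> space M)) = prob C * prob ((\<lambda>\<omega>. Y t \<omega> - Y s \<omega>) -` B \<inter> space M)"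
      if C: "C \<in> sets (F (ennreal s))" and [measurable]: "B \<in> sets borel" for C B
    proof -
      have [measurable]: "C \<in> events" using F_sets C .
      have "prob (C' \<inter> ((\<lambda>\<omega>. Y t \<omega> - Y s \<omega>) -` B \<inter> space M)) = prob (C' \<inter> ((\<lambda>\<omega>. X t \<omega> - X s \<omega>) -` B \<inter> space M))"
        if [measurable]: "C' \<in> events" for C'
        by (rule measure_eq_AE) (use eq in \<open>eventually_elim, simp\<close>, measurable)
      note this[of C] this[of "space M"]
      moreover have "(\<lambda>\<omega>. X t \<omega> - X s \<omega>) -` B \<inter> space M
          \<in> {(\<lambda>\<omega>. X t \<omega> - X s \<omega>) -` B \<inter> space M | B. B \<in> sets borel}"
        using \<open>B \<in> sets borel\<close> by blast
      from indep_setD[OF indep_increments[OF 4] C this]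
      have "prob (C \<inter> ((\<lambda>\<omega>. X t \<omega> - X s \<omega>) -` B \<inter> space M)) = prob C * prob ((\<lambda>\<omega>. X t \<omega> - X s \<omega>) -` B \<inter> space M)" .
      ultimately show ?thesis by (simp add: Int_absorb1)
    qed
    then show ?case
      unfolding indep_sets2_eq using F_sets by auto
  next
    case (5 s t)
    have [measurable]: "X s \<in> borel_measurable M" "X t \<in> borel_measurable M" "X (t - s) \<in> borel_measurable M"
      "Y s \<in> borel_measurable M" "Y t \<in> borel_measurable M" "Y (t - s) \<in> borel_measurable M"
      using X Y 5 by auto
    have "distr M borel (\<lambda>\<omega>. Y t \<omega> - Y s \<omega>) = distr M borel (\<lambda>\<omega>. X t \<omega> - X s \<omega>)"
      by (rule distr_cong_AE[OF refl refl], use eq in \<open>eventually_elim, simp\<close>) simp_all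
    also have "\<dots> = distr M borel (X (t - s))" by (rule stationary_increments[OF 5])
    also have "\<dots> = distr M borel (Y (t - s))"
      by (rule distr_cong_AE[OF refl refl], use eq in \<open>eventually_elim, simp\<close>) simp_all
    finally show ?case .
  qed
qed

context usual_filtered_prob_space
begin

lemma put_value_cong:
  assumes "AE \<omega> in M. \<forall>t. Y t \<omega> = X t \<omega>"
  shows "put_value M F Y K r x = put_value M F X K r x"
proof -
  interpret complete_measure M by (rule complete)
  have "(\<integral>\<omega>. stopped_payoff K r (\<lambda>t \<omega>. x + Y t \<omega>) T \<omega> \<partial>M) = (\<integral>\<omega>. stopped_payoff K r (\<lambda>t \<omega>. x + X t \<omega>) T \<omega> \<partial>M)" for T
    by (rule integral_cong_AE_complete) (use assms in \<open>eventually_elim, simp add: stopped_payoff_def\<close>)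
  then show ?thesis unfolding put_value_def by simp
qed

lemma regular_below_cong:
  assumes "AE \<omega> in M. \<forall>t. Y t \<omega> = X t \<omega>"
  shows "regular_below M Y \<longleftrightarrow> regular_below M X"
proof -
  interpret complete_measure M by (rule complete)
  have "\<P>(\<omega> in M. first_passage_below Y 0 \<omega> = 0) = \<P>(\<omega> in M. first_passage_below X 0 \<omega> = 0)"
    by (rule measure_cong_AE_complete) (use assms in \<open>eventually_elim, simp add: first_passage_below_def\<close>)
  then show ?thesis unfolding regular_below_def by simp
qed

lemma AE_inf_at_exp_time_cong:
  assumes "AE \<omega> in M. \<forall>t. Y t \<omega> = X t \<omega>" and r: "0 \<le> r"
  shows "AE z in with_exp_time M r. inf_at_exp_time Y z = inf_at_exp_time X z"
proof -
  interpret complete_measure M by (rule complete)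
  interpret time: prob_space "exp_time_law r" by (rule prob_space_exp_time_law[OF r])
  interpret pair_sigma_finite M "exp_time_law r" ..
  let ?N = "{\<omega>\<in>space M. \<not> (\<forall>t. Y t \<omega> = X t \<omega>)}"
  have N: "?N \<in> null_sets M" using assms(1) unfolding AE_iff_null_sets .
  then have [measurable]: "?N \<in> sets M" by blast
  have "AE z in M \<Otimes>\<^sub>M exp_time_law r. fst z \<notin> ?N"
  proof (rule AE_pair_measure)
    show "{z \<in> space (M \<Otimes>\<^sub>M exp_time_law r). fst z \<notin> ?N} \<in> sets (M \<Otimes>\<^sub>M exp_time_law r)"
      by measurable
    show "AE \<omega> in M. AE e in exp_time_law r. fst (\<omega>, e) \<notin> ?N"
      using AE_not_in[OF N] by eventually_elim simp
  qed
  then have "AE z in M \<Otimes>\<^sub>M exp_time_law r. inf_at_exp_time Y z = inf_at_exp_time X z"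
    using AE_space
  proof eventually_elim
    case (elim z)
    then show ?case
      by (cases z) (auto simp: space_pair_measure inf_at_exp_time_def running_inf_def)
  qed
  then show ?thesis unfolding with_exp_time_def by (rule AE_completion)
qed

lemma put_boundary_cong:
  assumes "AE \<omega> in M. \<forall>t. Y t \<omega> = X t \<omega>" and "0 \<le> r"
  shows "put_boundary M Y K r = put_boundary M X K r"
proof -
  have "AE z in with_exp_time M r. exp (inf_at_exp_time Y z) = exp (inf_at_exp_time X z)"
    using AE_inf_at_exp_time_cong[OF assms] by eventually_elim simp
  then have "(\<integral>z. exp (inf_at_exp_time Y z) \<partial>with_exp_time M r) = (\<integral>z. exp (inf_at_exp_time X z) \<partial>with_exp_time M r)"
    unfolding with_exp_time_def by (rule completion.integral_cong_AE_complete)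
  then show ?thesis by (simp add: put_boundary_def)
qed

lemma prob_inf_at_exp_time_zero_cong:
  assumes "AE \<omega> in M. \<forall>t. Y t \<omega> = X t \<omega>" and "0 \<le> r"
  shows "\<P>(z in with_exp_time M r. inf_at_exp_time Y z = 0) = \<P>(z in with_exp_time M r. inf_at_exp_time X z = 0)"
proof -
  have "AE z in with_exp_time M r. inf_at_exp_time Y z = 0 \<longleftrightarrow> inf_at_exp_time X z = 0"
    using AE_inf_at_exp_time_cong[OF assms] by eventually_elim simp
  then show ?thesis
    unfolding with_exp_time_def by (rule completion.measure_cong_AE_complete)
qed

end

text \<open>The identity serves as the replacement for bad paths: it starts at 0, is cadlag and
  drifts to infinity.\<close>

lemma cadlag_identity: "cadlag (\<lambda>t. t)"
  unfolding cadlag_def by (auto intro: exI[of _ "_::real"] tendsto_intros continuous_intros)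

theorem theorem6:
  fixes M :: "'a measure" and F :: "ennreal \<Rightarrow> 'a measure"
    and X :: "real \<Rightarrow> 'a \<Rightarrow> real" and K r :: real
  assumes "levy_process M F X"
    and "0 < K" and "0 \<le> r"
    and "0 < r \<or> (r = 0 \<and> \<P>(\<omega> in M. filterlim (\<lambda>t. X t \<omega>) at_top at_top) = 1)"
  defines "v \<equiv> put_value M F X K r"
    and "x_star \<equiv> put_boundary M X K r"
  shows "(v has_real_derivative
            (- exp x_star + K * \<P>(z in with_exp_time M r. inf_at_exp_time X z = 0))) (at_right x_star)
       \<and> (smooth_pasting v (put_payoff K) x_star \<longleftrightarrow> regular_below M X)"
proof -
  interpret X: levy_process M F X by fact
  have drift: "AE \<omega> in M. r = 0 \<longrightarrow> filterlim (\<lambda>t. X t \<omega>) at_top at_top"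
  proof (cases "r = 0")
    case True
    then have one: "\<P>(\<omega> in M. filterlim (\<lambda>t. X t \<omega>) at_top at_top) = 1" using assms(4) by simp
    \<comment> \<open>A set that is not measurable has measure 0 by convention, so probability 1
      already implies measurability.\<close>
    then have "{\<omega>\<in>space M. filterlim (\<lambda>t. X t \<omega>) at_top at_top} \<in> sets M"
      using measure_notin_sets by fastforce
    then have "AE \<omega> in M. filterlim (\<lambda>t. X t \<omega>) at_top at_top"
      using one by (simp add: X.prob_Collect_eq_1)
    then show ?thesis by eventually_elim simp
  qed simp
  define good where "good \<omega> \<longleftrightarrow> X 0 \<omega> = 0 \<and> cadlag (\<lambda>t. X t \<omega>) \<and>
    (r = 0 \<longrightarrow> filterlim (\<lambda>t. X t \<omega>) at_top at_top)" for \<omega>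
  define Y where "Y t \<omega> = (if good \<omega> then X t \<omega> else t)" for t \<omega>
  have eq: "AE \<omega> in M. \<forall>t. Y t \<omega> = X t \<omega>"
    using X.start_zero X.cadlag_paths drift by eventually_elim (simp add: Y_def good_def)
  interpret Y: levy_process M F Y by (rule X.levy_process_modification[OF eq])
  interpret Y: regular_path_levy M F Y r
  proof
    show "0 \<le> r" by fact
    fix \<omega>
    have cases: "good \<omega> \<and> (\<lambda>t. Y t \<omega>) = (\<lambda>t. X t \<omega>) \<or> (\<lambda>t. Y t \<omega>) = (\<lambda>t. t)"
      by (cases "good \<omega>") (simp_all add: Y_def)
    show "Y 0 \<omega> = 0" by (simp add: Y_def good_def)
    show "cadlag (\<lambda>t. Y t \<omega>)" using cases cadlag_identity by (auto simp: good_def)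
    show "filterlim (\<lambda>t. Y t \<omega>) at_top at_top" if "r = 0"
      using cases that filterlim_ident[of at_top] by (auto simp: good_def)
  qed
  have v: "put_value M F X K r = put_value M F Y K r"
    using X.put_value_cong[OF eq] by (simp add: fun_eq_iff)
  have b: "put_boundary M X K r = put_boundary M Y K r"
    using X.put_boundary_cong[OF eq \<open>0 \<le> r\<close>] by simp
  have p: "\<P>(z in with_exp_time M r. inf_at_exp_time X z = 0) = \<P>(z in Y.joint. Y.terminal_inf z = 0)"
    using X.prob_inf_at_exp_time_zero_cong[OF eq \<open>0 \<le> r\<close>] Y.prob_inf_at_exp_time_zero by simp
  have reg: "regular_below M X \<longleftrightarrow> regular_below M Y"
    using X.regular_below_cong[OF eq] by simp
  show ?thesis
    unfolding v_def x_star_def v b p reg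
    using Y.put_value_right_slope[OF \<open>0 < K\<close>] Y.smooth_pasting_iff[OF \<open>0 < K\<close>]
      Y.terminal_inf_zero_iff_regular by simp
qed

end
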